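(* Let $G$ be a topological abelian group and let $H$ be a Čech-complete topological abelian group. Suppose that $D$ is a dense subgroup of $G$ (with the subspace topology). Then $\mathrm{Ext}(G,H)\cong\mathrm{Ext}(D,H)$ (isomorphism of abelian groups).
   Context: All topological groups are Hausdorff and abelian. A topological abelian group $H$ is almost metrizable if there is a non-empty compact subset $K\subseteq H$ that has a countable base of neighbourhoods in $H$; a topological abelian group is Čech-complete if and only if it is almost metrizable and complete. An extension of topological abelian groups is a short exact sequence $E:0\to H\stackrel{\imath}{\to}X\stackrel{\pi}{\to}G\to 0$ of topological abelian groups in which $\imath,\pi$ are continuous homomorphisms that are open onto their images. Two extensions $0\to H\stackrel{\imath}{\to}X\stackrel{\pi}{\to}G\to 0$ and $0\to H\stackrel{\imath'}{\to}X'\stackrel{\pi'}{\to}G\to 0$ are equivalent if there is a continuous homomorphism $T:X\to X'$ with $T\circ\imath=\imath'$ and $\pi'\circ T=\pi$ (such a $T$ is necessarily a topological isomorphism). $\mathrm{Ext}(G,H)$ is the set of equivalence classes of such extensions. It is an abelian group under the Baer sum: $[E_1]+[E_2]$ is the class of the extension obtained from the product extension $0\to H\times H\to X_1\times X_2\to G\times G\to 0$ by pulling back along the diagonal $G\to G\times G$ and then pushing out along the addition map $H\times H\to H$ (pull-backs and push-outs taken in topological abelian groups). The zero element is the class of the trivial extension $0\to H\to H\times G\to G\to 0$. *)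

theory Defs
  imports "HOL-Analysis.Analysis" "HOL-Algebra.Coset"
begin

section \<open>Topological abelian groups\<close>

text \<open>Groups are written multiplicatively, as in HOL-Algebra.\<close>

record 'a top_group = "'a monoid" +
  topo :: "'a topology"

locale top_ab_group = comm_group G for G :: "'a top_group" (structure) +
  assumes topspace_eq: "topspace (topo G) = carrier G"
    and continuous_mult:
      "continuous_map (prod_topology (topo G) (topo G)) (topo G) (\<lambda>(x, y). x \<otimes> y)"
    and continuous_inv: "continuous_map (topo G) (topo G) (\<lambda>x. inv x)"
    and Hausdorff: "Hausdorff_space (topo G)"

definition with_topology :: "'a monoid \<Rightarrow> 'a topology \<Rightarrow> 'a top_group" where
  "with_topology G T = \<lparr>carrier = carrier G, mult = mult G, one = one G, topo = T\<rparr>"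

definition tg_sub :: "'a top_group \<Rightarrow> 'a set \<Rightarrow> 'a top_group" where
  "tg_sub G S = G\<lparr>carrier := S, topo := subtopology (topo G) S\<rparr>"

definition tg_prod :: "'a top_group \<Rightarrow> 'b top_group \<Rightarrow> ('a \<times> 'b) top_group" where
  "tg_prod G H = with_topology (G \<times>\<times> H) (prod_topology (topo G) (topo H))"

definition quotient_topology :: "'a topology \<Rightarrow> ('a \<Rightarrow> 'b) \<Rightarrow> 'b topology" where
  "quotient_topology T f =
     topology (\<lambda>U. U \<subseteq> f ` topspace T \<and> openin T {x \<in> topspace T. f x \<in> U})"

definition tg_quot :: "'a top_group \<Rightarrow> 'a set \<Rightarrow> 'a set top_group" where
  "tg_quot G N = with_topology (G Mod N) (quotient_topology (topo G) (\<lambda>x. N #>\<^bsub>G\<^esub> x))"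

definition tg_hom :: "'a top_group \<Rightarrow> 'b top_group \<Rightarrow> ('a \<Rightarrow> 'b) set" where
  "tg_hom G H = {f \<in> hom G H. continuous_map (topo G) (topo H) f}"

definition open_onto_image :: "'a top_group \<Rightarrow> 'b top_group \<Rightarrow> ('a \<Rightarrow> 'b) \<Rightarrow> bool" where
  "open_onto_image G H f \<longleftrightarrow> open_map (topo G) (subtopology (topo H) (f ` carrier G)) f"


section \<open>Almost metrizable, complete and Cech-complete groups\<close>

definition neighbourhood_of :: "'a topology \<Rightarrow> 'a set \<Rightarrow> 'a set \<Rightarrow> bool" where
  "neighbourhood_of T K N \<longleftrightarrow> N \<subseteq> topspace T \<and> (\<exists>U. openin T U \<and> K \<subseteq> U \<and> U \<subseteq> N)"

definition almost_metrizable :: "'a top_group \<Rightarrow> bool" where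
  "almost_metrizable G \<longleftrightarrow>
     (\<exists>K. K \<noteq> {} \<and> compactin (topo G) K \<and>
        (\<exists>B. countable B \<and> (\<forall>N\<in>B. neighbourhood_of (topo G) K N) \<and>
             (\<forall>M. neighbourhood_of (topo G) K M \<longrightarrow> (\<exists>N\<in>B. N \<subseteq> M))))"

text \<open>A filter on the carrier is a filter on the type lying below the principal filter of the
  carrier. For an abelian group the left and the right uniformity coincide.\<close>

definition Cauchy_filter_in :: "'a top_group \<Rightarrow> 'a filter \<Rightarrow> bool" where
  "Cauchy_filter_in G F \<longleftrightarrow>
     F \<noteq> bot \<and> F \<le> principal (carrier G) \<and>
     (\<forall>U. openin (topo G) U \<and> \<one>\<^bsub>G\<^esub> \<in> U \<longrightarrow>
        (\<forall>\<^sub>F (x, y) in F \<times>\<^sub>F F. x \<otimes>\<^bsub>G\<^esub> inv\<^bsub>G\<^esub> y \<in> U))"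

definition complete_top_group :: "'a top_group \<Rightarrow> bool" where
  "complete_top_group G \<longleftrightarrow> (\<forall>F. Cauchy_filter_in G F \<longrightarrow> (\<exists>l. limitin (topo G) (\<lambda>x. x) l F))"

definition Cech_complete :: "'a top_group \<Rightarrow> bool" where
  "Cech_complete G \<longleftrightarrow> almost_metrizable G \<and> complete_top_group G"


section \<open>Extensions\<close>

record ('h, 'x, 'g) extn =
  mid :: "'x top_group"
  inc :: "'h \<Rightarrow> 'x"
  prj :: "'x \<Rightarrow> 'g"

definition is_extension :: "'g top_group \<Rightarrow> 'h top_group \<Rightarrow> ('h, 'x, 'g) extn \<Rightarrow> bool" where
  "is_extension G H E \<longleftrightarrow>
     top_ab_group (mid E) \<and>
     inc E \<in> tg_hom H (mid E) \<and> open_onto_image H (mid E) (inc E) \<and>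
     prj E \<in> tg_hom (mid E) G \<and> open_onto_image (mid E) G (prj E) \<and>
     inj_on (inc E) (carrier H) \<and>
     inc E ` carrier H = kernel (mid E) G (prj E) \<and>
     prj E ` carrier (mid E) = carrier G"

text \<open>Only the values of the maps on the carriers matter, so the behaviour of the total HOL
  functions outside the carriers does not distinguish equivalence classes.\<close>

definition ext_equiv ::
  "'h top_group \<Rightarrow> ('h, 'x, 'g) extn \<Rightarrow> ('h, 'y, 'g) extn \<Rightarrow> bool" where
  "ext_equiv H E E' \<longleftrightarrow>
     (\<exists>T \<in> tg_hom (mid E) (mid E').
        (\<forall>h \<in> carrier H. T (inc E h) = inc E' h) \<and>
        (\<forall>x \<in> carrier (mid E). prj E' (T x) = prj E x))"

definition trivial_extension ::
  "'g top_group \<Rightarrow> 'h top_group \<Rightarrow> ('h, 'h \<times> 'g, 'g) extn" where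
  "trivial_extension G H = \<lparr>mid = tg_prod H G, inc = (\<lambda>h. (h, \<one>\<^bsub>G\<^esub>)), prj = snd\<rparr>"

definition prod_extension ::
  "('h, 'x, 'g) extn \<Rightarrow> ('k, 'y, 'l) extn \<Rightarrow> ('h \<times> 'k, 'x \<times> 'y, 'g \<times> 'l) extn" where
  "prod_extension E E' =
     \<lparr>mid = tg_prod (mid E) (mid E'), inc = map_prod (inc E) (inc E'),
      prj = map_prod (prj E) (prj E')\<rparr>"

text \<open>Pull-back of an extension along a continuous homomorphism \<open>f\<close> from \<open>G'\<close> to the quotient.\<close>

definition pullback_extension ::
  "'l top_group \<Rightarrow> ('l \<Rightarrow> 'g) \<Rightarrow> ('h, 'x, 'g) extn \<Rightarrow> ('h, 'x \<times> 'l, 'l) extn" where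
  "pullback_extension G' f E =
     \<lparr>mid = tg_sub (tg_prod (mid E) G')
               {(x, g). x \<in> carrier (mid E) \<and> g \<in> carrier G' \<and> prj E x = f g},
      inc = (\<lambda>h. (inc E h, \<one>\<^bsub>G'\<^esub>)), prj = snd\<rparr>"

text \<open>Push-out of an extension by \<open>H\<close> along a continuous homomorphism \<open>f\<close> from \<open>H\<close> to \<open>H'\<close>:
  the quotient of \<open>H' \<times> X\<close> by the antidiagonal copy of \<open>H\<close>. That subgroup is closed, so the quotient
  is Hausdorff.\<close>

definition antidiagonal ::
  "'h top_group \<Rightarrow> ('h \<Rightarrow> 'k) \<Rightarrow> ('h, 'x, 'g) extn \<Rightarrow> ('k \<times> 'x) set" where
  "antidiagonal H f E = (\<lambda>h. (f h, inv\<^bsub>mid E\<^esub> (inc E h))) ` carrier H"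

definition pushout_extension ::
  "'h top_group \<Rightarrow> 'k top_group \<Rightarrow> ('h \<Rightarrow> 'k) \<Rightarrow> ('h, 'x, 'g) extn \<Rightarrow>
     ('k, ('k \<times> 'x) set, 'g) extn" where
  "pushout_extension H H' f E =
     \<lparr>mid = tg_quot (tg_prod H' (mid E)) (antidiagonal H f E),
      inc = (\<lambda>k. antidiagonal H f E #>\<^bsub>tg_prod H' (mid E)\<^esub> (k, \<one>\<^bsub>mid E\<^esub>)),
      prj = (\<lambda>C. the_elem ((\<lambda>(k, x). prj E x) ` C))\<rparr>"

definition Baer_sum ::
  "'g top_group \<Rightarrow> 'h top_group \<Rightarrow> ('h, 'x, 'g) extn \<Rightarrow> ('h, 'y, 'g) extn \<Rightarrow>
     ('h, ('h \<times> (('x \<times> 'y) \<times> 'g)) set, 'g) extn" where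
  "Baer_sum G H E E' =
     pushout_extension (tg_prod H H) H (\<lambda>(h, k). h \<otimes>\<^bsub>H\<^esub> k)
       (pullback_extension G (\<lambda>g. (g, g)) (prod_extension E E'))"


section \<open>The group of extensions\<close>

text \<open>The middle group of an extension is in bijection with the product of the carriers of \<open>H\<close>
  and \<open>G\<close>, so every equivalence class has a representative whose middle group lives on a subset of
  the type \<open>'h \<times> 'g\<close>; see \<open>extension_representative\<close> below. Baer sums are
  brought back to this type through \<open>ext_equiv\<close>.\<close>

definition extensions ::
  "'g top_group \<Rightarrow> 'h top_group \<Rightarrow> ('h, 'h \<times> 'g, 'g) extn set" where
  "extensions G H = {E. is_extension G H E}"

definition ext_rel ::
  "'g top_group \<Rightarrow> 'h top_group \<Rightarrow> ('h, 'h \<times> 'g, 'g) extn rel" where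
  "ext_rel G H = {(E, E'). E \<in> extensions G H \<and> E' \<in> extensions G H \<and> ext_equiv H E E'}"

definition ext_class ::
  "'g top_group \<Rightarrow> 'h top_group \<Rightarrow> ('h, 'x, 'g) extn \<Rightarrow> ('h, 'h \<times> 'g, 'g) extn set" where
  "ext_class G H E = {E' \<in> extensions G H. ext_equiv H E E'}"

definition Ext ::
  "'g top_group \<Rightarrow> 'h top_group \<Rightarrow> ('h, 'h \<times> 'g, 'g) extn set monoid" where
  "Ext G H =
     \<lparr>carrier = extensions G H // ext_rel G H,
      mult = (\<lambda>A B. \<Union>E\<in>A. \<Union>E'\<in>B. ext_class G H (Baer_sum G H E E')),
      one = ext_class G H (trivial_extension G H)\<rparr>"


section \<open>Every extension has a representative on the fixed type\<close>

lemma openin_quotient_topology: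
  "openin (quotient_topology T f) U \<longleftrightarrow>
     U \<subseteq> f ` topspace T \<and> openin T {x \<in> topspace T. f x \<in> U}"
proof -
  have "istopology (\<lambda>U. U \<subseteq> f ` topspace T \<and> openin T {x \<in> topspace T. f x \<in> U})"
    unfolding istopology_def
  proof (intro conjI allI impI)
    fix S U
    assume S: "S \<subseteq> f ` topspace T \<and> openin T {x \<in> topspace T. f x \<in> S}"
      and U: "U \<subseteq> f ` topspace T \<and> openin T {x \<in> topspace T. f x \<in> U}"
    show "S \<inter> U \<subseteq> f ` topspace T" using S by blast
    have "{x \<in> topspace T. f x \<in> S \<inter> U} =
            {x \<in> topspace T. f x \<in> S} \<inter> {x \<in> topspace T. f x \<in> U}" by blast
    then show "openin T {x \<in> topspace T. f x \<in> S \<inter> U}" using S U by auto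
  next
    fix K assume K: "\<forall>S\<in>K. S \<subseteq> f ` topspace T \<and> openin T {x \<in> topspace T. f x \<in> S}"
    then show "\<Union> K \<subseteq> f ` topspace T" by blast
    have "{x \<in> topspace T. f x \<in> \<Union> K} = (\<Union>S\<in>K. {x \<in> topspace T. f x \<in> S})" by blast
    then show "openin T {x \<in> topspace T. f x \<in> \<Union> K}" using K by auto
  qed
  then show ?thesis unfolding quotient_topology_def by (simp add: topology_inverse')
qed

lemma topspace_quotient_topology: "topspace (quotient_topology T f) = f ` topspace T"
proof
  show "topspace (quotient_topology T f) \<subseteq> f ` topspace T"
    using openin_quotient_topology[of T f "topspace (quotient_topology T f)"] by simp
  have "{x \<in> topspace T. f x \<in> f ` topspace T} = topspace T" by blast
  then have "openin (quotient_topology T f) (f ` topspace T)"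
    by (simp add: openin_quotient_topology)
  then show "f ` topspace T \<subseteq> topspace (quotient_topology T f)" by (rule openin_subset)
qed

lemma quotient_map_quotient_topology: "quotient_map T (quotient_topology T f) f"
  unfolding quotient_map_def
  by (simp add: openin_quotient_topology topspace_quotient_topology)

lemma top_ab_group_transport:
  fixes X :: "'x top_group" and f :: "'x \<Rightarrow> 'y"
  assumes X: "top_ab_group X" and f: "inj_on f (carrier X)"
  defines "r \<equiv> the_inv_into (carrier X) f"
  defines "Y \<equiv> \<lparr>carrier = f ` carrier X, mult = (\<lambda>a b. f (r a \<otimes>\<^bsub>X\<^esub> r b)), one = f \<one>\<^bsub>X\<^esub>,
                topo = quotient_topology (topo X) f\<rparr>"
  shows "top_ab_group Y" and "f \<in> tg_hom X Y" and "r \<in> tg_hom Y X"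
    and "homeomorphic_maps (topo X) (topo Y) f r"
proof -
  interpret X: top_ab_group X by (rule X)
  have rf [simp]: "r (f x) = x" if "x \<in> carrier X" for x
    unfolding r_def using f that by (rule the_inv_into_f_f)
  have fr [simp]: "f (r y) = y" and rc [simp]: "r y \<in> carrier X" if "y \<in> carrier Y" for y
    using that by (auto simp: Y_def)
  have cY: "carrier Y = f ` carrier X" and oY: "\<one>\<^bsub>Y\<^esub> = f \<one>\<^bsub>X\<^esub>"
    and mY: "a \<otimes>\<^bsub>Y\<^esub> b = f (r a \<otimes>\<^bsub>X\<^esub> r b)" and tY: "topo Y = quotient_topology (topo X) f" for a b
    by (simp_all add: Y_def)
  have top: "topspace (topo Y) = carrier Y"
    by (simp add: tY cY topspace_quotient_topology X.topspace_eq)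
  have "homeomorphic_map (topo X) (topo Y) f"
    using f by (simp add: homeomorphic_map_def tY quotient_map_quotient_topology X.topspace_eq)
  then obtain g where g: "homeomorphic_maps (topo X) (topo Y) f g"
    by (auto simp: homeomorphic_map_maps)
  have "r y = g y" if "y \<in> topspace (topo Y)" for y
    using that g by (auto simp: homeomorphic_maps_def top cY X.topspace_eq)
  then show hm: "homeomorphic_maps (topo X) (topo Y) f r"
    using homeomorphic_maps_eq[OF g, of f r] by simp
  then have cf: "continuous_map (topo X) (topo Y) f" and cr: "continuous_map (topo Y) (topo X) r"
    by (auto simp: homeomorphic_maps_def)
  have fh: "f \<in> hom X Y" by (auto simp: hom_def cY mY)
  have rh: "r \<in> hom Y X" by (auto simp: hom_def cY mY)
  from fh cf show "f \<in> tg_hom X Y" by (simp add: tg_hom_def)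
  from rh cr show "r \<in> tg_hom Y X" by (simp add: tg_hom_def)
  interpret Y: comm_group Y
  proof (rule comm_groupI)
    show "\<one>\<^bsub>Y\<^esub> \<in> carrier Y" by (simp add: oY cY)
    fix x assume x: "x \<in> carrier Y"
    show "\<exists>y\<in>carrier Y. y \<otimes>\<^bsub>Y\<^esub> x = \<one>\<^bsub>Y\<^esub>"
      using x by (intro bexI[of _ "f (inv\<^bsub>X\<^esub> (r x))"]) (auto simp: mY oY cY)
  qed (auto simp: cY mY oY X.m_ac)
  show "top_ab_group Y"
  proof
    show "topspace (topo Y) = carrier Y" by (rule top)
    have "continuous_map (prod_topology (topo Y) (topo Y)) (prod_topology (topo X) (topo X))
            (\<lambda>(x, y). (r x, r y))"
      using cr by (simp add: continuous_map_prod_top)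
    from continuous_map_compose[OF continuous_map_compose[OF this X.continuous_mult] cf]
    have "continuous_map (prod_topology (topo Y) (topo Y)) (topo Y)
            (f \<circ> ((\<lambda>(x, y). x \<otimes>\<^bsub>X\<^esub> y) \<circ> (\<lambda>(x, y). (r x, r y))))" .
    then show "continuous_map (prod_topology (topo Y) (topo Y)) (topo Y) (\<lambda>(x, y). x \<otimes>\<^bsub>Y\<^esub> y)"
      by (rule continuous_map_eq) (auto simp: mY)
    have ge: "(f \<circ> ((\<lambda>x. inv\<^bsub>X\<^esub> x) \<circ> r)) y = inv\<^bsub>Y\<^esub> y" if "y \<in> topspace (topo Y)" for y
    proof -
      have y: "y \<in> carrier Y" using that top by simp
      have "f (inv\<^bsub>X\<^esub> (r y)) \<otimes>\<^bsub>Y\<^esub> y = \<one>\<^bsub>Y\<^esub>" using y by (simp add: mY oY)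
      moreover have "f (inv\<^bsub>X\<^esub> (r y)) \<in> carrier Y" using y by (simp add: cY)
      ultimately show ?thesis using y Y.inv_equality by fastforce
    qed
    from continuous_map_compose[OF continuous_map_compose[OF cr X.continuous_inv] cf]
    show "continuous_map (topo Y) (topo Y) (\<lambda>x. inv\<^bsub>Y\<^esub> x)"
      using ge by (rule continuous_map_eq)
    show "Hausdorff_space (topo Y)"
      using X.Hausdorff hm homeomorphic_Hausdorff_space homeomorphic_space_def by blast
  qed
qed

lemma extension_representative:
  fixes E :: "('h, 'x, 'g) extn"
  assumes G: "group G" and H: "group H" and E: "is_extension G H E"
  shows "\<exists>E' \<in> extensions G H. ext_equiv H E E'"
proof -
  let ?X = "mid E" and ?i = "inc E" and ?p = "prj E"
  have X: "top_ab_group ?X" and i: "?i \<in> tg_hom H ?X" and io: "open_onto_image H ?X ?i"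
    and p: "?p \<in> tg_hom ?X G" and po: "open_onto_image ?X G ?p"
    and inj: "inj_on ?i (carrier H)" and ker: "?i ` carrier H = kernel ?X G ?p"
    and sur: "?p ` carrier ?X = carrier G"
    using E by (auto simp: is_extension_def)
  interpret X: top_ab_group ?X by (rule X)
  interpret G: group G by (rule G)
  interpret p: group_hom ?X G ?p
    using p by unfold_locales (simp add: tg_hom_def)
  define s where "s = inv_into (carrier ?X) ?p"
  define f where "f x = (inv_into (carrier H) ?i (x \<otimes>\<^bsub>?X\<^esub> inv\<^bsub>?X\<^esub> s (?p x)), ?p x)" for x
  have s: "s (?p x) \<in> carrier ?X" "?p (s (?p x)) = ?p x" if "x \<in> carrier ?X" for x
    using that unfolding s_def by (auto intro: inv_into_into f_inv_into_f)
  have f: "inj_on f (carrier ?X)"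
  proof (rule inj_onI)
    fix x y assume x: "x \<in> carrier ?X" and y: "y \<in> carrier ?X" and xy: "f x = f y"
    have k: "z \<otimes>\<^bsub>?X\<^esub> inv\<^bsub>?X\<^esub> s (?p z) \<in> ?i ` carrier H" if "z \<in> carrier ?X" for z
      using that s[OF that] by (simp add: ker kernel_def)
    have "x \<otimes>\<^bsub>?X\<^esub> inv\<^bsub>?X\<^esub> s (?p x) = y \<otimes>\<^bsub>?X\<^esub> inv\<^bsub>?X\<^esub> s (?p y)"
      using xy k[OF x] k[OF y] by (auto simp: f_def dest: inv_into_injective)
    moreover have "?p x = ?p y" using xy by (simp add: f_def)
    ultimately show "x = y" using x y s[OF y] by simp
  qed
  define r where "r = the_inv_into (carrier ?X) f"
  define Y where "Y = \<lparr>carrier = f ` carrier ?X, mult = (\<lambda>a b. f (r a \<otimes>\<^bsub>?X\<^esub> r b)),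
                one = f \<one>\<^bsub>?X\<^esub>, topo = quotient_topology (topo ?X) f\<rparr>"
  note tr = top_ab_group_transport[OF X f, folded r_def, folded Y_def]
  interpret Y: top_ab_group Y by (rule tr(1))
  have rf [simp]: "r (f x) = x" if "x \<in> carrier ?X" for x
    unfolding r_def using f that by (rule the_inv_into_f_f)
  have cY: "carrier Y = f ` carrier ?X" by (simp add: Y_def)
  have fh: "f \<in> hom ?X Y" and rh: "r \<in> hom Y ?X" 
    and cf: "continuous_map (topo ?X) (topo Y) f" and cr: "continuous_map (topo Y) (topo ?X) r"
    using tr(2,3) by (auto simp: tg_hom_def)
  have of: "open_map (topo ?X) (topo Y) f" and opr: "open_map (topo Y) (topo ?X) r"
    using tr(4) by (simp_all add: homeomorphic_imp_open_map homeomorphic_maps_map)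
  have ic: "?i h \<in> carrier ?X" if "h \<in> carrier H" for h
    using i that by (auto simp: tg_hom_def hom_def)
  define E' where "E' = \<lparr>mid = Y, inc = f \<circ> ?i, prj = ?p \<circ> r\<rparr>"
  have "(?p \<circ> r) ` carrier Y = ?p ` carrier ?X"
    unfolding cY image_comp by (rule image_cong) simp_all
  then have img: "(?p \<circ> r) ` carrier Y = carrier G" using sur by simp
  have "is_extension G H E'"
    unfolding is_extension_def
  proof (intro conjI)
    show "top_ab_group (mid E')" using tr(1) by (simp add: E'_def)
    show "inc E' \<in> tg_hom H (mid E')"
      using i fh cf by (auto simp: E'_def tg_hom_def intro: hom_compose continuous_map_compose)
    show "prj E' \<in> tg_hom (mid E') G"
      using p rh cr by (auto simp: E'_def tg_hom_def intro: hom_compose continuous_map_compose)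
    show "open_onto_image (mid E') G (prj E')"
      using po opr sur img 
      by (auto simp: E'_def open_onto_image_def intro: open_map_compose)
    have "open_map (subtopology (topo ?X) (?i ` carrier H))
             (subtopology (topo Y) (f ` ?i ` carrier H)) f"
      unfolding open_map_def
    proof (intro allI impI)
      fix U assume "openin (subtopology (topo ?X) (?i ` carrier H)) U"
      then obtain V where V: "openin (topo ?X) V" "U = V \<inter> ?i ` carrier H"
        by (auto simp: openin_subtopology)
      have VX: "V \<subseteq> carrier ?X" using openin_subset[OF V(1)] X.topspace_eq by simp
      have "f ` U = f ` V \<inter> f ` ?i ` carrier H"
        unfolding V(2) using VX ic by (intro inj_on_image_Int[OF f]) auto
      moreover have "openin (topo Y) (f ` V)" using of V(1) by (simp add: open_map_def)
      ultimately show "openin (subtopology (topo Y) (f ` ?i ` carrier H)) (f ` U)"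
        by (auto simp: openin_subtopology)
    qed
    then show "open_onto_image H (mid E') (inc E')"
      using io by (auto simp: E'_def open_onto_image_def image_comp intro: open_map_compose)
    show "inj_on (inc E') (carrier H)"
      using inj f ic by (auto simp: E'_def inj_on_def)
    have "kernel Y G (?p \<circ> r) = f ` kernel ?X G ?p" by (auto simp: kernel_def cY)
    then show "inc E' ` carrier H = kernel (mid E') G (prj E')"
      by (simp add: E'_def ker[symmetric] image_comp)
    show "prj E' ` carrier (mid E') = carrier G" using img by (simp add: E'_def)
  qed
  moreover have "ext_equiv H E E'"
    unfolding ext_equiv_def using tr(2) by (auto simp: E'_def intro!: bexI[of _ f])
  ultimately show ?thesis by (auto simp: extensions_def)
qed

end

theory Submission
  imports Defs
begin

text \<open>
  Restricting an extension \<open>X\<close> of \<open>G\<close> to \<open>D\<close> means replacing the middle group by the preimage of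
  \<open>D\<close>. This is compatible with Baer sums, because the Baer sum is determined by a universal property
  (\<open>Baer_sum_equivI\<close>, \<open>Baer_sum_pairing\<close>) that survives restriction. The content of the theorem is
  that restriction is bijective on equivalence classes, and both halves follow from one construction
  that recovers \<open>X\<close> from its restriction \<open>Y\<close>.

  Since \<open>D\<close> is dense and the projection is open, \<open>Y\<close> is dense in \<open>X\<close>. Hence a point of \<open>X\<close> is
  determined by the trace of its neighbourhood filter on \<open>Y\<close>, and this trace is a minimal Cauchy
  filter on \<open>Y\<close> whose image under the projection converges in \<open>G\<close>. Now start with any extension \<open>Y\<close>
  of \<open>D\<close> and let the points be \<^emph>\<open>all\<close> minimal Cauchy filters on \<open>Y\<close> whose image converges in \<open>G\<close>:
  these form a subgroup of the Raikov completion of \<open>Y\<close>, and sending such a filter to the limit of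
  its image is a homomorphism to \<open>G\<close>. If this is an extension of \<open>G\<close> by \<open>H\<close>
  (\<open>top_extension_completion\<close>), then it restricts to \<open>Y\<close> (\<open>restrict_completion_equiv\<close>), which gives
  surjectivity; and every extension of \<open>G\<close> that restricts to \<open>Y\<close> maps to it by taking traces
  (\<open>completion_unique\<close>), which gives injectivity because morphisms of extensions are isomorphisms.

  The two parts of Cech-completeness enter in different places. Completeness of \<open>H\<close> identifies the
  kernel: if the image of a minimal Cauchy filter tends to the unit, every member of the filter meets
  \<open>H\<close>, so the filter has a trace on \<open>H\<close>, which converges (\<open>limit_of_kernel\<close>). Almost metrizability
  makes the limit map surjective (\<open>Cauchy_filter_lift\<close>). The compact set with its countable base
  yields a sequence of unit neighbourhoods of \<open>H\<close> such that for every unit neighbourhood \<open>U\<close> of \<open>H\<close>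
  some term of the sequence is covered by finitely many translates of \<open>U\<close>. A point of \<open>G\<close> can be
  approximated by a sequence in \<open>Y\<close> that is Cauchy with respect to a matching sequence of unit
  neighbourhoods of \<open>Y\<close>, as for metrizable groups; the finitely many translates that remain
  undecided at each stage are settled by passing to an ultrafilter. Openness of the limit map follows
  from the same lifting, after a correction by an element of \<open>H\<close> (\<open>limit_of_open\<close>).
\<close>

section \<open>Neighbourhoods of the unit\<close>

definition open_unit_nbhd :: "'a top_group \<Rightarrow> 'a set \<Rightarrow> bool" where
  "open_unit_nbhd G U \<longleftrightarrow> openin (topo G) U \<and> \<one>\<^bsub>G\<^esub> \<in> U"

lemma top_ab_groupI:
  fixes G :: "'a top_group" (structure)
  assumes G: "comm_group G" and top: "topspace (topo G) = carrier G"
    and mult: "\<And>U x y. \<lbrakk>openin (topo G) U; x \<in> carrier G; y \<in> carrier G; x \<otimes> y \<in> U\<rbrakk> \<Longrightarrow>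
      \<exists>V W. openin (topo G) V \<and> openin (topo G) W \<and> x \<in> V \<and> y \<in> W \<and> (\<forall>v\<in>V. \<forall>w\<in>W. v \<otimes> w \<in> U)"
    and inv: "\<And>U x. \<lbrakk>openin (topo G) U; x \<in> carrier G; inv x \<in> U\<rbrakk> \<Longrightarrow>
      \<exists>V. openin (topo G) V \<and> x \<in> V \<and> (\<forall>v\<in>V. inv v \<in> U)"
    and sep: "\<And>x y. \<lbrakk>x \<in> carrier G; y \<in> carrier G; x \<noteq> y\<rbrakk> \<Longrightarrow>
      \<exists>V W. openin (topo G) V \<and> openin (topo G) W \<and> x \<in> V \<and> y \<in> W \<and> V \<inter> W = {}"
  shows "top_ab_group G"
proof -
  interpret comm_group G by (rule G)
  show ?thesis
  proof
    show "continuous_map (prod_topology (topo G) (topo G)) (topo G) (\<lambda>(x, y). x \<otimes> y)"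
      unfolding continuous_map_def
    proof (intro conjI allI impI)
      show "(\<lambda>(x, y). x \<otimes> y) \<in> topspace (prod_topology (topo G) (topo G)) \<rightarrow> topspace (topo G)"
        by (auto simp: top)
      fix U assume U: "openin (topo G) U"
      show "openin (prod_topology (topo G) (topo G))
          {z \<in> topspace (prod_topology (topo G) (topo G)). (case z of (x, y) \<Rightarrow> x \<otimes> y) \<in> U}"
        unfolding openin_prod_topology_alt
      proof (intro allI impI)
        fix x y assume "(x, y) \<in> {z \<in> topspace (prod_topology (topo G) (topo G)).
          (case z of (x, y) \<Rightarrow> x \<otimes> y) \<in> U}"
        then have "x \<in> carrier G" "y \<in> carrier G" "x \<otimes> y \<in> U" by (auto simp: top)
        from mult[OF U this] obtain V W where VW: "openin (topo G) V" "openin (topo G) W" "x \<in> V"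
          "y \<in> W" "\<forall>v\<in>V. \<forall>w\<in>W. v \<otimes> w \<in> U" by blast
        then show "\<exists>V W. openin (topo G) V \<and> openin (topo G) W \<and> x \<in> V \<and> y \<in> W \<and>
          V \<times> W \<subseteq> {z \<in> topspace (prod_topology (topo G) (topo G)). (case z of (x, y) \<Rightarrow> x \<otimes> y) \<in> U}"
          by (intro exI[of _ V] exI[of _ W]) (auto dest: openin_subset)
      qed
    qed
    show "continuous_map (topo G) (topo G) (\<lambda>x. inv x)"
      unfolding continuous_map_def
    proof (intro conjI allI impI)
      show "(\<lambda>x. inv x) \<in> topspace (topo G) \<rightarrow> topspace (topo G)" by (auto simp: top)
      fix U assume U: "openin (topo G) U"
      show "openin (topo G) {x \<in> topspace (topo G). inv x \<in> U}"
      proof (subst openin_subopen, intro ballI)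
        fix x assume "x \<in> {x \<in> topspace (topo G). inv x \<in> U}"
        then have "x \<in> carrier G" "inv x \<in> U" by (auto simp: top)
        from inv[OF U this] obtain V where "openin (topo G) V" "x \<in> V" "\<forall>v\<in>V. inv v \<in> U" by blast
        then show "\<exists>T. openin (topo G) T \<and> x \<in> T \<and> T \<subseteq> {x \<in> topspace (topo G). inv x \<in> U}"
          by (intro exI[of _ V]) (auto dest: openin_subset)
      qed
    qed
    show "Hausdorff_space (topo G)"
      unfolding Hausdorff_space_def disjnt_def using sep by (auto simp: top)
  qed (rule top)
qed

context top_ab_group
begin

lemma openin_carrier: "openin (topo G) U \<Longrightarrow> U \<subseteq> carrier G"
  using openin_subset topspace_eq by metis

lemma openin_carrier_self: "openin (topo G) (carrier G)"
  using openin_topspace[of "topo G"] by (simp add: topspace_eq)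

lemma subtopology_carrier: "subtopology (topo G) (carrier G) = topo G"
  using subtopology_topspace[of "topo G"] by (simp add: topspace_eq)

lemma cancel_left: "\<lbrakk>x \<in> carrier G; y \<in> carrier G\<rbrakk> \<Longrightarrow> x \<otimes> (inv x \<otimes> y) = y"
  "\<lbrakk>x \<in> carrier G; y \<in> carrier G\<rbrakk> \<Longrightarrow> inv x \<otimes> (x \<otimes> y) = y"
  by (simp_all add: m_assoc[symmetric])

lemma cancel_right: "\<lbrakk>x \<in> carrier G; y \<in> carrier G\<rbrakk> \<Longrightarrow> y \<otimes> x \<otimes> inv x = y"
  "\<lbrakk>x \<in> carrier G; y \<in> carrier G\<rbrakk> \<Longrightarrow> y \<otimes> inv x \<otimes> x = y"
  by (simp_all add: m_assoc)

lemma cancel_middle: "\<lbrakk>x \<in> carrier G; y \<in> carrier G\<rbrakk> \<Longrightarrow> x \<otimes> (y \<otimes> inv x) = y"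
  "\<lbrakk>x \<in> carrier G; y \<in> carrier G\<rbrakk> \<Longrightarrow> inv x \<otimes> (y \<otimes> x) = y"
  by (simp_all add: m_comm[of y] cancel_left)

lemma mult_div_mult:
  assumes "a \<in> carrier G" "b \<in> carrier G" "c \<in> carrier G" "d \<in> carrier G"
  shows "(a \<otimes> b) \<otimes> inv (c \<otimes> d) = (a \<otimes> inv c) \<otimes> (b \<otimes> inv d)"
  using assms by (simp add: inv_mult m_ac)

lemma continuous_translation:
  assumes "a \<in> carrier G"
  shows "continuous_map (topo G) (topo G) (\<lambda>x. a \<otimes> x)"
proof -
  have "continuous_map (topo G) (prod_topology (topo G) (topo G)) (\<lambda>x. (a, x))"
    using assms by (simp add: continuous_map_pairedI topspace_eq)
  from continuous_map_compose[OF this continuous_mult] show ?thesis by (simp add: o_def)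
qed

lemma openin_translate_preimage:
  assumes "openin (topo G) U" "a \<in> carrier G"
  shows "openin (topo G) {x \<in> carrier G. a \<otimes> x \<in> U}"
  using openin_continuous_map_preimage[OF continuous_translation[OF assms(2)] assms(1)]
  by (simp add: topspace_eq)

lemma openin_translate:
  assumes "openin (topo G) U" "a \<in> carrier G"
  shows "openin (topo G) ((\<lambda>u. a \<otimes> u) ` U)"
proof -
  have "(\<lambda>u. a \<otimes> u) ` U = {x \<in> carrier G. inv a \<otimes> x \<in> U}"
    (is "?A = ?B")
  proof
    show "?A \<subseteq> ?B" using openin_carrier[OF assms(1)] assms(2) by (auto simp: cancel_left)
    show "?B \<subseteq> ?A"
    proof
      fix x assume "x \<in> ?B"
      then show "x \<in> ?A" using assms(2) by (intro image_eqI[of _ _ "inv a \<otimes> x"]) (simp_all add: cancel_left)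
    qed
  qed
  then show ?thesis using openin_translate_preimage[OF assms(1), of "inv a"] assms(2) by simp
qed

lemma mult_nbhds:
  assumes "openin (topo G) U" "x \<in> carrier G" "y \<in> carrier G" "x \<otimes> y \<in> U"
  shows "\<exists>V W. openin (topo G) V \<and> openin (topo G) W \<and> x \<in> V \<and> y \<in> W \<and> (\<forall>v\<in>V. \<forall>w\<in>W. v \<otimes> w \<in> U)"
proof -
  let ?A = "{z \<in> topspace (prod_topology (topo G) (topo G)). (case z of (x, y) \<Rightarrow> x \<otimes> y) \<in> U}"
  have "openin (prod_topology (topo G) (topo G)) ?A"
    by (rule openin_continuous_map_preimage[OF continuous_mult assms(1)])
  moreover have "(x, y) \<in> ?A"
    using assms(2-4) by (simp add: topspace_eq)
  ultimately obtain V W where VW: "openin (topo G) V" "openin (topo G) W" "x \<in> V" "y \<in> W" "V \<times> W \<subseteq> ?A"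
    unfolding openin_prod_topology_alt by meson
  then have "v \<otimes> w \<in> U" if "v \<in> V" "w \<in> W" for v w using that by auto
  then show ?thesis using VW by metis
qed

lemma openin_inv_preimage:
  assumes "openin (topo G) U"
  shows "openin (topo G) {x \<in> carrier G. inv x \<in> U}"
  using openin_continuous_map_preimage[OF continuous_inv assms] by (simp add: topspace_eq)

lemma div_nbhds:
  assumes "openin (topo G) U" "x \<in> carrier G" "y \<in> carrier G" "x \<otimes> inv y \<in> U"
  shows "\<exists>V W. openin (topo G) V \<and> openin (topo G) W \<and> x \<in> V \<and> y \<in> W \<and> (\<forall>v\<in>V. \<forall>w\<in>W. v \<otimes> inv w \<in> U)"
proof -
  obtain V W where "openin (topo G) V" "openin (topo G) W" "x \<in> V" "inv y \<in> W" "\<forall>v\<in>V. \<forall>w\<in>W. v \<otimes> w \<in> U"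
    using mult_nbhds[OF assms(1,2) inv_closed[OF assms(3)] assms(4)] by blast
  then show ?thesis using openin_inv_preimage[of W] assms(3)
    by (intro exI[of _ V] exI[of _ "{x \<in> carrier G. inv x \<in> W}"]) auto
qed

lemma unit_nbhd_carrier: "open_unit_nbhd G U \<Longrightarrow> u \<in> U \<Longrightarrow> u \<in> carrier G"
  using openin_carrier by (auto simp: open_unit_nbhd_def)

lemma unit_nbhd_univ: "open_unit_nbhd G (carrier G)"
  by (simp add: open_unit_nbhd_def openin_carrier_self)

lemma unit_nbhd_Int: "open_unit_nbhd G U \<Longrightarrow> open_unit_nbhd G V \<Longrightarrow> open_unit_nbhd G (U \<inter> V)"
  by (auto simp: open_unit_nbhd_def)

text \<open>Continuity of the operations at the unit, in the usual form: a symmetric neighbourhood whose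
  square is small. It is the group version of halving an epsilon.\<close>

lemma unit_nbhd_halve:
  assumes "open_unit_nbhd G U"
  obtains V where "open_unit_nbhd G V" "V \<subseteq> U" "\<And>v. v \<in> V \<Longrightarrow> inv v \<in> V"
    "\<And>v w. v \<in> V \<Longrightarrow> w \<in> V \<Longrightarrow> v \<otimes> w \<in> U"
proof -
  obtain V W where VW: "openin (topo G) V" "openin (topo G) W" "\<one> \<in> V" "\<one> \<in> W"
    "\<forall>v\<in>V. \<forall>w\<in>W. v \<otimes> w \<in> U"
    using mult_nbhds[of U \<one> \<one>] assms by (auto simp: open_unit_nbhd_def)
  define N where "N = V \<inter> W \<inter> {x \<in> carrier G. inv x \<in> V \<inter> W}"
  have N: "open_unit_nbhd G N" unfolding open_unit_nbhd_def N_def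
    using VW openin_inv_preimage[of "V \<inter> W"] by auto
  show thesis
  proof
    show "open_unit_nbhd G N" by (rule N)
    have "v \<in> U" if "v \<in> N" for v
    proof -
      have "v \<in> V" using that by (simp add: N_def)
      then have "v \<otimes> \<one> \<in> U" using VW(4,5) by blast
      then show ?thesis using unit_nbhd_carrier[OF N that] by simp
    qed
    then show "N \<subseteq> U" by blast
  qed (use VW in \<open>auto simp: N_def\<close>)
qed

lemma unit_nbhd_of_point:
  assumes "openin (topo G) U" "x \<in> U"
  shows "open_unit_nbhd G {u \<in> carrier G. x \<otimes> u \<in> U}"
  using assms openin_translate_preimage[OF assms(1), of x] openin_carrier[OF assms(1)]
  by (auto simp: open_unit_nbhd_def)

text \<open>By homogeneity, topological statements about groups reduce to open neighbourhoods of the unit.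
  This is the form used below for continuity (\<open>tg_homI\<close>), openness of homomorphisms
  (\<open>tg_hom_openin_image\<close>) and exactness of extensions (\<open>is_extensionI\<close>).\<close>

lemma openin_by_unit_nbhds:
  assumes "U \<subseteq> carrier G"
    and "\<And>x. x \<in> U \<Longrightarrow> \<exists>V. open_unit_nbhd G V \<and> (\<forall>v\<in>V. x \<otimes> v \<in> U)"
  shows "openin (topo G) U"
proof (subst openin_subopen, intro ballI)
  fix x assume x: "x \<in> U"
  then obtain V where V: "open_unit_nbhd G V" "\<forall>v\<in>V. x \<otimes> v \<in> U" using assms(2) by blast
  have xc: "x \<in> carrier G" using x assms(1) by blast
  have "x \<in> (\<lambda>u. x \<otimes> u) ` V" using V(1) xc by (intro image_eqI[of _ _ \<one>]) (auto simp: open_unit_nbhd_def)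
  then show "\<exists>T. openin (topo G) T \<and> x \<in> T \<and> T \<subseteq> U"
    using V openin_translate[of V x] xc by (intro exI[of _ "(\<lambda>u. x \<otimes> u) ` V"]) (auto simp: open_unit_nbhd_def)
qed

end

lemma tg_hom_unit_nbhd:
  assumes "f \<in> tg_hom G H" "top_ab_group G" "top_ab_group H" "open_unit_nbhd H V"
  shows "open_unit_nbhd G {x \<in> carrier G. f x \<in> V}"
proof -
  interpret G: top_ab_group G by fact
  interpret H: top_ab_group H by fact
  interpret f: group_hom G H f using assms(1) by unfold_locales (simp add: tg_hom_def)
  show ?thesis
    using openin_continuous_map_preimage[of "topo G" "topo H" f V] assms
    by (auto simp: open_unit_nbhd_def tg_hom_def G.topspace_eq)
qed

lemma tg_homI:
  assumes "top_ab_group G" "top_ab_group H" "f \<in> hom G H"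
    and cont: "\<And>V. open_unit_nbhd H V \<Longrightarrow> \<exists>U. open_unit_nbhd G U \<and> (\<forall>u\<in>U. f u \<in> V)"
  shows "f \<in> tg_hom G H"
proof -
  interpret G: top_ab_group G by fact
  interpret H: top_ab_group H by fact
  interpret f: group_hom G H f using assms(3) by unfold_locales
  have "openin (topo G) {x \<in> carrier G. f x \<in> V}" if V: "openin (topo H) V" for V
  proof (rule G.openin_by_unit_nbhds)
    fix x assume x: "x \<in> {x \<in> carrier G. f x \<in> V}"
    then have "open_unit_nbhd H {u \<in> carrier H. f x \<otimes>\<^bsub>H\<^esub> u \<in> V}"
      using H.unit_nbhd_of_point[OF V] by blast
    from cont[OF this] obtain U where "open_unit_nbhd G U" "\<forall>u\<in>U. f u \<in> {u \<in> carrier H. f x \<otimes>\<^bsub>H\<^esub> u \<in> V}"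
      by blast
    moreover have "u \<in> carrier G" if "u \<in> U" for u
      using G.unit_nbhd_carrier[OF \<open>open_unit_nbhd G U\<close> that] .
    ultimately show "\<exists>U. open_unit_nbhd G U \<and> (\<forall>u\<in>U. x \<otimes>\<^bsub>G\<^esub> u \<in> {x \<in> carrier G. f x \<in> V})"
      using x by (intro exI[of _ U]) simp
  qed auto
  then have "continuous_map (topo G) (topo H) f"
    by (auto simp: continuous_map_def G.topspace_eq H.topspace_eq)
  then show ?thesis using assms(3) by (simp add: tg_hom_def)
qed

lemma tg_hom_openin_image:
  assumes "top_ab_group G" "top_ab_group H" "f \<in> hom G H"
    and opn: "\<And>U. open_unit_nbhd G U \<Longrightarrow> \<exists>V. open_unit_nbhd H V \<and> V \<subseteq> f ` U"
    and U: "openin (topo G) U"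
  shows "openin (topo H) (f ` U)"
proof -
  interpret G: top_ab_group G by fact
  interpret H: top_ab_group H by fact
  interpret f: group_hom G H f using assms(3) by unfold_locales
  show ?thesis
  proof (rule H.openin_by_unit_nbhds)
    show "f ` U \<subseteq> carrier H" using G.openin_carrier[OF U] by auto
    fix y assume "y \<in> f ` U"
    then obtain x where x: "x \<in> U" "y = f x" by blast
    then have xc: "x \<in> carrier G" using G.openin_carrier[OF U] by auto
    from opn[OF G.unit_nbhd_of_point[OF U x(1)]] obtain V
      where V: "open_unit_nbhd H V" "V \<subseteq> f ` {u \<in> carrier G. x \<otimes>\<^bsub>G\<^esub> u \<in> U}" by blast
    have "y \<otimes>\<^bsub>H\<^esub> v \<in> f ` U" if "v \<in> V" for v
    proof -
      have "v \<in> f ` {u \<in> carrier G. x \<otimes>\<^bsub>G\<^esub> u \<in> U}" using V(2) that by (rule subsetD)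
      then obtain u where u: "u \<in> carrier G" "x \<otimes>\<^bsub>G\<^esub> u \<in> U" "v = f u" by blast
      then have "y \<otimes>\<^bsub>H\<^esub> v = f (x \<otimes>\<^bsub>G\<^esub> u)" using x xc by simp
      then show ?thesis using u by blast
    qed
    then show "\<exists>V. open_unit_nbhd H V \<and> (\<forall>v\<in>V. y \<otimes>\<^bsub>H\<^esub> v \<in> f ` U)" using V(1) by blast
  qed
qed

lemma tg_hom_compose: "f \<in> tg_hom G H \<Longrightarrow> g \<in> tg_hom H K \<Longrightarrow> (\<lambda>x. g (f x)) \<in> tg_hom G K"
  using hom_compose[of f G H g K] continuous_map_compose[of "topo G" "topo H" f "topo K" g]
  by (auto simp: tg_hom_def o_def)

lemma tg_hom_closed: "f \<in> tg_hom G H \<Longrightarrow> x \<in> carrier G \<Longrightarrow> f x \<in> carrier H"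
  by (auto simp: tg_hom_def hom_def)

lemma tg_hom_mult: "f \<in> tg_hom G H \<Longrightarrow> x \<in> carrier G \<Longrightarrow> y \<in> carrier G \<Longrightarrow>
    f (x \<otimes>\<^bsub>G\<^esub> y) = f x \<otimes>\<^bsub>H\<^esub> f y"
  by (auto simp: tg_hom_def hom_def)

section \<open>Extensions through unit neighbourhoods\<close>

text \<open>The embedding and openness conditions of an extension, checked only at the unit.\<close>

lemma is_extensionI:
  assumes X: "top_ab_group (mid E)" and G: "top_ab_group G" and H: "top_ab_group H"
    and i: "inc E \<in> tg_hom H (mid E)" and p: "prj E \<in> tg_hom (mid E) G"
    and emb: "\<And>U. open_unit_nbhd H U \<Longrightarrow>
      \<exists>V. open_unit_nbhd (mid E) V \<and> (\<forall>h\<in>carrier H. inc E h \<in> V \<longrightarrow> h \<in> U)"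
    and opn: "\<And>U. open_unit_nbhd (mid E) U \<Longrightarrow> \<exists>V. open_unit_nbhd G V \<and> V \<subseteq> prj E ` U"
    and inj: "\<And>h. h \<in> carrier H \<Longrightarrow> inc E h = \<one>\<^bsub>mid E\<^esub> \<Longrightarrow> h = \<one>\<^bsub>H\<^esub>"
    and pi: "\<And>h. h \<in> carrier H \<Longrightarrow> prj E (inc E h) = \<one>\<^bsub>G\<^esub>"
    and ker: "\<And>x. x \<in> carrier (mid E) \<Longrightarrow> prj E x = \<one>\<^bsub>G\<^esub> \<Longrightarrow> \<exists>h\<in>carrier H. x = inc E h"
    and surj: "\<And>g. g \<in> carrier G \<Longrightarrow> \<exists>x\<in>carrier (mid E). prj E x = g"
  shows "is_extension G H E"
proof -
  interpret X: top_ab_group "mid E" by fact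
  interpret G: top_ab_group G by fact
  interpret H: top_ab_group H by fact
  interpret i: group_hom H "mid E" "inc E" using i by unfold_locales (simp add: tg_hom_def)
  interpret p: group_hom "mid E" G "prj E" using p by unfold_locales (simp add: tg_hom_def)
  have img: "prj E ` carrier (mid E) = carrier G" using surj p.hom_closed by (auto simp: image_iff)
  have "inj_on (inc E) (carrier H)"
    using inj by (auto simp: i.inj_on_one_iff)
  moreover have "inc E ` carrier H = kernel (mid E) G (prj E)"
    using pi ker by (auto simp: kernel_def)
  moreover have "open_onto_image (mid E) G (prj E)"
  proof -
    have "openin (topo G) (prj E ` U)" if "openin (topo (mid E)) U" for U
      using tg_hom_openin_image[OF X G p.homh opn that] .
    then show ?thesis
      by (simp add: open_onto_image_def open_map_def img G.subtopology_carrier)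
  qed
  moreover have "open_onto_image H (mid E) (inc E)"
    unfolding open_onto_image_def open_map_def
  proof (intro allI impI)
    fix U assume U: "openin (topo H) U"
    define W where "W = \<Union>{W. openin (topo (mid E)) W \<and> W \<inter> inc E ` carrier H \<subseteq> inc E ` U}"
    have "inc E h \<in> W" if h: "h \<in> U" for h
    proof -
      have hc: "h \<in> carrier H" using H.openin_carrier[OF U] h by blast
      obtain V where V: "open_unit_nbhd (mid E) V"
        "\<forall>k\<in>carrier H. inc E k \<in> V \<longrightarrow> k \<in> {u \<in> carrier H. h \<otimes>\<^bsub>H\<^esub> u \<in> U}"
        using emb[OF H.unit_nbhd_of_point[OF U h]] by blast
      let ?W = "(\<lambda>u. inc E h \<otimes>\<^bsub>mid E\<^esub> u) ` V"
      have "openin (topo (mid E)) ?W"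
        using V hc by (intro X.openin_translate) (auto simp: open_unit_nbhd_def)
      moreover have "inc E h \<in> ?W"
        using V hc by (intro image_eqI[of _ _ "\<one>\<^bsub>mid E\<^esub>"]) (auto simp: open_unit_nbhd_def)
      moreover have "?W \<inter> inc E ` carrier H \<subseteq> inc E ` U"
      proof
        fix z assume "z \<in> ?W \<inter> inc E ` carrier H"
        then obtain v k where vk: "v \<in> V" "z = inc E h \<otimes>\<^bsub>mid E\<^esub> v" "k \<in> carrier H" "z = inc E k" by blast
        have "v = inc E (inv\<^bsub>H\<^esub> h \<otimes>\<^bsub>H\<^esub> k)"
          using vk hc X.unit_nbhd_carrier[OF V(1) vk(1)] X.cancel_left(2)[of "inc E h" v] by simp
        then have "h \<otimes>\<^bsub>H\<^esub> (inv\<^bsub>H\<^esub> h \<otimes>\<^bsub>H\<^esub> k) \<in> U" using V(2) vk hc by auto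
        then have "k \<in> U" using vk(3) hc H.cancel_left(1)[of h k] by (simp only:)
        then show "z \<in> inc E ` U" using vk(4) by (simp only: imageI)
      qed
      ultimately show ?thesis unfolding W_def by blast
    qed
    then have "inc E ` U = W \<inter> inc E ` carrier H"
      using H.openin_carrier[OF U] by (auto simp: W_def)
    moreover have "openin (topo (mid E)) W" unfolding W_def by blast
    ultimately show "openin (subtopology (topo (mid E)) (inc E ` carrier H)) (inc E ` U)"
      by (auto simp: openin_subtopology)
  qed
  ultimately show ?thesis using X i p img by (simp add: is_extension_def)
qed

text \<open>An extension together with its two outer groups. The middle group, the inclusion and the
  projection are available with prefixes \<open>X\<close>, \<open>i\<close> and \<open>p\<close>.\<close>

locale top_extension =
  fixes G :: "'g top_group" and H :: "'h top_group" and E :: "('h, 'x, 'g) extn"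
  assumes G: "top_ab_group G" and H: "top_ab_group H" and ext: "is_extension G H E"

sublocale top_extension \<subseteq> X: top_ab_group "mid E"
  using ext by (simp add: is_extension_def)

sublocale top_extension \<subseteq> G: top_ab_group G by (rule G)

sublocale top_extension \<subseteq> H: top_ab_group H by (rule H)

sublocale top_extension \<subseteq> i: group_hom H "mid E" "inc E"
  using ext by unfold_locales (auto simp: is_extension_def tg_hom_def)

sublocale top_extension \<subseteq> p: group_hom "mid E" G "prj E"
  using ext by unfold_locales (auto simp: is_extension_def tg_hom_def)

context top_extension
begin

lemma inc_tg_hom: "inc E \<in> tg_hom H (mid E)" and prj_tg_hom: "prj E \<in> tg_hom (mid E) G"
  using ext by (auto simp: is_extension_def)

lemma inc_eqD: "h \<in> carrier H \<Longrightarrow> k \<in> carrier H \<Longrightarrow> inc E h = inc E k \<Longrightarrow> h = k"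
  using ext by (auto simp: is_extension_def inj_on_def)

lemma prj_inc [simp]: "h \<in> carrier H \<Longrightarrow> prj E (inc E h) = \<one>\<^bsub>G\<^esub>"
  using ext by (auto simp: is_extension_def kernel_def)

lemma prj_eq_one: "x \<in> carrier (mid E) \<Longrightarrow> prj E x = \<one>\<^bsub>G\<^esub> \<Longrightarrow> \<exists>h\<in>carrier H. x = inc E h"
  using ext by (auto simp: is_extension_def kernel_def)

lemma prj_eq:
  assumes "x \<in> carrier (mid E)" "y \<in> carrier (mid E)" "prj E x = prj E y"
  obtains h where "h \<in> carrier H" "x = y \<otimes>\<^bsub>mid E\<^esub> inc E h"
proof -
  have "prj E (inv\<^bsub>mid E\<^esub> y \<otimes>\<^bsub>mid E\<^esub> x) = \<one>\<^bsub>G\<^esub>" using assms by simp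
  then obtain h where "h \<in> carrier H" "inv\<^bsub>mid E\<^esub> y \<otimes>\<^bsub>mid E\<^esub> x = inc E h"
    using prj_eq_one[of "inv\<^bsub>mid E\<^esub> y \<otimes>\<^bsub>mid E\<^esub> x"] assms by auto
  moreover from this have "x = y \<otimes>\<^bsub>mid E\<^esub> inc E h"
    using X.cancel_left(1)[of y x] assms by simp
  ultimately show thesis by (intro that)
qed

lemma prj_surj:
  assumes "g \<in> carrier G"
  shows "\<exists>x\<in>carrier (mid E). prj E x = g"
proof -
  have "g \<in> prj E ` carrier (mid E)" using ext assms unfolding is_extension_def by simp
  then show ?thesis by blast
qed

lemma openin_prj_image:
  assumes "openin (topo (mid E)) U"
  shows "openin (topo G) (prj E ` U)"
proof -
  have "openin (subtopology (topo G) (carrier G)) (prj E ` U)"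
    using ext assms by (auto simp: is_extension_def open_onto_image_def open_map_def)
  then show ?thesis by (simp only: G.subtopology_carrier)
qed

lemma unit_nbhd_prj: "open_unit_nbhd (mid E) U \<Longrightarrow> open_unit_nbhd G (prj E ` U)"
  using openin_prj_image[of U] by (auto simp: open_unit_nbhd_def image_iff intro!: bexI[of _ "\<one>\<^bsub>mid E\<^esub>"])

lemma unit_nbhd_inc:
  assumes "open_unit_nbhd H U"
  shows "\<exists>V. open_unit_nbhd (mid E) V \<and> (\<forall>h\<in>carrier H. inc E h \<in> V \<longrightarrow> h \<in> U)"
proof -
  have U: "openin (topo H) U" "\<one>\<^bsub>H\<^esub> \<in> U" using assms by (auto simp: open_unit_nbhd_def)
  then have "openin (subtopology (topo (mid E)) (inc E ` carrier H)) (inc E ` U)"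
    using ext by (auto simp: is_extension_def open_onto_image_def open_map_def)
  then obtain V where V: "openin (topo (mid E)) V" "inc E ` U = V \<inter> inc E ` carrier H"
    by (auto simp: openin_subtopology)
  show ?thesis
  proof (intro exI conjI ballI impI)
    have "inc E \<one>\<^bsub>H\<^esub> \<in> V" using V U by blast
    then show "open_unit_nbhd (mid E) V" using V by (simp add: open_unit_nbhd_def)
    fix h assume h: "h \<in> carrier H" "inc E h \<in> V"
    then obtain k where "k \<in> U" "inc E h = inc E k" using V by blast
    then show "h \<in> U" using inc_eqD[OF h(1)] H.openin_carrier[OF U(1)] by blast
  qed
qed

end

section \<open>Equivalence of extensions\<close>

lemma ext_equiv_refl: "ext_equiv H E E"
proof -
  have "(\<lambda>x. x) \<in> tg_hom (mid E) (mid E)" by (auto simp: tg_hom_def hom_def)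
  then show ?thesis unfolding ext_equiv_def by (intro bexI[of _ "\<lambda>x. x"]) auto
qed

lemma ext_equiv_trans:
  assumes "ext_equiv H E E'" "ext_equiv H E' E''"
  shows "ext_equiv H E E''"
proof -
  from assms obtain S T where ST: "S \<in> tg_hom (mid E) (mid E')" "T \<in> tg_hom (mid E') (mid E'')"
    "\<forall>h \<in> carrier H. S (inc E h) = inc E' h" "\<forall>h \<in> carrier H. T (inc E' h) = inc E'' h"
    "\<forall>x \<in> carrier (mid E). prj E' (S x) = prj E x" "\<forall>x \<in> carrier (mid E'). prj E'' (T x) = prj E' x"
    unfolding ext_equiv_def by blast
  then show ?thesis unfolding ext_equiv_def
    using tg_hom_compose[OF ST(1,2)] tg_hom_closed[OF ST(1)]
    by (intro bexI[of _ "\<lambda>x. T (S x)"]) auto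
qed

text \<open>The topological five lemma. For openness let \<open>U\<close> be a unit neighbourhood upstairs. A point \<open>y\<close>
  near the unit of the target projects close to the unit of \<open>G\<close>, so it has the same projection as
  \<open>T v\<close> for a small \<open>v\<close>; the quotient of \<open>y\<close> by \<open>T v\<close> is then a small element of \<open>H\<close>, and small
  elements of \<open>H\<close> are small in both middle groups, which carry the same topology on \<open>H\<close>.\<close>

lemma ext_morphism_homeomorphic:
  assumes E: "top_extension G H E" and E': "top_extension G H E'"
    and T: "T \<in> tg_hom (mid E) (mid E')"
    and Ti: "\<And>h. h \<in> carrier H \<Longrightarrow> T (inc E h) = inc E' h"
    and Tp: "\<And>x. x \<in> carrier (mid E) \<Longrightarrow> prj E' (T x) = prj E x"
  shows "bij_betw T (carrier (mid E)) (carrier (mid E'))"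
    and "\<And>U. openin (topo (mid E)) U \<Longrightarrow> openin (topo (mid E')) (T ` U)"
proof -
  interpret E: top_extension G H E by fact
  interpret E': top_extension G H E' by fact
  interpret T: group_hom "mid E" "mid E'" T using T by unfold_locales (simp add: tg_hom_def)
  have "x = \<one>\<^bsub>mid E\<^esub>" if x: "x \<in> carrier (mid E)" "T x = \<one>\<^bsub>mid E'\<^esub>" for x
  proof -
    have "prj E x = \<one>\<^bsub>G\<^esub>" using Tp[OF x(1)] x(2) by simp
    then obtain h where h: "h \<in> carrier H" "x = inc E h" using E.prj_eq_one x by blast
    then have "inc E' h = inc E' \<one>\<^bsub>H\<^esub>" using Ti x by simp
    then show ?thesis using E'.inc_eqD[OF h(1), of "\<one>\<^bsub>H\<^esub>"] h by simp
  qed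
  then have "inj_on T (carrier (mid E))" by (auto simp: T.inj_on_one_iff)
  moreover have "y \<in> T ` carrier (mid E)" if y: "y \<in> carrier (mid E')" for y
  proof -
    obtain x where x: "x \<in> carrier (mid E)" "prj E x = prj E' y"
      using E.prj_surj[OF E'.p.hom_closed[OF y]] by blast
    then have "prj E' y = prj E' (T x)" using Tp by simp
    from E'.prj_eq[OF y T.hom_closed[OF x(1)] this]
    obtain h where h: "h \<in> carrier H" "y = T x \<otimes>\<^bsub>mid E'\<^esub> inc E' h" .
    then have "y = T (x \<otimes>\<^bsub>mid E\<^esub> inc E h)" using x Ti by simp
    moreover have "x \<otimes>\<^bsub>mid E\<^esub> inc E h \<in> carrier (mid E)" using x h by simp
    ultimately show ?thesis by (rule image_eqI)
  qed
  ultimately show "bij_betw T (carrier (mid E)) (carrier (mid E'))"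
    by (auto simp: bij_betw_def)
  show "openin (topo (mid E')) (T ` U)" if "openin (topo (mid E)) U" for U
  proof (rule tg_hom_openin_image[OF E.X.top_ab_group_axioms E'.X.top_ab_group_axioms T.homh _ that])
    fix U assume "open_unit_nbhd (mid E) U"
    then obtain V where V: "open_unit_nbhd (mid E) V" "\<And>v w. v \<in> V \<Longrightarrow> w \<in> V \<Longrightarrow> v \<otimes>\<^bsub>mid E\<^esub> w \<in> U"
      using E.X.unit_nbhd_halve by metis
    from E'.unit_nbhd_inc[OF tg_hom_unit_nbhd[OF E.inc_tg_hom E.H E.X.top_ab_group_axioms V(1)]]
    obtain W where W: "open_unit_nbhd (mid E') W"
      "\<forall>h\<in>carrier H. inc E' h \<in> W \<longrightarrow> h \<in> {h \<in> carrier H. inc E h \<in> V}" by (elim exE conjE)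
    obtain N where N: "open_unit_nbhd (mid E') N" "\<And>v. v \<in> N \<Longrightarrow> inv\<^bsub>mid E'\<^esub> v \<in> N"
      "\<And>v w. v \<in> N \<Longrightarrow> w \<in> N \<Longrightarrow> v \<otimes>\<^bsub>mid E'\<^esub> w \<in> W"
      using E'.X.unit_nbhd_halve[OF W(1)] by metis
    define M where "M = V \<inter> {x \<in> carrier (mid E). T x \<in> N}"
    have M: "open_unit_nbhd (mid E) M" unfolding M_def
      by (intro E.X.unit_nbhd_Int V(1) tg_hom_unit_nbhd[OF T E.X.top_ab_group_axioms E'.X.top_ab_group_axioms N(1)])
    define O' where "O' = N \<inter> {y \<in> carrier (mid E'). prj E' y \<in> prj E ` M}"
    have "open_unit_nbhd (mid E') O'" unfolding O'_def
      by (intro E'.X.unit_nbhd_Int N(1) tg_hom_unit_nbhd[OF E'.prj_tg_hom E'.X.top_ab_group_axioms E'.G]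
          E.unit_nbhd_prj M)
    moreover have "O' \<subseteq> T ` U"
    proof
      fix y assume "y \<in> O'"
      then obtain v where v: "y \<in> N" "y \<in> carrier (mid E')" "v \<in> V" "v \<in> carrier (mid E)" "T v \<in> N" 
        "prj E' y = prj E v" by (auto simp: O'_def M_def)
      have "prj E' y = prj E' (T v)" using v Tp by simp
      from E'.prj_eq[OF v(2) T.hom_closed[OF v(4)] this]
      obtain h where h: "h \<in> carrier H" "y = T v \<otimes>\<^bsub>mid E'\<^esub> inc E' h" .
      have "inc E' h = inv\<^bsub>mid E'\<^esub> (T v) \<otimes>\<^bsub>mid E'\<^esub> y" using h v E'.X.cancel_left by simp
      then have "inc E' h \<in> W" using N v by simp
      then have "inc E h \<in> V" using W(2) h(1) by simp
      then have "v \<otimes>\<^bsub>mid E\<^esub> inc E h \<in> U" using V(2) v(3) by simp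
      moreover have "y = T (v \<otimes>\<^bsub>mid E\<^esub> inc E h)" using h v Ti by simp
      ultimately show "y \<in> T ` U" by (simp only: imageI)
    qed
    ultimately show "\<exists>V. open_unit_nbhd (mid E') V \<and> V \<subseteq> T ` U" by blast
  qed
qed

lemma ext_equiv_sym:
  assumes E: "top_extension G H E" and E': "top_extension G H E'" and eq: "ext_equiv H E E'"
  shows "ext_equiv H E' E"
proof -
  interpret E: top_extension G H E by fact
  interpret E': top_extension G H E' by fact
  from eq obtain T where T: "T \<in> tg_hom (mid E) (mid E')"
    and Ti: "\<And>h. h \<in> carrier H \<Longrightarrow> T (inc E h) = inc E' h"
    and Tp: "\<And>x. x \<in> carrier (mid E) \<Longrightarrow> prj E' (T x) = prj E x"
    unfolding ext_equiv_def by blast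
  note bij = ext_morphism_homeomorphic(1)[OF E E' T Ti Tp]
  note opn = ext_morphism_homeomorphic(2)[OF E E' T Ti Tp]
  define S where "S = inv_into (carrier (mid E)) T"
  have ST: "S (T x) = x" if "x \<in> carrier (mid E)" for x
    using bij that by (simp add: S_def bij_betw_inv_into_left)
  have TS: "T (S y) = y" "S y \<in> carrier (mid E)" if "y \<in> carrier (mid E')" for y
    using bij that by (auto simp: S_def bij_betw_inv_into_right bij_betw_def inv_into_into)
  have "T \<in> iso (mid E) (mid E')" using T bij by (simp add: iso_def tg_hom_def)
  then have "S \<in> iso (mid E') (mid E)" unfolding S_def by (rule E.X.iso_set_sym)
  then have Sh: "S \<in> hom (mid E') (mid E)" by (simp add: iso_def)
  have "S \<in> tg_hom (mid E') (mid E)"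
  proof (rule tg_homI[OF E'.X.top_ab_group_axioms E.X.top_ab_group_axioms Sh])
    fix V assume V: "open_unit_nbhd (mid E) V"
    have "T \<one>\<^bsub>mid E\<^esub> = \<one>\<^bsub>mid E'\<^esub>" using Ti[of "\<one>\<^bsub>H\<^esub>"] by simp
    then have "open_unit_nbhd (mid E') (T ` V)" using V opn[of V]
      unfolding open_unit_nbhd_def by (metis imageI)
    then show "\<exists>U. open_unit_nbhd (mid E') U \<and> (\<forall>u\<in>U. S u \<in> V)"
      using ST E.X.unit_nbhd_carrier[OF V] by (intro exI[of _ "T ` V"]) auto
  qed
  moreover have "S (inc E' h) = inc E h" if "h \<in> carrier H" for h
    using ST[of "inc E h"] Ti that by simp
  moreover have "prj E (S y) = prj E' y" if "y \<in> carrier (mid E')" for y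
    using TS[OF that] Tp[of "S y"] by simp
  ultimately show ?thesis unfolding ext_equiv_def by blast
qed

section \<open>Subgroups, products and quotients\<close>

lemma tg_sub_simps [simp]:
  "carrier (tg_sub G S) = S" "mult (tg_sub G S) = mult G" "one (tg_sub G S) = one G"
  "topo (tg_sub G S) = subtopology (topo G) S"
  by (simp_all add: tg_sub_def)

lemma tg_prod_simps [simp]:
  "carrier (tg_prod G H) = carrier G \<times> carrier H"
  "mult (tg_prod G H) (a, b) (c, d) = (a \<otimes>\<^bsub>G\<^esub> c, b \<otimes>\<^bsub>H\<^esub> d)"
  "one (tg_prod G H) = (\<one>\<^bsub>G\<^esub>, \<one>\<^bsub>H\<^esub>)"
  "topo (tg_prod G H) = prod_topology (topo G) (topo H)"
  by (simp_all add: tg_prod_def with_topology_def DirProd_def)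

lemma inv_tg_sub:
  assumes "top_ab_group G" "subgroup S G" "x \<in> S"
  shows "inv\<^bsub>tg_sub G S\<^esub> x = inv\<^bsub>G\<^esub> x"
proof -
  interpret top_ab_group G by fact
  have "m_inv (tg_sub G S) x = m_inv (G\<lparr>carrier := S\<rparr>) x" by (simp add: m_inv_def tg_sub_def)
  then show ?thesis using m_inv_consistent[OF assms(2,3)] by simp
qed

lemma top_ab_group_sub:
  assumes G: "top_ab_group G" and S: "subgroup S G"
  shows "top_ab_group (tg_sub G S)"
proof -
  interpret G: top_ab_group G by fact
  interpret S: subgroup S G by fact
  have SG: "x \<in> carrier G" if "x \<in> S" for x using S.subset that by blast
  have inv_S: "inv\<^bsub>tg_sub G S\<^esub> x = inv\<^bsub>G\<^esub> x" if "x \<in> S" for x by (rule inv_tg_sub[OF G S that])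
  show ?thesis
  proof (rule top_ab_groupI)
    show "comm_group (tg_sub G S)"
      by (rule comm_groupI) (auto simp: SG G.m_ac intro!: bexI[of _ "inv\<^bsub>G\<^esub> _"])
    show "topspace (topo (tg_sub G S)) = carrier (tg_sub G S)"
      using SG by (auto simp: G.topspace_eq)
  next
    fix U x y assume "openin (topo (tg_sub G S)) U" and xy: "x \<in> carrier (tg_sub G S)"
      "y \<in> carrier (tg_sub G S)" "x \<otimes>\<^bsub>tg_sub G S\<^esub> y \<in> U"
    then obtain U' where U': "openin (topo G) U'" "U = U' \<inter> S" by (auto simp: openin_subtopology)
    then have "x \<in> carrier G" "y \<in> carrier G" "x \<otimes>\<^bsub>G\<^esub> y \<in> U'" using xy SG by auto
    from G.mult_nbhds[OF U'(1) this] obtain V W where VW: "openin (topo G) V" "openin (topo G) W"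
      "x \<in> V" "y \<in> W" "\<forall>v\<in>V. \<forall>w\<in>W. v \<otimes>\<^bsub>G\<^esub> w \<in> U'" by blast
    then show "\<exists>V W. openin (topo (tg_sub G S)) V \<and> openin (topo (tg_sub G S)) W \<and> x \<in> V \<and> y \<in> W \<and>
      (\<forall>v\<in>V. \<forall>w\<in>W. v \<otimes>\<^bsub>tg_sub G S\<^esub> w \<in> U)"
      using U'(2) xy by (intro exI[of _ "V \<inter> S"] exI[of _ "W \<inter> S"]) (auto simp: openin_subtopology)
  next
    fix U x assume "openin (topo (tg_sub G S)) U" and x: "x \<in> carrier (tg_sub G S)" "inv\<^bsub>tg_sub G S\<^esub> x \<in> U"
    then obtain U' where U': "openin (topo G) U'" "U = U' \<inter> S" by (auto simp: openin_subtopology)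
    then show "\<exists>V. openin (topo (tg_sub G S)) V \<and> x \<in> V \<and> (\<forall>v\<in>V. inv\<^bsub>tg_sub G S\<^esub> v \<in> U)"
      using x G.openin_inv_preimage[OF U'(1)] SG inv_S
      by (intro exI[of _ "{x \<in> carrier G. inv\<^bsub>G\<^esub> x \<in> U'} \<inter> S"]) (auto simp: openin_subtopology)
  next
    fix x y assume "x \<in> carrier (tg_sub G S)" "y \<in> carrier (tg_sub G S)" "x \<noteq> y"
    moreover have "Hausdorff_space (topo (tg_sub G S))"
      using G.Hausdorff by (simp add: Hausdorff_space_subtopology)
    ultimately show "\<exists>V W. openin (topo (tg_sub G S)) V \<and> openin (topo (tg_sub G S)) W \<and> x \<in> V \<and> y \<in> W \<and> V \<inter> W = {}"
      using SG unfolding Hausdorff_space_def disjnt_def by (simp add: G.topspace_eq)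
  qed
qed

lemma tg_hom_into_sub:
  "f \<in> tg_hom G K \<Longrightarrow> f ` carrier G \<subseteq> S \<Longrightarrow> topspace (topo G) = carrier G \<Longrightarrow> f \<in> tg_hom G (tg_sub K S)"
  by (auto simp: tg_hom_def hom_def continuous_map_in_subtopology)

lemma tg_hom_from_sub:
  "f \<in> tg_hom G K \<Longrightarrow> S \<subseteq> carrier G \<Longrightarrow> f \<in> tg_hom (tg_sub G S) K"
  by (auto simp: tg_hom_def hom_def continuous_map_from_subtopology)

lemma unit_nbhd_sub: "open_unit_nbhd G V \<Longrightarrow> \<one>\<^bsub>G\<^esub> \<in> S \<Longrightarrow> open_unit_nbhd (tg_sub G S) (V \<inter> S)"
  by (auto simp: open_unit_nbhd_def openin_subtopology)

lemma unit_nbhd_subE: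
  assumes "open_unit_nbhd (tg_sub G S) U"
  obtains V where "open_unit_nbhd G V" "U = V \<inter> S"
  using assms by (auto simp: open_unit_nbhd_def openin_subtopology)

lemma unit_nbhd_prod:
  "open_unit_nbhd G V \<Longrightarrow> open_unit_nbhd H W \<Longrightarrow> open_unit_nbhd (tg_prod G H) (V \<times> W)"
  by (auto simp: open_unit_nbhd_def openin_prod_Times_iff)

lemma unit_nbhd_prodE:
  assumes "open_unit_nbhd (tg_prod G H) U"
  obtains V W where "open_unit_nbhd G V" "open_unit_nbhd H W" "V \<times> W \<subseteq> U"
  using assms unfolding open_unit_nbhd_def tg_prod_simps openin_prod_topology_alt by meson

lemma comm_group_tg_prod:
  assumes "comm_group G" "comm_group H"
  shows "comm_group (tg_prod G H)"
proof -
  interpret G: comm_group G by fact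
  interpret H: comm_group H by fact
  show ?thesis
  proof (rule comm_groupI)
    fix x assume "x \<in> carrier (tg_prod G H)"
    then show "\<exists>y\<in>carrier (tg_prod G H). y \<otimes>\<^bsub>tg_prod G H\<^esub> x = \<one>\<^bsub>tg_prod G H\<^esub>"
      by (intro bexI[of _ "(inv\<^bsub>G\<^esub> fst x, inv\<^bsub>H\<^esub> snd x)"]) auto
  qed (auto simp: G.m_ac H.m_ac)
qed

lemma inv_tg_prod:
  assumes "comm_group G" "comm_group H" "x \<in> carrier G" "y \<in> carrier H"
  shows "inv\<^bsub>tg_prod G H\<^esub> (x, y) = (inv\<^bsub>G\<^esub> x, inv\<^bsub>H\<^esub> y)"
proof -
  interpret G: comm_group G by fact
  interpret H: comm_group H by fact
  interpret P: comm_group "tg_prod G H" by (rule comm_group_tg_prod) fact+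
  show ?thesis using assms(3,4) by (intro P.inv_equality) auto
qed

lemma top_ab_group_prod:
  assumes G: "top_ab_group G" and H: "top_ab_group H"
  shows "top_ab_group (tg_prod G H)"
proof -
  interpret G: top_ab_group G by fact
  interpret H: top_ab_group H by fact
  note cg = G.comm_group_axioms H.comm_group_axioms
  show ?thesis
  proof (rule top_ab_groupI)
    show "comm_group (tg_prod G H)" by (rule comm_group_tg_prod) (rule cg)+
    show "topspace (topo (tg_prod G H)) = carrier (tg_prod G H)"
      by (simp add: G.topspace_eq H.topspace_eq)
  next
    fix U x y assume U: "openin (topo (tg_prod G H)) U" and xy: "x \<in> carrier (tg_prod G H)"
      "y \<in> carrier (tg_prod G H)" "x \<otimes>\<^bsub>tg_prod G H\<^esub> y \<in> U"
    obtain a b c d where abcd: "x = (a, b)" "y = (c, d)" by (cases x, cases y)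
    have cc: "a \<in> carrier G" "b \<in> carrier H" "c \<in> carrier G" "d \<in> carrier H"
      "(a \<otimes>\<^bsub>G\<^esub> c, b \<otimes>\<^bsub>H\<^esub> d) \<in> U" using xy abcd by auto
    obtain A B where AB: "openin (topo G) A" "openin (topo H) B" "a \<otimes>\<^bsub>G\<^esub> c \<in> A" "b \<otimes>\<^bsub>H\<^esub> d \<in> B" "A \<times> B \<subseteq> U"
      using U cc(5) unfolding tg_prod_simps openin_prod_topology_alt by meson
    obtain V W where VW: "openin (topo G) V" "openin (topo G) W"
      "a \<in> V" "c \<in> W" "\<forall>v\<in>V. \<forall>w\<in>W. v \<otimes>\<^bsub>G\<^esub> w \<in> A" using G.mult_nbhds[OF AB(1) cc(1,3) AB(3)] by blast
    obtain V' W' where VW': "openin (topo H) V'" "openin (topo H) W'"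
      "b \<in> V'" "d \<in> W'" "\<forall>v\<in>V'. \<forall>w\<in>W'. v \<otimes>\<^bsub>H\<^esub> w \<in> B" using H.mult_nbhds[OF AB(2) cc(2,4) AB(4)] by blast
    have "(\<forall>v\<in>V \<times> V'. \<forall>w\<in>W \<times> W'. v \<otimes>\<^bsub>tg_prod G H\<^esub> w \<in> U)"
      using VW(5) VW'(5) AB(5) by auto
    then show "\<exists>V W. openin (topo (tg_prod G H)) V \<and> openin (topo (tg_prod G H)) W \<and> x \<in> V \<and> y \<in> W \<and>
      (\<forall>v\<in>V. \<forall>w\<in>W. v \<otimes>\<^bsub>tg_prod G H\<^esub> w \<in> U)"
      using VW VW' abcd by (intro exI[of _ "V \<times> V'"] exI[of _ "W \<times> W'"]) (simp add: openin_prod_Times_iff)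
  next
    fix U x assume U: "openin (topo (tg_prod G H)) U" and x: "x \<in> carrier (tg_prod G H)"
      "inv\<^bsub>tg_prod G H\<^esub> x \<in> U"
    obtain a b where ab: "x = (a, b)" by (cases x)
    then have cc: "a \<in> carrier G" "b \<in> carrier H" "(inv\<^bsub>G\<^esub> a, inv\<^bsub>H\<^esub> b) \<in> U"
      using x by (auto simp: inv_tg_prod[OF cg])
    obtain A B where AB: "openin (topo G) A" "openin (topo H) B" "inv\<^bsub>G\<^esub> a \<in> A" "inv\<^bsub>H\<^esub> b \<in> B" "A \<times> B \<subseteq> U"
      using U cc(3) unfolding tg_prod_simps openin_prod_topology_alt by meson
    show "\<exists>V. openin (topo (tg_prod G H)) V \<and> x \<in> V \<and> (\<forall>v\<in>V. inv\<^bsub>tg_prod G H\<^esub> v \<in> U)"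
      using AB(5) G.openin_inv_preimage[OF AB(1)] H.openin_inv_preimage[OF AB(2)] AB(3,4) ab cc
      by (intro exI[of _ "{x \<in> carrier G. inv\<^bsub>G\<^esub> x \<in> A} \<times> {x \<in> carrier H. inv\<^bsub>H\<^esub> x \<in> B}"])
        (auto simp: openin_prod_Times_iff inv_tg_prod[OF cg])
  next
    fix x y assume "x \<in> carrier (tg_prod G H)" "y \<in> carrier (tg_prod G H)" "x \<noteq> y"
    moreover have "Hausdorff_space (topo (tg_prod G H))"
      using G.Hausdorff H.Hausdorff by (simp add: Hausdorff_space_prod_topology)
    ultimately show "\<exists>V W. openin (topo (tg_prod G H)) V \<and> openin (topo (tg_prod G H)) W \<and> x \<in> V \<and> y \<in> W \<and> V \<inter> W = {}"
      unfolding Hausdorff_space_def disjnt_def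
      by (simp only: tg_prod_simps topspace_prod_topology G.topspace_eq H.topspace_eq) meson
  qed
qed

lemma tg_hom_pair:
  assumes "f \<in> tg_hom G H" "g \<in> tg_hom G K"
  shows "(\<lambda>x. (f x, g x)) \<in> tg_hom G (tg_prod H K)"
  using assms by (auto simp: tg_hom_def hom_def continuous_map_pairedI)

lemma tg_hom_fst: "top_ab_group G \<Longrightarrow> top_ab_group H \<Longrightarrow> fst \<in> tg_hom (tg_prod G H) G"
  and tg_hom_snd: "top_ab_group G \<Longrightarrow> top_ab_group H \<Longrightarrow> snd \<in> tg_hom (tg_prod G H) H"
  by (auto simp: tg_hom_def hom_def continuous_map_fst continuous_map_snd)

lemma tg_hom_prod_mult:
  assumes G: "top_ab_group G" and f: "f \<in> tg_hom K G" and g: "g \<in> tg_hom K G"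
  shows "(\<lambda>x. f x \<otimes>\<^bsub>G\<^esub> g x) \<in> tg_hom K G"
proof -
  interpret G: top_ab_group G by fact
  have "continuous_map (topo K) (prod_topology (topo G) (topo G)) (\<lambda>x. (f x, g x))"
    using f g by (simp add: tg_hom_def continuous_map_pairedI)
  from continuous_map_compose[OF this G.continuous_mult]
  have "continuous_map (topo K) (topo G) (\<lambda>x. f x \<otimes>\<^bsub>G\<^esub> g x)" by (simp add: o_def)
  moreover have "(a \<otimes>\<^bsub>G\<^esub> b) \<otimes>\<^bsub>G\<^esub> (c \<otimes>\<^bsub>G\<^esub> d) = (a \<otimes>\<^bsub>G\<^esub> c) \<otimes>\<^bsub>G\<^esub> (b \<otimes>\<^bsub>G\<^esub> d)"
    if "a \<in> carrier G" "b \<in> carrier G" "c \<in> carrier G" "d \<in> carrier G" for a b c d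
    using that by (simp add: G.m_ac)
  ultimately show ?thesis using f g by (simp add: tg_hom_def hom_def Pi_iff)
qed

lemma tg_quot_simps [simp]:
  "carrier (tg_quot G N) = carrier (G Mod N)" "mult (tg_quot G N) = mult (G Mod N)"
  "one (tg_quot G N) = one (G Mod N)"
  "topo (tg_quot G N) = quotient_topology (topo G) (\<lambda>x. N #>\<^bsub>G\<^esub> x)"
  by (simp_all add: tg_quot_def with_topology_def)

text \<open>The assumption says that \<open>N\<close> is closed: it asks that a point outside \<open>N\<close> stays outside
  the thickening of \<open>N\<close> by some unit neighbourhood. In this form it can be checked directly for the antidiagonal.\<close>

locale tg_quotient = top_ab_group G + subgroup N G for G :: "'a top_group" (structure) and N +
  assumes closed: "\<And>x. x \<in> carrier G \<Longrightarrow> x \<notin> N \<Longrightarrow>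
    \<exists>O'. open_unit_nbhd G O' \<and> (\<forall>u\<in>O'. \<forall>n\<in>N. x \<noteq> u \<otimes> n)"
begin

abbreviation q :: "'a \<Rightarrow> 'a set" where "q x \<equiv> N #> x"
abbreviation Q :: "'a set top_group" where "Q \<equiv> tg_quot G N"

lemma normal_N: "normal N G"
  using subgroup_axioms by (rule subgroup_imp_normal)

lemma q_mult: "x \<in> carrier G \<Longrightarrow> y \<in> carrier G \<Longrightarrow> q x \<otimes>\<^bsub>Q\<^esub> q y = q (x \<otimes> y)"
  by (simp add: FactGroup_def normal.rcos_sum[OF normal_N])

lemma q_carrier: "x \<in> carrier G \<Longrightarrow> q x \<in> carrier Q"
  by (auto simp: FactGroup_def RCOSETS_def)

lemma carrier_QE: "C \<in> carrier Q \<Longrightarrow> (\<And>x. x \<in> carrier G \<Longrightarrow> C = q x \<Longrightarrow> thesis) \<Longrightarrow> thesis"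
  by (auto simp: FactGroup_def RCOSETS_def)

lemma one_Q: "\<one>\<^bsub>Q\<^esub> = q \<one>"
  using coset_mult_one[of N] subset by (simp add: FactGroup_def)

lemma q_eq_iff:
  assumes "x \<in> carrier G" "y \<in> carrier G"
  shows "q x = q y \<longleftrightarrow> x \<otimes> inv y \<in> N"
proof
  assume "q x = q y"
  then have "x \<in> q y" using rcos_self[OF assms(1) subgroup_axioms] by simp
  then show "x \<otimes> inv y \<in> N" using rcos_module_imp[OF is_group assms(2)] by simp
next
  assume "x \<otimes> inv y \<in> N"
  then have "x \<in> q y" using rcos_module_rev[OF is_group assms(2,1)] by simp
  then show "q x = q y" using repr_independence[OF _ assms(2) subgroup_axioms] by simp
qed

lemma q_eqI: "n \<in> N \<Longrightarrow> x \<in> carrier G \<Longrightarrow> q (x \<otimes> n) = q x"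
  using mem_carrier by (subst q_eq_iff) (auto simp: m_ac cancel_left)

lemma comm_group_Q: "comm_group Q"
proof -
  interpret F: comm_group "G Mod N" using abelian_FactGroup[OF subgroup_axioms] .
  have "\<exists>y\<in>carrier (G Mod N). y \<otimes>\<^bsub>G Mod N\<^esub> x = \<one>\<^bsub>G Mod N\<^esub>" if "x \<in> carrier (G Mod N)" for x
    using F.l_inv_ex[OF that] by blast
  then show ?thesis
    by (intro comm_groupI; simp only: tg_quot_simps)
      (rule F.m_closed F.one_closed F.m_assoc F.m_comm F.l_one; assumption)+
qed

lemma q_inv: "x \<in> carrier G \<Longrightarrow> inv\<^bsub>Q\<^esub> (q x) = q (inv x)"
proof -
  interpret F: comm_group Q by (rule comm_group_Q)
  assume x: "x \<in> carrier G"
  show ?thesis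
    using x q_mult[of "inv x" x] q_carrier[of x] q_carrier[of "inv x"] one_Q by (intro F.inv_equality) simp_all
qed

lemma openin_Q: "openin (topo Q) U \<longleftrightarrow> U \<subseteq> carrier Q \<and> openin (topo G) {x \<in> carrier G. q x \<in> U}"
proof -
  have "q ` carrier G = carrier Q" by (auto simp: FactGroup_def RCOSETS_def)
  then show ?thesis by (simp add: openin_quotient_topology topspace_eq)
qed

text \<open>The quotient map is open because the saturation of an open set is a union of translates of it.\<close>

lemma openin_q_image:
  assumes U: "openin (topo G) U"
  shows "openin (topo Q) (q ` U)"
proof -
  have Uc: "U \<subseteq> carrier G" using openin_carrier[OF U] .
  have "{x \<in> carrier G. q x \<in> q ` U} = (\<Union>n\<in>N. (\<lambda>u. n \<otimes> u) ` U)" (is "?A = ?B")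
  proof
    show "?A \<subseteq> ?B"
    proof
      fix x assume "x \<in> ?A"
      then obtain u where u: "x \<in> carrier G" "u \<in> U" "q x = q u" by blast
      then have "x \<otimes> inv u \<in> N" using q_eq_iff Uc by blast
      moreover have "x = (x \<otimes> inv u) \<otimes> u" using u Uc by (auto simp: cancel_right)
      ultimately show "x \<in> ?B" using u(2) by blast
    qed
    show "?B \<subseteq> ?A"
    proof
      fix x assume "x \<in> ?B"
      then obtain n u where nu: "n \<in> N" "u \<in> U" "x = n \<otimes> u" by blast
      then have "q x = q u" using q_eqI[of n u] Uc mem_carrier m_comm[of n u] by auto
      then show "x \<in> ?A" using nu Uc mem_carrier by auto
    qed
  qed
  moreover have "openin (topo G) ?B" using openin_translate[OF U] mem_carrier by auto
  moreover have "q ` U \<subseteq> carrier Q" using Uc q_carrier by blast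
  ultimately show ?thesis unfolding openin_Q by simp
qed

lemma top_ab_group_Q: "top_ab_group Q"
proof (rule top_ab_groupI)
  show "comm_group Q" by (rule comm_group_Q)
  show "topspace (topo Q) = carrier Q"
    by (auto simp: topspace_quotient_topology topspace_eq FactGroup_def RCOSETS_def)
next
  fix U A B assume U: "openin (topo Q) U" and "A \<in> carrier Q" "B \<in> carrier Q" and AB: "A \<otimes>\<^bsub>Q\<^esub> B \<in> U"
  then obtain x y where xy: "x \<in> carrier G" "y \<in> carrier G" "A = q x" "B = q y"
    by (elim carrier_QE)
  let ?U = "{x \<in> carrier G. q x \<in> U}"
  have "openin (topo G) ?U" "x \<otimes> y \<in> ?U"
    using U AB xy monoid.m_closed[OF is_monoid xy(1,2)]
    by (simp_all only: openin_Q q_mult mem_Collect_eq simp_thms)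
  from mult_nbhds[OF this(1) xy(1,2) this(2)] obtain V W where VW: "openin (topo G) V" "openin (topo G) W"
    "x \<in> V" "y \<in> W" "\<forall>v\<in>V. \<forall>w\<in>W. v \<otimes> w \<in> ?U" by blast
  have "a \<otimes>\<^bsub>Q\<^esub> b \<in> U" if ab: "a \<in> q ` V" "b \<in> q ` W" for a b
  proof -
    obtain v w where vw: "v \<in> V" "a = q v" "w \<in> W" "b = q w" using ab by blast
    then have "v \<in> carrier G" "w \<in> carrier G" using openin_carrier VW(1,2) by blast+
    then show ?thesis using VW(5) vw q_mult by simp
  qed
  then show "\<exists>V W. openin (topo Q) V \<and> openin (topo Q) W \<and> A \<in> V \<and> B \<in> W \<and> (\<forall>v\<in>V. \<forall>w\<in>W. v \<otimes>\<^bsub>Q\<^esub> w \<in> U)"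
    using openin_q_image[OF VW(1)] openin_q_image[OF VW(2)] imageI[OF VW(3), of q] imageI[OF VW(4), of q]
    by - (rule exI[of _ "q ` V"], rule exI[of _ "q ` W"], simp only: xy simp_thms, blast)
next
  fix U A assume U: "openin (topo Q) U" and A: "A \<in> carrier Q" "inv\<^bsub>Q\<^esub> A \<in> U"
  obtain x where x: "x \<in> carrier G" "A = q x" using A(1) by (elim carrier_QE)
  let ?V = "{y \<in> carrier G. inv y \<in> {x \<in> carrier G. q x \<in> U}}"
  have V: "openin (topo G) ?V" using U openin_inv_preimage by (simp only: openin_Q)
  have "inv\<^bsub>Q\<^esub> v \<in> U" if "v \<in> q ` ?V" for v using that q_inv by auto
  moreover have "A \<in> q ` ?V" using x A q_inv by auto
  ultimately show "\<exists>V. openin (topo Q) V \<and> A \<in> V \<and> (\<forall>v\<in>V. inv\<^bsub>Q\<^esub> v \<in> U)"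
    using openin_q_image[OF V] by blast
next
  fix A B assume "A \<in> carrier Q" "B \<in> carrier Q" and AB: "A \<noteq> B"
  then obtain x y where xy: "x \<in> carrier G" "y \<in> carrier G" "A = q x" "B = q y"
    by (elim carrier_QE)
  have o: "openin (topo G) (carrier G - N)"
  proof (rule openin_by_unit_nbhds)
    fix z assume "z \<in> carrier G - N"
    then obtain O' where O': "open_unit_nbhd G O'" "\<forall>u\<in>O'. \<forall>n\<in>N. z \<noteq> u \<otimes> n" and z: "z \<in> carrier G" using closed by blast
    obtain V where V: "open_unit_nbhd G V" "V \<subseteq> O'" "\<And>v. v \<in> V \<Longrightarrow> inv v \<in> V"
      using unit_nbhd_halve[OF O'(1)] by metis
    have "z \<otimes> v \<in> carrier G - N" if v: "v \<in> V" for v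
    proof -
      have vc: "v \<in> carrier G" using unit_nbhd_carrier[OF V(1) v] .
      have "inv v \<in> O'" using V v by blast
      moreover have "z = inv v \<otimes> (z \<otimes> v)" using z vc cancel_middle by simp
      ultimately have "z \<otimes> v \<notin> N" using O'(2) by metis
      then show ?thesis using z vc by simp
    qed
    then show "\<exists>V. open_unit_nbhd G V \<and> (\<forall>v\<in>V. z \<otimes> v \<in> carrier G - N)" using V(1) by blast
  qed auto
  have "x \<otimes> inv y \<in> carrier G - N" using AB xy q_eq_iff by auto
  from div_nbhds[OF o xy(1,2) this] obtain V W where VW: "openin (topo G) V" "openin (topo G) W"
    "x \<in> V" "y \<in> W" "\<forall>v\<in>V. \<forall>w\<in>W. v \<otimes> inv w \<in> carrier G - N" by (elim exE conjE)
  have "q ` V \<inter> q ` W = {}"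
  proof (rule ccontr)
    assume "q ` V \<inter> q ` W \<noteq> {}"
    then obtain v w where vw: "v \<in> V" "w \<in> W" "q v = q w" by blast
    then have "v \<otimes> inv w \<in> N" using q_eq_iff openin_carrier VW(1,2) by blast
    then show False using VW(5) vw by blast
  qed
  then show "\<exists>V W. openin (topo Q) V \<and> openin (topo Q) W \<and> A \<in> V \<and> B \<in> W \<and> V \<inter> W = {}"
    using openin_q_image[OF VW(1)] openin_q_image[OF VW(2)] imageI[OF VW(3), of q] imageI[OF VW(4), of q]
    by - (rule exI[of _ "q ` V"], rule exI[of _ "q ` W"], simp only: xy simp_thms)
qed

lemma q_tg_hom: "q \<in> tg_hom G Q"
proof -
  have "openin (topo G) {x \<in> carrier G. q x \<in> U}" if "openin (topo Q) U" for U
    using that by (simp only: openin_Q)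
  then have "continuous_map (topo G) (topo Q) q"
    using q_carrier top_ab_group.topspace_eq[OF top_ab_group_Q] by (auto simp: continuous_map_def topspace_eq)
  moreover have "q \<in> hom G Q" using q_mult q_carrier by (auto simp: hom_def)
  ultimately show ?thesis by (simp add: tg_hom_def)
qed

lemma q_unit_nbhd: "open_unit_nbhd G U \<Longrightarrow> open_unit_nbhd Q (q ` U)"
  using openin_q_image[of U] one_Q by (auto simp: open_unit_nbhd_def)

text \<open>A map on the quotient is a continuous homomorphism as soon as its composite with the quotient
  map is one.\<close>

lemma tg_hom_from_Q:
  assumes K: "top_ab_group K" and f: "f \<in> tg_hom G K" and F: "\<And>x. x \<in> carrier G \<Longrightarrow> F (q x) = f x"
  shows "F \<in> tg_hom Q K"
proof (rule tg_homI[OF top_ab_group_Q K])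
  show "F \<in> hom Q K"
  proof (rule homI)
    fix A B assume "A \<in> carrier Q" "B \<in> carrier Q"
    then obtain x y where "x \<in> carrier G" "y \<in> carrier G" "A = q x" "B = q y" by (elim carrier_QE)
    then show "F (A \<otimes>\<^bsub>Q\<^esub> B) = F A \<otimes>\<^bsub>K\<^esub> F B" using F q_mult tg_hom_mult[OF f] by simp
  next
    fix A assume "A \<in> carrier Q"
    then show "F A \<in> carrier K" using F tg_hom_closed[OF f] by (elim carrier_QE) simp
  qed
  fix V assume "open_unit_nbhd K V"
  then have U: "open_unit_nbhd G {x \<in> carrier G. f x \<in> V}"
    by (rule tg_hom_unit_nbhd[OF f top_ab_group_axioms K])
  then show "\<exists>U. open_unit_nbhd Q U \<and> (\<forall>u\<in>U. F u \<in> V)"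
    using q_unit_nbhd[OF U] F by (intro exI[of _ "q ` {x \<in> carrier G. f x \<in> V}"]) auto
qed

end

section \<open>Products, pull-backs and push-outs of extensions\<close>

lemma prod_extension_simps [simp]:
  "mid (prod_extension E E') = tg_prod (mid E) (mid E')"
  "inc (prod_extension E E') = map_prod (inc E) (inc E')"
  "prj (prod_extension E E') = map_prod (prj E) (prj E')"
  by (simp_all add: prod_extension_def)

lemma tg_hom_map_prod:
  assumes "top_ab_group G" "top_ab_group H" "f \<in> tg_hom G K" "g \<in> tg_hom H L"
  shows "map_prod f g \<in> tg_hom (tg_prod G H) (tg_prod K L)"
proof -
  have "(\<lambda>x. (f (fst x), g (snd x))) \<in> tg_hom (tg_prod G H) (tg_prod K L)"
    by (intro tg_hom_pair tg_hom_compose[OF tg_hom_fst] tg_hom_compose[OF tg_hom_snd] assms)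
  moreover have "map_prod f g = (\<lambda>x. (f (fst x), g (snd x)))" by auto
  ultimately show ?thesis by simp
qed

lemma top_extension_prod:
  assumes "top_extension G H E" "top_extension G' H' E'"
  shows "top_extension (tg_prod G G') (tg_prod H H') (prod_extension E E')"
proof -
  interpret E: top_extension G H E by fact
  interpret E': top_extension G' H' E' by fact
  show ?thesis
  proof (intro top_extension.intro is_extensionI)
    show X: "top_ab_group (mid (prod_extension E E'))"
      by (simp add: top_ab_group_prod E.X.top_ab_group_axioms E'.X.top_ab_group_axioms)
    show "top_ab_group (tg_prod G G')" "top_ab_group (tg_prod G G')"
      by (intro top_ab_group_prod E.G E'.G)+
    show "top_ab_group (tg_prod H H')" "top_ab_group (tg_prod H H')"
      by (intro top_ab_group_prod E.H E'.H)+
    show "inc (prod_extension E E') \<in> tg_hom (tg_prod H H') (mid (prod_extension E E'))"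
      using tg_hom_map_prod[OF E.H E'.H E.inc_tg_hom E'.inc_tg_hom] by simp
    show "prj (prod_extension E E') \<in> tg_hom (mid (prod_extension E E')) (tg_prod G G')"
      using tg_hom_map_prod[OF E.X.top_ab_group_axioms E'.X.top_ab_group_axioms E.prj_tg_hom E'.prj_tg_hom]
      by simp
  next
    fix U assume "open_unit_nbhd (tg_prod H H') U"
    then obtain A B where AB: "open_unit_nbhd H A" "open_unit_nbhd H' B" "A \<times> B \<subseteq> U"
      by (rule unit_nbhd_prodE)
    obtain V where V: "open_unit_nbhd (mid E) V" "\<forall>h\<in>carrier H. inc E h \<in> V \<longrightarrow> h \<in> A"
      using E.unit_nbhd_inc[OF AB(1)] by blast
    obtain W where W: "open_unit_nbhd (mid E') W" "\<forall>h\<in>carrier H'. inc E' h \<in> W \<longrightarrow> h \<in> B"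
      using E'.unit_nbhd_inc[OF AB(2)] by blast
    show "\<exists>V. open_unit_nbhd (mid (prod_extension E E')) V \<and>
      (\<forall>h\<in>carrier (tg_prod H H'). inc (prod_extension E E') h \<in> V \<longrightarrow> h \<in> U)"
      using unit_nbhd_prod[OF V(1) W(1)] V(2) W(2) AB(3) by (intro exI[of _ "V \<times> W"]) auto
  next
    fix U assume "open_unit_nbhd (mid (prod_extension E E')) U"
    then obtain A B where AB: "open_unit_nbhd (mid E) A" "open_unit_nbhd (mid E') B" "A \<times> B \<subseteq> U"
      unfolding prod_extension_simps by (rule unit_nbhd_prodE)
    have "(prj E ` A) \<times> (prj E' ` B) \<subseteq> prj (prod_extension E E') ` U"
      using image_mono[OF AB(3), of "map_prod (prj E) (prj E')"] by (auto simp: image_iff)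
    then show "\<exists>V. open_unit_nbhd (tg_prod G G') V \<and> V \<subseteq> prj (prod_extension E E') ` U"
      using unit_nbhd_prod[OF E.unit_nbhd_prj[OF AB(1)] E'.unit_nbhd_prj[OF AB(2)]] by blast
  next
    fix h assume "h \<in> carrier (tg_prod H H')" 
      and "inc (prod_extension E E') h = \<one>\<^bsub>mid (prod_extension E E')\<^esub>"
    then show "h = \<one>\<^bsub>tg_prod H H'\<^esub>"
      using E.inc_eqD[of "fst h" "\<one>\<^bsub>H\<^esub>"] E'.inc_eqD[of "snd h" "\<one>\<^bsub>H'\<^esub>"] by (cases h) auto
  next
    fix h assume "h \<in> carrier (tg_prod H H')"
    then show "prj (prod_extension E E') (inc (prod_extension E E') h) = \<one>\<^bsub>tg_prod G G'\<^esub>" by auto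
  next
    fix x assume "x \<in> carrier (mid (prod_extension E E'))" "prj (prod_extension E E') x = \<one>\<^bsub>tg_prod G G'\<^esub>"
    then obtain h k where "h \<in> carrier H" "fst x = inc E h" "k \<in> carrier H'" "snd x = inc E' k"
      using E.prj_eq_one[of "fst x"] E'.prj_eq_one[of "snd x"] by (cases x) auto
    then show "\<exists>h\<in>carrier (tg_prod H H'). x = inc (prod_extension E E') h"
      by (intro bexI[of _ "(h, k)"]) (auto simp: prod_eq_iff)
  next
    fix g assume "g \<in> carrier (tg_prod G G')"
    then obtain x y where "x \<in> carrier (mid E)" "prj E x = fst g" "y \<in> carrier (mid E')" "prj E' y = snd g"
      using E.prj_surj[of "fst g"] E'.prj_surj[of "snd g"] by (cases g) auto
    then show "\<exists>x\<in>carrier (mid (prod_extension E E')). prj (prod_extension E E') x = g"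
      by (intro bexI[of _ "(x, y)"]) (auto simp: prod_eq_iff)
  qed
qed

lemma pullback_extension_simps [simp]:
  "mid (pullback_extension G' f E) = tg_sub (tg_prod (mid E) G')
     {(x, g). x \<in> carrier (mid E) \<and> g \<in> carrier G' \<and> prj E x = f g}"
  "inc (pullback_extension G' f E) = (\<lambda>h. (inc E h, \<one>\<^bsub>G'\<^esub>))"
  "prj (pullback_extension G' f E) = snd"
  by (simp_all add: pullback_extension_def)

lemma top_extension_pullback:
  assumes "top_extension G H E" and G': "top_ab_group G'" and f: "f \<in> tg_hom G' G"
  shows "top_extension G' H (pullback_extension G' f E)"
proof -
  interpret E: top_extension G H E by fact
  interpret G': top_ab_group G' by fact
  interpret f: group_hom G' G f using f by unfold_locales (simp add: tg_hom_def)
  let ?S = "{(x, g). x \<in> carrier (mid E) \<and> g \<in> carrier G' \<and> prj E x = f g}"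
  let ?P = "tg_prod (mid E) G'"
  note XG = E.X.top_ab_group_axioms G'
  note cg = E.X.comm_group_axioms G'.comm_group_axioms
  interpret P: top_ab_group ?P by (rule top_ab_group_prod[OF XG])
  have S: "subgroup ?S ?P"
    by (rule P.subgroupI) (auto simp: inv_tg_prod[OF cg] intro!: exI[of _ "\<one>\<^bsub>mid E\<^esub>"] exI[of _ "\<one>\<^bsub>G'\<^esub>"])
  have sub: "?S \<subseteq> carrier ?P" by auto
  have one: "\<one>\<^bsub>?P\<^esub> \<in> ?S" by auto
  show ?thesis
  proof (intro top_extension.intro is_extensionI)
    show "top_ab_group (mid (pullback_extension G' f E))"
      using top_ab_group_sub[OF P.top_ab_group_axioms S] by simp
    have "(\<lambda>h. \<one>\<^bsub>G'\<^esub>) \<in> tg_hom H G'" by (auto simp: tg_hom_def hom_def G'.topspace_eq)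
    then have "(\<lambda>h. (inc E h, \<one>\<^bsub>G'\<^esub>)) \<in> tg_hom H ?P" by (rule tg_hom_pair[OF E.inc_tg_hom])
    then show "inc (pullback_extension G' f E) \<in> tg_hom H (mid (pullback_extension G' f E))"
      unfolding pullback_extension_simps by (rule tg_hom_into_sub) (auto simp: E.H.topspace_eq)
    show "prj (pullback_extension G' f E) \<in> tg_hom (mid (pullback_extension G' f E)) G'"
      unfolding pullback_extension_simps by (rule tg_hom_from_sub[OF tg_hom_snd[OF XG] sub])
  next
    fix U assume "open_unit_nbhd H U"
    from E.unit_nbhd_inc[OF this] obtain V where V: "open_unit_nbhd (mid E) V" "\<forall>h\<in>carrier H. inc E h \<in> V \<longrightarrow> h \<in> U"
      by blast
    have "open_unit_nbhd (tg_sub ?P ?S) ((V \<times> carrier G') \<inter> ?S)"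
      by (rule unit_nbhd_sub[OF unit_nbhd_prod[OF V(1) G'.unit_nbhd_univ] one])
    then show "\<exists>V. open_unit_nbhd (mid (pullback_extension G' f E)) V \<and>
      (\<forall>h\<in>carrier H. inc (pullback_extension G' f E) h \<in> V \<longrightarrow> h \<in> U)"
      using V(2) by (intro exI[of _ "(V \<times> carrier G') \<inter> ?S"]) auto
  next
    fix U assume "open_unit_nbhd (mid (pullback_extension G' f E)) U"
    then obtain U' where U': "open_unit_nbhd ?P U'" "U = U' \<inter> ?S"
      unfolding pullback_extension_simps by (rule unit_nbhd_subE)
    obtain A B where AB: "open_unit_nbhd (mid E) A" "open_unit_nbhd G' B" "A \<times> B \<subseteq> U'"
      using U'(1) by (rule unit_nbhd_prodE)
    let ?V = "B \<inter> {g \<in> carrier G'. f g \<in> prj E ` A}"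
    have "open_unit_nbhd G' ?V"
      by (intro G'.unit_nbhd_Int AB(2) tg_hom_unit_nbhd[OF f G' E.G] E.unit_nbhd_prj AB(1))
    moreover have "?V \<subseteq> snd ` U"
    proof
      fix g assume "g \<in> ?V"
      then obtain a where a: "g \<in> B" "g \<in> carrier G'" "a \<in> A" "f g = prj E a" by blast
      then have "(a, g) \<in> U" using U'(2) AB(3) E.X.unit_nbhd_carrier[OF AB(1)] by auto
      then show "g \<in> snd ` U" by (rule rev_image_eqI) simp
    qed
    ultimately show "\<exists>V. open_unit_nbhd G' V \<and> V \<subseteq> prj (pullback_extension G' f E) ` U"
      by (auto simp only: pullback_extension_simps)
  next
    fix h assume "h \<in> carrier H" "inc (pullback_extension G' f E) h = \<one>\<^bsub>mid (pullback_extension G' f E)\<^esub>"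
    then show "h = \<one>\<^bsub>H\<^esub>" using E.inc_eqD[of h "\<one>\<^bsub>H\<^esub>"] by simp
  next
    fix x assume "x \<in> carrier (mid (pullback_extension G' f E))" "prj (pullback_extension G' f E) x = \<one>\<^bsub>G'\<^esub>"
    then obtain y where y: "x = (y, \<one>\<^bsub>G'\<^esub>)" "y \<in> carrier (mid E)" "prj E y = \<one>\<^bsub>G\<^esub>"
      by (cases x) auto
    then show "\<exists>h\<in>carrier H. x = inc (pullback_extension G' f E) h"
      using E.prj_eq_one[OF y(2,3)] by auto
  next
    fix g assume g: "g \<in> carrier G'"
    then obtain x where "x \<in> carrier (mid E)" "prj E x = f g" using E.prj_surj[OF f.hom_closed[OF g]] by blast
    then show "\<exists>x\<in>carrier (mid (pullback_extension G' f E)). prj (pullback_extension G' f E) x = g"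
      using g by (intro bexI[of _ "(x, g)"]) auto
  qed (simp_all add: E.H G')
qed

lemma pushout_extension_simps [simp]:
  "mid (pushout_extension H H' f E) = tg_quot (tg_prod H' (mid E)) (antidiagonal H f E)"
  "inc (pushout_extension H H' f E) = (\<lambda>k. antidiagonal H f E #>\<^bsub>tg_prod H' (mid E)\<^esub> (k, \<one>\<^bsub>mid E\<^esub>))"
  "prj (pushout_extension H H' f E) = (\<lambda>C. the_elem ((\<lambda>(k, x). prj E x) ` C))"
  by (simp_all add: pushout_extension_def)

locale pushout = top_extension G H E + H': top_ab_group H'
  for G :: "'g top_group" and H :: "'h top_group" and E :: "('h, 'x, 'g) extn" and H' :: "'k top_group" +
  fixes f :: "'h \<Rightarrow> 'k"
  assumes f: "f \<in> tg_hom H H'"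

sublocale pushout \<subseteq> f: group_hom H H' f
  using f by unfold_locales (simp add: tg_hom_def)

context pushout
begin

abbreviation "P \<equiv> tg_prod H' (mid E)"
abbreviation "N \<equiv> antidiagonal H f E"

lemmas HX = H'.top_ab_group_axioms X.top_ab_group_axioms
lemmas cg = H'.comm_group_axioms X.comm_group_axioms

lemma mem_N: "(k, x) \<in> N \<longleftrightarrow> (\<exists>h\<in>carrier H. k = f h \<and> x = inv\<^bsub>mid E\<^esub> (inc E h))"
  by (auto simp: antidiagonal_def)

lemma top_ab_group_P: "top_ab_group P"
  by (rule top_ab_group_prod[OF HX])

lemma subgroup_N: "subgroup N P"
proof -
  interpret P: top_ab_group P by (rule top_ab_group_P)
  show ?thesis
  proof (rule P.subgroupI)
    show "N \<subseteq> carrier P" by (auto simp: antidiagonal_def)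
    show "N \<noteq> {}" by (auto simp: antidiagonal_def)
  next
    fix a assume "a \<in> N"
    then obtain h where h: "h \<in> carrier H" "a = (f h, inv\<^bsub>mid E\<^esub> (inc E h))" by (auto simp: antidiagonal_def)
    then have "inv\<^bsub>P\<^esub> a = (f (inv\<^bsub>H\<^esub> h), inv\<^bsub>mid E\<^esub> (inc E (inv\<^bsub>H\<^esub> h)))" by (simp add: inv_tg_prod[OF cg])
    then show "inv\<^bsub>P\<^esub> a \<in> N" unfolding antidiagonal_def
      using h(1) by (intro image_eqI[of _ _ "inv\<^bsub>H\<^esub> h"]) (simp_all only: H.inv_closed)
  next
    fix a b assume "a \<in> N" "b \<in> N"
    then obtain h k where h: "h \<in> carrier H" "a = (f h, inv\<^bsub>mid E\<^esub> (inc E h))"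
       "k \<in> carrier H" "b = (f k, inv\<^bsub>mid E\<^esub> (inc E k))" by (auto simp: antidiagonal_def)
    then have "a \<otimes>\<^bsub>P\<^esub> b = (f (h \<otimes>\<^bsub>H\<^esub> k), inv\<^bsub>mid E\<^esub> (inc E (h \<otimes>\<^bsub>H\<^esub> k)))" by (simp add: X.inv_mult)
    then show "a \<otimes>\<^bsub>P\<^esub> b \<in> N" unfolding antidiagonal_def
      using h(1,3) by (intro image_eqI[of _ _ "h \<otimes>\<^bsub>H\<^esub> k"]) (simp_all only: H.m_closed)
  qed
qed

text \<open>The antidiagonal is closed. A point \<open>(k, x)\<close> outside it either projects to a non-trivial point of
  \<open>G\<close>, which is a separating invariant since the antidiagonal lies over the unit; or \<open>x\<close> is the
  inverse of the image of some \<open>h\<close>, and then \<open>c = k inv (f h)\<close> is non-trivial. In the second case a product \<open>u n\<close>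
  with \<open>n\<close> in the antidiagonal that equals \<open>(k, x)\<close> would exhibit \<open>c\<close> as a product of two small elements.\<close>

lemma N_separated:
  assumes "z \<in> carrier P" "z \<notin> N"
  shows "\<exists>O'. open_unit_nbhd P O' \<and> (\<forall>u\<in>O'. \<forall>n\<in>N. z \<noteq> u \<otimes>\<^bsub>P\<^esub> n)"
proof -
  obtain k x where z: "z = (k, x)" and kx: "k \<in> carrier H'" "x \<in> carrier (mid E)" using assms by auto
  show ?thesis
  proof (cases "prj E x = \<one>\<^bsub>G\<^esub>")
    case False
    define W where "W = {y \<in> carrier (mid E). prj E y \<in> carrier G - {prj E x}}"
    have "openin (topo G) (carrier G - {prj E x})"
      using G.openin_carrier_self closedin_Hausdorff_singleton[OF G.Hausdorff] kx G.topspace_eq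
      by (intro openin_diff) auto
    then have "open_unit_nbhd G (carrier G - {prj E x})" using False by (auto simp: open_unit_nbhd_def)
    then have W: "open_unit_nbhd (mid E) W"
      unfolding W_def by (rule tg_hom_unit_nbhd[OF prj_tg_hom X.top_ab_group_axioms G])
    have "z \<noteq> u \<otimes>\<^bsub>P\<^esub> n" if un: "u \<in> carrier H' \<times> W" "n \<in> N" for u n
    proof
      assume e: "z = u \<otimes>\<^bsub>P\<^esub> n"
      obtain h where h: "h \<in> carrier H" "n = (f h, inv\<^bsub>mid E\<^esub> (inc E h))" using \<open>n \<in> N\<close> by (auto simp: antidiagonal_def)
      obtain v w where vw: "u = (v, w)" "w \<in> W" using un by auto
      then have "x = w \<otimes>\<^bsub>mid E\<^esub> inv\<^bsub>mid E\<^esub> (inc E h)" "w \<in> carrier (mid E)" using e z h by (auto simp: W_def)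
      then have "prj E x = prj E w" using h by simp
      then show False using vw by (auto simp: W_def)
    qed
    then show ?thesis using unit_nbhd_prod[OF H'.unit_nbhd_univ W] by blast
  next
    case True
    then have "prj E (inv\<^bsub>mid E\<^esub> x) = \<one>\<^bsub>G\<^esub>" using kx by simp
    then obtain h where h: "h \<in> carrier H" "inv\<^bsub>mid E\<^esub> x = inc E h"
      using prj_eq_one[of "inv\<^bsub>mid E\<^esub> x"] kx by auto
    then have x: "x = inv\<^bsub>mid E\<^esub> (inc E h)" using kx X.inv_inv[of x] by simp
    define c where "c = k \<otimes>\<^bsub>H'\<^esub> inv\<^bsub>H'\<^esub> f h"
    have c: "c \<in> carrier H'" using kx h by (simp add: c_def)
    have "k \<noteq> f h" using assms(2) x h z mem_N by blast
    then have "c \<noteq> \<one>\<^bsub>H'\<^esub>" using kx h H'.cancel_right(2)[of "f h" k] by (auto simp: c_def)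
    then have "open_unit_nbhd H' (carrier H' - {c})"
      using H'.openin_carrier_self closedin_Hausdorff_singleton[OF H'.Hausdorff] c H'.topspace_eq
      by (auto simp: open_unit_nbhd_def intro: openin_diff)
    then obtain V where V: "open_unit_nbhd H' V" "\<And>v w. v \<in> V \<Longrightarrow> w \<in> V \<Longrightarrow> v \<otimes>\<^bsub>H'\<^esub> w \<in> carrier H' - {c}"
      using H'.unit_nbhd_halve by metis
    obtain W where W: "open_unit_nbhd (mid E) W" "\<forall>h\<in>carrier H. inc E h \<in> W \<longrightarrow> h \<in> {h \<in> carrier H. f h \<in> V}"
      using unit_nbhd_inc[OF tg_hom_unit_nbhd[OF f H H'.top_ab_group_axioms V(1)]] by (elim exE conjE)
    have "z \<noteq> u \<otimes>\<^bsub>P\<^esub> n" if un: "u \<in> V \<times> W" "n \<in> N" for u n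
    proof
      assume e: "z = u \<otimes>\<^bsub>P\<^esub> n"
      obtain h' where h': "h' \<in> carrier H" "n = (f h', inv\<^bsub>mid E\<^esub> (inc E h'))" using \<open>n \<in> N\<close> by (auto simp: antidiagonal_def)
      obtain v w where vw: "u = (v, w)" "v \<in> V" "w \<in> W" using un by auto
      have vwc: "v \<in> carrier H'" "w \<in> carrier (mid E)"
        using H'.unit_nbhd_carrier[OF V(1) vw(2)] X.unit_nbhd_carrier[OF W(1) vw(3)] .
      have k: "k = v \<otimes>\<^bsub>H'\<^esub> f h'" and w: "x = w \<otimes>\<^bsub>mid E\<^esub> inv\<^bsub>mid E\<^esub> (inc E h')" using e z h' vw by auto
      have "w = x \<otimes>\<^bsub>mid E\<^esub> inc E h'" unfolding w using vwc h' X.cancel_right by simp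
      also have "\<dots> = inc E (h' \<otimes>\<^bsub>H\<^esub> inv\<^bsub>H\<^esub> h)" using h h' by (simp add: x X.m_comm)
      finally have "inc E (h' \<otimes>\<^bsub>H\<^esub> inv\<^bsub>H\<^esub> h) \<in> W" using vw(3) by (simp only:)
      then have "f (h' \<otimes>\<^bsub>H\<^esub> inv\<^bsub>H\<^esub> h) \<in> V"
        using W(2)[rule_format, of "h' \<otimes>\<^bsub>H\<^esub> inv\<^bsub>H\<^esub> h"] h(1) h'(1) by simp
      then have "v \<otimes>\<^bsub>H'\<^esub> f (h' \<otimes>\<^bsub>H\<^esub> inv\<^bsub>H\<^esub> h) \<noteq> c" using V(2)[OF vw(2)] by blast
      moreover have "v \<otimes>\<^bsub>H'\<^esub> f (h' \<otimes>\<^bsub>H\<^esub> inv\<^bsub>H\<^esub> h) = c" using vwc h h' by (simp add: c_def k H'.m_assoc)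
      ultimately show False by blast
    qed
    then show ?thesis using unit_nbhd_prod[OF V(1) W(1)] by blast
  qed
qed

end

sublocale pushout \<subseteq> Q: tg_quotient P N
  using top_ab_group_P subgroup_N N_separated by (intro tg_quotient.intro tg_quotient_axioms.intro)

context pushout
begin

lemma q_eq_iff': "k \<in> carrier H' \<Longrightarrow> x \<in> carrier (mid E) \<Longrightarrow> k' \<in> carrier H' \<Longrightarrow> x' \<in> carrier (mid E) \<Longrightarrow>
  Q.q (k, x) = Q.q (k', x') \<longleftrightarrow>
    (\<exists>h\<in>carrier H. k \<otimes>\<^bsub>H'\<^esub> inv\<^bsub>H'\<^esub> k' = f h \<and> x \<otimes>\<^bsub>mid E\<^esub> inv\<^bsub>mid E\<^esub> x' = inv\<^bsub>mid E\<^esub> (inc E h))"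
  using Q.q_eq_iff[of "(k, x)" "(k', x')"] by (simp add: inv_tg_prod[OF cg] mem_N)

lemma prj_pushout:
  assumes "k \<in> carrier H'" "x \<in> carrier (mid E)"
  shows "prj (pushout_extension H H' f E) (Q.q (k, x)) = prj E x"
proof -
  have "(\<lambda>(k, x). prj E x) z = prj E x" if z: "z \<in> Q.q (k, x)" for z
  proof -
    obtain h where "h \<in> carrier H" "z = (f h, inv\<^bsub>mid E\<^esub> (inc E h)) \<otimes>\<^bsub>P\<^esub> (k, x)"
      using z by (auto simp: r_coset_def antidiagonal_def)
    then show ?thesis using assms by simp
  qed
  then have "(\<lambda>(k, x). prj E x) ` Q.q (k, x) = (\<lambda>_. prj E x) ` Q.q (k, x)" by (intro image_cong refl)
  moreover have "(k, x) \<in> Q.q (k, x)" using assms by (intro Q.rcos_self subgroup_N) simp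
  ultimately have "(\<lambda>(k, x). prj E x) ` Q.q (k, x) = {prj E x}" by (simp only: image_constant)
  then show ?thesis by simp
qed

lemma inc_pushout: "inc (pushout_extension H H' f E) k = Q.q (k, \<one>\<^bsub>mid E\<^esub>)"
  by simp

lemma mid_pushout: "mid (pushout_extension H H' f E) = Q.Q"
  by simp

lemma top_extension_pushout: "top_extension G H' (pushout_extension H H' f E)"
  unfolding top_extension_def
proof (intro conjI is_extensionI; (unfold mid_pushout)?)
  note prj = pushout_extension_simps(3)[where H = H and H' = H' and f = f and E = E]
  show "top_ab_group Q.Q" by (rule Q.top_ab_group_Q)
  have "(\<lambda>k. k) \<in> tg_hom H' H'" by (auto simp: tg_hom_def hom_def)
  moreover have "(\<lambda>h. \<one>\<^bsub>mid E\<^esub>) \<in> tg_hom H' (mid E)" by (auto simp: tg_hom_def hom_def X.topspace_eq)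
  ultimately have "(\<lambda>k. (k, \<one>\<^bsub>mid E\<^esub>)) \<in> tg_hom H' P" by (rule tg_hom_pair)
  from tg_hom_compose[OF this Q.q_tg_hom]
  show "inc (pushout_extension H H' f E) \<in> tg_hom H' Q.Q" by (simp only: pushout_extension_simps)
  show "prj (pushout_extension H H' f E) \<in> tg_hom Q.Q G"
  proof (rule Q.tg_hom_from_Q[OF G tg_hom_compose[OF tg_hom_snd[OF HX] prj_tg_hom]])
    fix z assume "z \<in> carrier P"
    then show "prj (pushout_extension H H' f E) (Q.q z) = prj E (snd z)"
      using prj_pushout[of "fst z" "snd z"] by (cases z) (auto simp del: pushout_extension_simps)
  qed
  fix U assume U: "open_unit_nbhd H' U"
  obtain V where V: "open_unit_nbhd H' V" "\<And>v w. v \<in> V \<Longrightarrow> w \<in> V \<Longrightarrow> v \<otimes>\<^bsub>H'\<^esub> w \<in> U"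
    using H'.unit_nbhd_halve[OF U] by metis
  obtain W where W: "open_unit_nbhd (mid E) W" "\<forall>h\<in>carrier H. inc E h \<in> W \<longrightarrow> h \<in> {h \<in> carrier H. f h \<in> V}"
    using unit_nbhd_inc[OF tg_hom_unit_nbhd[OF f H H'.top_ab_group_axioms V(1)]] by (elim exE conjE)
  have "k \<in> U" if k: "k \<in> carrier H'" "inc (pushout_extension H H' f E) k \<in> Q.q ` (V \<times> W)" for k
  proof -
    obtain v w where vw: "v \<in> V" "w \<in> W" "Q.q (k, \<one>\<^bsub>mid E\<^esub>) = Q.q (v, w)"
      using k(2) unfolding inc_pushout by blast
    have vwc: "v \<in> carrier H'" "w \<in> carrier (mid E)"
      using H'.unit_nbhd_carrier[OF V(1) vw(1)] X.unit_nbhd_carrier[OF W(1) vw(2)] .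
    obtain h where h: "h \<in> carrier H" "k \<otimes>\<^bsub>H'\<^esub> inv\<^bsub>H'\<^esub> v = f h" "inv\<^bsub>mid E\<^esub> w = inv\<^bsub>mid E\<^esub> (inc E h)"
      using vw(3) q_eq_iff'[OF k(1) X.one_closed vwc] vwc by auto
    then have "inc E h = w" using vwc X.inv_inv i.hom_closed by metis
    then have "f h \<in> V" using W(2) vw(2) h(1) by auto
    moreover have "k = f h \<otimes>\<^bsub>H'\<^esub> v" using h(2) H'.cancel_right(2)[OF vwc(1) k(1)] by simp
    ultimately show "k \<in> U" using V(2)[OF _ vw(1)] by simp
  qed
  then show "\<exists>V. open_unit_nbhd Q.Q V \<and> (\<forall>h\<in>carrier H'. inc (pushout_extension H H' f E) h \<in> V \<longrightarrow> h \<in> U)"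
    using Q.q_unit_nbhd[OF unit_nbhd_prod[OF V(1) W(1)]] by blast
next
  fix U assume U: "open_unit_nbhd Q.Q U"
  from tg_hom_unit_nbhd[OF Q.q_tg_hom top_ab_group_P Q.top_ab_group_Q this]
  obtain A B where AB: "open_unit_nbhd H' A" "open_unit_nbhd (mid E) B"
    "A \<times> B \<subseteq> {x \<in> carrier P. Q.q x \<in> U}" by (rule unit_nbhd_prodE)
  have "prj E ` B \<subseteq> prj (pushout_extension H H' f E) ` U"
  proof
    fix g assume "g \<in> prj E ` B"
    then obtain b where b: "b \<in> B" "g = prj E b" by blast
    have "\<one>\<^bsub>H'\<^esub> \<in> A" using AB(1) by (simp add: open_unit_nbhd_def)
    then have "Q.q (\<one>\<^bsub>H'\<^esub>, b) \<in> U" using AB(3) b by auto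
    moreover have "g = prj (pushout_extension H H' f E) (Q.q (\<one>\<^bsub>H'\<^esub>, b))"
      using prj_pushout[OF H'.one_closed X.unit_nbhd_carrier[OF AB(2) b(1)]] b by simp
    ultimately show "g \<in> prj (pushout_extension H H' f E) ` U" by (rule rev_image_eqI)
  qed
  then show "\<exists>V. open_unit_nbhd G V \<and> V \<subseteq> prj (pushout_extension H H' f E) ` U"
    using unit_nbhd_prj[OF AB(2)] by blast
next
  fix k assume k: "k \<in> carrier H'" "inc (pushout_extension H H' f E) k = \<one>\<^bsub>Q.Q\<^esub>"
  then have "Q.q (k, \<one>\<^bsub>mid E\<^esub>) = Q.q (\<one>\<^bsub>H'\<^esub>, \<one>\<^bsub>mid E\<^esub>)"
    unfolding inc_pushout using Q.one_Q by (simp only: tg_prod_simps)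
  then obtain h where h: "h \<in> carrier H" "k = f h" "\<one>\<^bsub>mid E\<^esub> = inv\<^bsub>mid E\<^esub> (inc E h)"
    using q_eq_iff'[of k "\<one>\<^bsub>mid E\<^esub>" "\<one>\<^bsub>H'\<^esub>" "\<one>\<^bsub>mid E\<^esub>"] k by auto
  then have "inc E h = inc E \<one>\<^bsub>H\<^esub>" using X.inv_eq_1_iff[OF i.hom_closed[OF h(1)]] by simp
  then show "k = \<one>\<^bsub>H'\<^esub>" using inc_eqD[OF h(1) H.one_closed] h by simp
next
  fix k assume "k \<in> carrier H'"
  then show "prj (pushout_extension H H' f E) (inc (pushout_extension H H' f E) k) = \<one>\<^bsub>G\<^esub>"
    using prj_pushout[of k "\<one>\<^bsub>mid E\<^esub>"] by simp
next
  fix C assume "C \<in> carrier Q.Q" and C: "prj (pushout_extension H H' f E) C = \<one>\<^bsub>G\<^esub>"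
  then obtain z where z: "z \<in> carrier P" "C = Q.q z" by (elim Q.carrier_QE)
  obtain k x where kx: "z = (k, x)" "k \<in> carrier H'" "x \<in> carrier (mid E)" using z by auto
  then have "prj E x = \<one>\<^bsub>G\<^esub>" using prj_pushout[OF kx(2,3)] C z by simp
  then obtain h where h: "h \<in> carrier H" "x = inc E h" using prj_eq_one kx by blast
  have "Q.q (k, x) = Q.q (k \<otimes>\<^bsub>H'\<^esub> f h, \<one>\<^bsub>mid E\<^esub>)"
    using h kx by (subst q_eq_iff')
      (auto simp: H'.inv_mult H'.cancel_left H'.m_ac intro!: bexI[of _ "inv\<^bsub>H\<^esub> h"])
  then show "\<exists>h\<in>carrier H'. C = inc (pushout_extension H H' f E) h"
    unfolding inc_pushout using kx h z by (intro bexI[of _ "k \<otimes>\<^bsub>H'\<^esub> f h"]) simp_all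
next
  fix g assume "g \<in> carrier G"
  then obtain x where "x \<in> carrier (mid E)" "prj E x = g" using prj_surj by blast
  then show "\<exists>x\<in>carrier Q.Q. prj (pushout_extension H H' f E) x = g"
    using prj_pushout[OF H'.one_closed] Q.q_carrier[of "(\<one>\<^bsub>H'\<^esub>, x)"]
    by (intro bexI[of _ "Q.q (\<one>\<^bsub>H'\<^esub>, x)"]) (simp_all del: pushout_extension_simps)
qed (rule G H'.top_ab_group_axioms)+

text \<open>The universal property of the push-out, in the form needed here: a morphism over \<open>f\<close> from \<open>E\<close> to
  an extension by \<open>H'\<close> identifies the latter with the push-out, since the induced morphism is one of
  extensions of \<open>G\<close> by \<open>H'\<close>.\<close>

lemma pushout_equivI:
  assumes E'': "top_extension G H' E''" and S: "S \<in> tg_hom (mid E) (mid E'')"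
    and Si: "\<And>h. h \<in> carrier H \<Longrightarrow> S (inc E h) = inc E'' (f h)"
    and Sp: "\<And>x. x \<in> carrier (mid E) \<Longrightarrow> prj E'' (S x) = prj E x"
  shows "ext_equiv H' (pushout_extension H H' f E) E''"
proof -
  interpret E'': top_extension G H' E'' by fact
  interpret S: group_hom "mid E" "mid E''" S using S by unfold_locales (simp add: tg_hom_def)
  define s where "s z = inc E'' (fst z) \<otimes>\<^bsub>mid E''\<^esub> S (snd z)" for z
  have s: "s \<in> tg_hom P (mid E'')" unfolding s_def
    by (intro tg_hom_prod_mult E''.X.top_ab_group_axioms tg_hom_compose[OF tg_hom_fst[OF HX] E''.inc_tg_hom]
      tg_hom_compose[OF tg_hom_snd[OF HX] S])
  interpret s: group_hom P "mid E''" s using s by unfold_locales (simp add: tg_hom_def)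
  have sN: "s n = \<one>\<^bsub>mid E''\<^esub>" if "n \<in> N" for n
    using that Si by (auto simp: antidiagonal_def s_def)
  define T where "T C = s (SOME z. z \<in> carrier P \<and> C = Q.q z)" for C
  have Tq: "T (Q.q z) = s z" if z: "z \<in> carrier P" for z
  proof -
    define w where "w = (SOME w. w \<in> carrier P \<and> Q.q z = Q.q w)"
    have w: "w \<in> carrier P" "Q.q z = Q.q w"
      using someI[of "\<lambda>w. w \<in> carrier P \<and> Q.q z = Q.q w" z] z by (auto simp: w_def)
    then have "s (z \<otimes>\<^bsub>P\<^esub> inv\<^bsub>P\<^esub> w) = \<one>\<^bsub>mid E''\<^esub>" using sN z Q.q_eq_iff by blast
    then have "s z \<otimes>\<^bsub>mid E''\<^esub> inv\<^bsub>mid E''\<^esub> s w = \<one>\<^bsub>mid E''\<^esub>"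
      using z w(1) by (simp only: s.hom_mult s.hom_inv Q.inv_closed)
    then have "s z = s w" using E''.X.cancel_right(2)[OF s.hom_closed[OF w(1)] s.hom_closed[OF z]]
      s.hom_closed[OF w(1)] by simp
    then show ?thesis by (simp add: T_def w_def)
  qed
  have "T \<in> tg_hom (mid (pushout_extension H H' f E)) (mid E'')"
    unfolding mid_pushout by (rule Q.tg_hom_from_Q[OF E''.X.top_ab_group_axioms s Tq])
  moreover have "T (inc (pushout_extension H H' f E) k) = inc E'' k" if "k \<in> carrier H'" for k
    unfolding inc_pushout using Tq[of "(k, \<one>\<^bsub>mid E\<^esub>)"] that by (simp add: s_def)
  moreover have "prj E'' (T C) = prj (pushout_extension H H' f E) C" if C: "C \<in> carrier Q.Q" for C
  proof -
    obtain z where z: "z \<in> carrier P" "C = Q.q z" using C by (elim Q.carrier_QE)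
    obtain k x where kx: "z = (k, x)" "k \<in> carrier H'" "x \<in> carrier (mid E)" using z by auto
    then have "prj E'' (T C) = prj E x" using Tq[OF z(1)] z(2) Sp by (simp add: s_def)
    then show ?thesis using prj_pushout[OF kx(2,3)] z kx by simp
  qed
  ultimately show ?thesis unfolding ext_equiv_def mid_pushout by blast
qed

end

section \<open>The Baer sum\<close>

lemma tg_hom_ident: "(\<lambda>x. x) \<in> tg_hom G G"
  by (simp add: tg_hom_def hom_def)

lemma tg_hom_multiplication:
  assumes H: "top_ab_group H"
  shows "(\<lambda>(h, k). h \<otimes>\<^bsub>H\<^esub> k) \<in> tg_hom (tg_prod H H) H"
proof -
  have "(\<lambda>z. fst z \<otimes>\<^bsub>H\<^esub> snd z) \<in> tg_hom (tg_prod H H) H"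
    by (intro tg_hom_prod_mult tg_hom_fst tg_hom_snd H)
  then show ?thesis by (simp add: case_prod_unfold)
qed

lemma tg_hom_diagonal: "(\<lambda>g. (g, g)) \<in> tg_hom G (tg_prod G G)"
  by (rule tg_hom_pair) (auto simp: tg_hom_def hom_def)

abbreviation fibre_product ::
  "'g top_group \<Rightarrow> ('h, 'x, 'g) extn \<Rightarrow> ('h, 'y, 'g) extn \<Rightarrow> ('h \<times> 'h, ('x \<times> 'y) \<times> 'g, 'g) extn" where
  "fibre_product G E E' \<equiv> pullback_extension G (\<lambda>g. (g, g)) (prod_extension E E')"

lemma top_extension_fibre_product:
  assumes "top_extension G H E" "top_extension G H E'"
  shows "top_extension G (tg_prod H H) (fibre_product G E E')"
  by (rule top_extension_pullback[OF top_extension_prod[OF assms] top_extension.G[OF assms(1)] tg_hom_diagonal])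

lemma pushout_fibre_product:
  assumes "top_extension G H E" "top_extension G H E'"
  shows "pushout G (tg_prod H H) (fibre_product G E E') H (\<lambda>(h, k). h \<otimes>\<^bsub>H\<^esub> k)"
proof -
  interpret E: top_extension G H E by fact
  show ?thesis
    using top_extension_fibre_product[OF assms] tg_hom_multiplication[OF E.H] E.H by (simp add: pushout_def pushout_axioms_def)
qed

lemma top_extension_Baer_sum:
  assumes "top_extension G H E" "top_extension G H E'"
  shows "top_extension G H (Baer_sum G H E E')"
  unfolding Baer_sum_def by (rule pushout.top_extension_pushout[OF pushout_fibre_product[OF assms]])

text \<open>A map from the fibre product of two extensions to a third one that adds the \<open>H\<close>-components.
  Having such a map characterises the Baer sum up to equivalence (\<open>Baer_sum_equivI\<close> and
  \<open>Baer_sum_pairing\<close>), so that compatibility of the Baer sum with equivalences and with restriction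
  becomes a matter of composing and restricting pairings.\<close>

definition additive_pairing ::
  "'h top_group \<Rightarrow> 'g top_group \<Rightarrow> ('h, 'x, 'g) extn \<Rightarrow> ('h, 'y, 'g) extn \<Rightarrow> ('h, 'z, 'g) extn \<Rightarrow>
     (('x \<times> 'y) \<times> 'g \<Rightarrow> 'z) \<Rightarrow> bool" where
  "additive_pairing H G E E' E'' S \<longleftrightarrow>
     S \<in> tg_hom (mid (fibre_product G E E')) (mid E'') \<and>
     (\<forall>h\<in>carrier H. \<forall>k\<in>carrier H. S ((inc E h, inc E' k), \<one>\<^bsub>G\<^esub>) = inc E'' (h \<otimes>\<^bsub>H\<^esub> k)) \<and>
     (\<forall>z\<in>carrier (mid (fibre_product G E E')). prj E'' (S z) = snd z)"

lemma Baer_sum_equivI: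
  assumes "top_extension G H E" "top_extension G H E'" "top_extension G H E''"
    and "additive_pairing H G E E' E'' S"
  shows "ext_equiv H (Baer_sum G H E E') E''"
  unfolding Baer_sum_def
proof (rule pushout.pushout_equivI[OF pushout_fibre_product[OF assms(1,2)] assms(3)])
  show "S \<in> tg_hom (mid (fibre_product G E E')) (mid E'')"
    using assms(4) by (simp add: additive_pairing_def)
  show "S (inc (fibre_product G E E') h) = inc E'' ((\<lambda>(h, k). h \<otimes>\<^bsub>H\<^esub> k) h)"
    if "h \<in> carrier (tg_prod H H)" for h
    using assms(4) that by (cases h) (simp add: additive_pairing_def)
  show "prj E'' (S x) = prj (fibre_product G E E') x" if "x \<in> carrier (mid (fibre_product G E E'))" for x
    using assms(4) that unfolding additive_pairing_def pullback_extension_simps(3) by blast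
qed

lemma Baer_sum_pairing:
  assumes E: "top_extension G H E" and E': "top_extension G H E'"
  shows "\<exists>S. additive_pairing H G E E' (Baer_sum G H E E') S"
proof -
  interpret E: top_extension G H E by fact
  interpret E': top_extension G H E' by fact
  let ?F = "fibre_product G E E'"
  interpret B: pushout G "tg_prod H H" ?F H "\<lambda>(h, k). h \<otimes>\<^bsub>H\<^esub> k"
    by (rule pushout_fibre_product[OF assms])
  define S where "S z = B.Q.q (\<one>\<^bsub>H\<^esub>, z)" for z
  have "(\<lambda>z. \<one>\<^bsub>H\<^esub>) \<in> tg_hom (mid ?F) H" 
    by (simp only: tg_hom_def mem_Collect_eq continuous_map_const E.H.topspace_eq) (simp add: hom_def)
  then have "(\<lambda>z. (\<one>\<^bsub>H\<^esub>, z)) \<in> tg_hom (mid ?F) B.P"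
    by (rule tg_hom_pair[OF _ tg_hom_ident])
  from tg_hom_compose[OF this B.Q.q_tg_hom]
  have Sh: "S \<in> tg_hom (mid ?F) (mid (Baer_sum G H E E'))"
    unfolding Baer_sum_def B.mid_pushout S_def .
  have Si: "S ((inc E h, inc E' k), \<one>\<^bsub>G\<^esub>) = inc (Baer_sum G H E E') (h \<otimes>\<^bsub>H\<^esub> k)"
    if hk: "h \<in> carrier H" "k \<in> carrier H" for h k
  proof -
    have hkc: "(h, k) \<in> carrier (tg_prod H H)" using hk by simp
    have i: "((inc E h, inc E' k), \<one>\<^bsub>G\<^esub>) = inc ?F (h, k)" by simp
    have ic: "inc ?F (h, k) \<in> carrier (mid ?F)" using hk by simp
    have "B.Q.q (\<one>\<^bsub>H\<^esub>, inc ?F (h, k)) = B.Q.q (h \<otimes>\<^bsub>H\<^esub> k, \<one>\<^bsub>mid ?F\<^esub>)"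
    proof (subst B.q_eq_iff')
      show "\<exists>z\<in>carrier (tg_prod H H).
         \<one>\<^bsub>H\<^esub> \<otimes>\<^bsub>H\<^esub> inv\<^bsub>H\<^esub> (h \<otimes>\<^bsub>H\<^esub> k) = (case z of (h, k) \<Rightarrow> h \<otimes>\<^bsub>H\<^esub> k) \<and>
         inc ?F (h, k) \<otimes>\<^bsub>mid ?F\<^esub> inv\<^bsub>mid ?F\<^esub> \<one>\<^bsub>mid ?F\<^esub> = inv\<^bsub>mid ?F\<^esub> inc ?F z"
      proof (intro bexI conjI)
        let ?z = "inv\<^bsub>tg_prod H H\<^esub> (h, k)"
        have z: "?z = (inv\<^bsub>H\<^esub> h, inv\<^bsub>H\<^esub> k)"
          by (rule inv_tg_prod[OF E.H.comm_group_axioms E.H.comm_group_axioms hk])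
        show "?z \<in> carrier (tg_prod H H)" using z hk by simp
        show "\<one>\<^bsub>H\<^esub> \<otimes>\<^bsub>H\<^esub> inv\<^bsub>H\<^esub> (h \<otimes>\<^bsub>H\<^esub> k) = (case ?z of (h, k) \<Rightarrow> h \<otimes>\<^bsub>H\<^esub> k)"
          using hk by (simp add: z E.H.inv_mult)
        have "inv\<^bsub>mid ?F\<^esub> inc ?F ?z = inc ?F (h, k)"
          by (simp only: B.i.hom_inv[OF hkc] B.X.inv_inv[OF ic])
        then show "inc ?F (h, k) \<otimes>\<^bsub>mid ?F\<^esub> inv\<^bsub>mid ?F\<^esub> \<one>\<^bsub>mid ?F\<^esub> = inv\<^bsub>mid ?F\<^esub> inc ?F ?z"
          by (simp only: B.X.inv_one B.X.r_one[OF ic])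
      qed
    qed (use hk ic in \<open>simp_all only: E.H.one_closed E.H.m_closed B.X.one_closed\<close>)
    then show ?thesis unfolding S_def i Baer_sum_def B.inc_pushout .
  qed
  have Sp: "prj (Baer_sum G H E E') (S z) = snd z" if z: "z \<in> carrier (mid ?F)" for z
    unfolding S_def Baer_sum_def B.prj_pushout[OF E.H.one_closed z] by simp
  show ?thesis unfolding additive_pairing_def using Sh Si Sp by blast
qed

lemma additive_pairing_compose:
  assumes S: "additive_pairing H G E E' E'' S"
    and E: "top_extension G H E" "top_extension G H E'" and F: "top_extension G H F" "top_extension G H F'"
    and T: "T \<in> tg_hom (mid F) (mid E)" "\<And>h. h \<in> carrier H \<Longrightarrow> T (inc F h) = inc E h"
      "\<And>x. x \<in> carrier (mid F) \<Longrightarrow> prj E (T x) = prj F x"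
    and T': "T' \<in> tg_hom (mid F') (mid E')" "\<And>h. h \<in> carrier H \<Longrightarrow> T' (inc F' h) = inc E' h"
      "\<And>x. x \<in> carrier (mid F') \<Longrightarrow> prj E' (T' x) = prj F' x"
  shows "additive_pairing H G F F' E'' (\<lambda>z. S (map_prod (map_prod T T') (\<lambda>g. g) z))"
proof -
  interpret F: top_extension G H F by fact
  interpret F': top_extension G H F' by fact
  let ?R = "map_prod (map_prod T T') (\<lambda>g. g)"
  let ?A = "mid (fibre_product G F F')" and ?B = "mid (fibre_product G E E')"
  note FF = F.X.top_ab_group_axioms F'.X.top_ab_group_axioms
  interpret A: top_extension G "tg_prod H H" "fibre_product G F F'"
    by (rule top_extension_fibre_product[OF F])
  have "?R \<in> tg_hom (tg_prod (tg_prod (mid F) (mid F')) G) (tg_prod (tg_prod (mid E) (mid E')) G)"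
    by (intro tg_hom_map_prod top_ab_group_prod FF F.G T(1) T'(1) tg_hom_ident)
  then have R0: "?R \<in> tg_hom ?A (tg_prod (tg_prod (mid E) (mid E')) G)"
    unfolding pullback_extension_simps(1) prod_extension_simps(1) by (rule tg_hom_from_sub) auto
  have Rc: "?R z \<in> carrier ?B" if z: "z \<in> carrier ?A" for z
  proof -
    obtain x y g where "z = ((x, y), g)" and x: "x \<in> carrier (mid F)" and y: "y \<in> carrier (mid F')" and "g \<in> carrier G"
      "prj F x = g" "prj F' y = g" using z by auto
    then show ?thesis
      by (simp add: T(3)[OF x] T'(3)[OF y] tg_hom_closed[OF T(1) x] tg_hom_closed[OF T'(1) y])
  qed
  then have "?R ` carrier ?A \<subseteq> carrier ?B" by (rule image_subsetI)
  then have "?R \<in> tg_hom ?A (tg_sub (tg_prod (tg_prod (mid E) (mid E')) G) (carrier ?B))"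
    by (rule tg_hom_into_sub[OF R0 _ A.X.topspace_eq])
  then have R: "?R \<in> tg_hom ?A ?B"
    by (simp only: pullback_extension_simps(1) prod_extension_simps(1) tg_sub_simps(1))
  have "(\<lambda>z. S (?R z)) \<in> tg_hom ?A (mid E'')"
    using S by (intro tg_hom_compose[OF R]) (simp only: additive_pairing_def)
  moreover have "S (?R ((inc F h, inc F' k), \<one>\<^bsub>G\<^esub>)) = inc E'' (h \<otimes>\<^bsub>H\<^esub> k)"
    if "h \<in> carrier H" "k \<in> carrier H" for h k
  proof -
    have "?R ((inc F h, inc F' k), \<one>\<^bsub>G\<^esub>) = ((inc E h, inc E' k), \<one>\<^bsub>G\<^esub>)"
      by (simp only: map_prod_simp T(2)[OF that(1)] T'(2)[OF that(2)])
    then show ?thesis using S that unfolding additive_pairing_def by simp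
  qed
  moreover have "prj E'' (S (?R z)) = snd z" if "z \<in> carrier ?A" for z
  proof -
    have "prj E'' (S (?R z)) = snd (?R z)" using S Rc[OF that] unfolding additive_pairing_def by blast
    then show ?thesis by (cases z) simp
  qed
  ultimately show ?thesis unfolding additive_pairing_def by blast
qed

lemma Baer_sum_cong:
  assumes E: "top_extension G H E" "top_extension G H E'" and F: "top_extension G H F" "top_extension G H F'"
    and "ext_equiv H F E" "ext_equiv H F' E'"
  shows "ext_equiv H (Baer_sum G H F F') (Baer_sum G H E E')"
proof -
  obtain T where T: "T \<in> tg_hom (mid F) (mid E)" "\<And>h. h \<in> carrier H \<Longrightarrow> T (inc F h) = inc E h"
      "\<And>x. x \<in> carrier (mid F) \<Longrightarrow> prj E (T x) = prj F x"
    using assms(5) unfolding ext_equiv_def by blast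
  obtain T' where T': "T' \<in> tg_hom (mid F') (mid E')" "\<And>h. h \<in> carrier H \<Longrightarrow> T' (inc F' h) = inc E' h"
      "\<And>x. x \<in> carrier (mid F') \<Longrightarrow> prj E' (T' x) = prj F' x"
    using assms(6) unfolding ext_equiv_def by blast
  obtain S where S: "additive_pairing H G E E' (Baer_sum G H E E') S"
    using Baer_sum_pairing[OF E] by blast
  show ?thesis
    by (rule Baer_sum_equivI[OF F top_extension_Baer_sum[OF E] additive_pairing_compose[OF S E F T T']])
qed

section \<open>Restriction to a subgroup\<close>

definition restrict_extension :: "'g set \<Rightarrow> ('h, 'x, 'g) extn \<Rightarrow> ('h, 'x, 'g) extn" where
  "restrict_extension D E =
     \<lparr>mid = tg_sub (mid E) {x \<in> carrier (mid E). prj E x \<in> D}, inc = inc E, prj = prj E\<rparr>"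

lemma restrict_extension_simps [simp]:
  "mid (restrict_extension D E) = tg_sub (mid E) {x \<in> carrier (mid E). prj E x \<in> D}"
  "inc (restrict_extension D E) = inc E" "prj (restrict_extension D E) = prj E"
  by (simp_all add: restrict_extension_def)

lemma top_extension_restrict:
  assumes E: "top_extension G H E" and D: "subgroup D G"
  shows "top_extension (tg_sub G D) H (restrict_extension D E)"
proof -
  interpret E: top_extension G H E by fact
  interpret D: subgroup D G by fact
  let ?S = "{x \<in> carrier (mid E). prj E x \<in> D}"
  have S: "subgroup ?S (mid E)"
    by (rule E.X.subgroupI) (auto intro!: exI[of _ "\<one>\<^bsub>mid E\<^esub>"])
  have one: "\<one>\<^bsub>mid E\<^esub> \<in> ?S" by simp
  show ?thesis
  proof (intro top_extension.intro is_extensionI)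
    show "top_ab_group (mid (restrict_extension D E))"
      using top_ab_group_sub[OF E.X.top_ab_group_axioms S] by simp
    show "top_ab_group (tg_sub G D)" "top_ab_group (tg_sub G D)" by (rule top_ab_group_sub[OF E.G D])+
    show "inc (restrict_extension D E) \<in> tg_hom H (mid (restrict_extension D E))"
      unfolding restrict_extension_simps
      by (rule tg_hom_into_sub[OF E.inc_tg_hom]) (auto simp: E.H.topspace_eq)
    have "prj E \<in> tg_hom (tg_sub (mid E) ?S) G" by (rule tg_hom_from_sub[OF E.prj_tg_hom]) auto
    then show "prj (restrict_extension D E) \<in> tg_hom (mid (restrict_extension D E)) (tg_sub G D)"
      unfolding restrict_extension_simps
      by (rule tg_hom_into_sub) (auto simp: E.X.topspace_eq)
  next
    fix U assume "open_unit_nbhd H U"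
    from E.unit_nbhd_inc[OF this] obtain V where V: "open_unit_nbhd (mid E) V" "\<forall>h\<in>carrier H. inc E h \<in> V \<longrightarrow> h \<in> U"
      by (elim exE conjE)
    then show "\<exists>V. open_unit_nbhd (mid (restrict_extension D E)) V \<and>
      (\<forall>h\<in>carrier H. inc (restrict_extension D E) h \<in> V \<longrightarrow> h \<in> U)"
      using unit_nbhd_sub[OF V(1) one] by (intro exI[of _ "V \<inter> ?S"]) auto
  next
    fix U assume "open_unit_nbhd (mid (restrict_extension D E)) U"
    then obtain U' where U': "open_unit_nbhd (mid E) U'" "U = U' \<inter> ?S"
      unfolding restrict_extension_simps by (rule unit_nbhd_subE)
    have "open_unit_nbhd (tg_sub G D) (prj E ` U' \<inter> D)" by (rule unit_nbhd_sub[OF E.unit_nbhd_prj[OF U'(1)] D.one_closed])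
    moreover have "prj E ` U' \<inter> D \<subseteq> prj E ` U" using U'(2) E.X.unit_nbhd_carrier[OF U'(1)] by auto
    ultimately show "\<exists>V. open_unit_nbhd (tg_sub G D) V \<and> V \<subseteq> prj (restrict_extension D E) ` U" 
      unfolding restrict_extension_simps by blast
  next
    fix h assume "h \<in> carrier H" "inc (restrict_extension D E) h = \<one>\<^bsub>mid (restrict_extension D E)\<^esub>"
    then show "h = \<one>\<^bsub>H\<^esub>" using E.inc_eqD[of h "\<one>\<^bsub>H\<^esub>"] by simp
  next
    fix x assume "x \<in> carrier (mid (restrict_extension D E))" "prj (restrict_extension D E) x = \<one>\<^bsub>tg_sub G D\<^esub>"
    then show "\<exists>h\<in>carrier H. x = inc (restrict_extension D E) h"
      using E.prj_eq_one[of x] by simp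
  next
    fix g assume g: "g \<in> carrier (tg_sub G D)"
    then obtain x where "x \<in> carrier (mid E)" "prj E x = g" using E.prj_surj[of g] D.subset by auto
    then show "\<exists>x\<in>carrier (mid (restrict_extension D E)). prj (restrict_extension D E) x = g"
      using g by auto
  qed (simp_all add: E.H)
qed

lemma ext_equiv_restrict:
  assumes E: "top_extension G H E" and eq: "ext_equiv H E E'" and D: "subgroup D G"
  shows "ext_equiv H (restrict_extension D E) (restrict_extension D E')"
proof -
  interpret E: top_extension G H E by fact
  from eq obtain T where T: "T \<in> tg_hom (mid E) (mid E')"
    and Ti: "\<And>h. h \<in> carrier H \<Longrightarrow> T (inc E h) = inc E' h"
    and Tp: "\<And>x. x \<in> carrier (mid E) \<Longrightarrow> prj E' (T x) = prj E x"
    unfolding ext_equiv_def by blast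
  have "T \<in> tg_hom (mid (restrict_extension D E)) (mid E')"
    unfolding restrict_extension_simps by (rule tg_hom_from_sub[OF T]) auto
  then have "T \<in> tg_hom (mid (restrict_extension D E)) (mid (restrict_extension D E'))"
    unfolding restrict_extension_simps(1)[of D E']
    by (rule tg_hom_into_sub) (auto simp: E.X.topspace_eq Tp tg_hom_closed[OF T])
  then show ?thesis unfolding ext_equiv_def using Ti Tp by (intro bexI[of _ T]) auto
qed

text \<open>The fibre product of the restrictions sits inside the fibre product, with the subspace topology
  inherited through the ambient product; the pairing is restricted along this inclusion.\<close>

lemma additive_pairing_restrict:
  assumes S: "additive_pairing H G E E' E'' S" and D: "subgroup D G"
    and E: "top_extension G H E" "top_extension G H E'"  "top_extension G H E''"
  shows "additive_pairing H (tg_sub G D) (restrict_extension D E) (restrict_extension D E')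
    (restrict_extension D E'') S"
proof -
  interpret E: top_extension G H E by (rule E(1))
  interpret E': top_extension G H E' by (rule E(2))
  interpret D: subgroup D G by (rule D)
  let ?rE = "restrict_extension D E" and ?rE' = "restrict_extension D E'" and ?rE'' = "restrict_extension D E''"
  note r = E(1,2)[THEN top_extension_restrict, OF D]
  let ?A = "mid (fibre_product (tg_sub G D) ?rE ?rE')" and ?B = "mid (fibre_product G E E')"
  interpret A: top_extension "tg_sub G D" "tg_prod H H" "fibre_product (tg_sub G D) ?rE ?rE'"
    by (rule top_extension_fibre_product[OF r])
  interpret rE: top_extension "tg_sub G D" H ?rE by (rule r)
  interpret rE': top_extension "tg_sub G D" H ?rE' by (rule r)
  have "map_prod (map_prod (\<lambda>x. x) (\<lambda>x. x)) (\<lambda>x. x)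
      \<in> tg_hom (tg_prod (tg_prod (mid ?rE) (mid ?rE')) (tg_sub G D)) (tg_prod (tg_prod (mid E) (mid E')) G)"
  proof (intro tg_hom_map_prod top_ab_group_prod)
    show "(\<lambda>x. x) \<in> tg_hom (mid ?rE) (mid E)" "(\<lambda>x. x) \<in> tg_hom (mid ?rE') (mid E')"
      unfolding restrict_extension_simps by (rule tg_hom_from_sub[OF tg_hom_ident], blast)+
    show "(\<lambda>x. x) \<in> tg_hom (tg_sub G D) G" by (rule tg_hom_from_sub[OF tg_hom_ident D.subset])
  qed (rule rE.X.top_ab_group_axioms rE'.X.top_ab_group_axioms rE.G)+
  then have "(\<lambda>x. x) \<in> tg_hom (tg_prod (tg_prod (mid ?rE) (mid ?rE')) (tg_sub G D)) (tg_prod (tg_prod (mid E) (mid E')) G)"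
    by (simp only: map_prod_ident)
  then have I0: "(\<lambda>x. x) \<in> tg_hom ?A (tg_prod (tg_prod (mid E) (mid E')) G)"
    unfolding pullback_extension_simps(1) prod_extension_simps(1) by (rule tg_hom_from_sub) auto
  have sub: "carrier ?A \<subseteq> carrier ?B" using D.subset by auto
  then have "(\<lambda>x. x) ` carrier ?A \<subseteq> carrier ?B" by blast
  then have "(\<lambda>x. x) \<in> tg_hom ?A (tg_sub (tg_prod (tg_prod (mid E) (mid E')) G) (carrier ?B))"
    by (rule tg_hom_into_sub[OF I0 _ A.X.topspace_eq])
  then have I: "(\<lambda>x. x) \<in> tg_hom ?A ?B"
    by (simp only: pullback_extension_simps(1) prod_extension_simps(1) tg_sub_simps(1))
  have SB: "S \<in> tg_hom ?B (mid E'')" using S by (simp only: additive_pairing_def)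
  have Sp: "prj E'' (S z) = snd z" if "z \<in> carrier ?A" for z
    using S sub that unfolding additive_pairing_def by blast
  have snd: "snd z \<in> D" if "z \<in> carrier ?A" for z using that by auto
  have "S \<in> tg_hom ?A (mid ?rE'')"
    unfolding restrict_extension_simps(1)[of D E'']
  proof (rule tg_hom_into_sub[OF tg_hom_compose[OF I SB] _ A.X.topspace_eq])
    show "S ` carrier ?A \<subseteq> {x \<in> carrier (mid E''). prj E'' x \<in> D}"
      using Sp snd sub tg_hom_closed[OF SB] by auto
  qed
  moreover have "S ((inc ?rE h, inc ?rE' k), \<one>\<^bsub>tg_sub G D\<^esub>) = inc ?rE'' (h \<otimes>\<^bsub>H\<^esub> k)"
    if "h \<in> carrier H" "k \<in> carrier H" for h k
    using S that unfolding additive_pairing_def by simp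
  moreover have "prj ?rE'' (S z) = snd z" if "z \<in> carrier ?A" for z using Sp[OF that] by simp
  ultimately show ?thesis unfolding additive_pairing_def by blast
qed

lemma Baer_sum_restrict:
  assumes E: "top_extension G H E" "top_extension G H E'" and D: "subgroup D G"
  shows "ext_equiv H (Baer_sum (tg_sub G D) H (restrict_extension D E) (restrict_extension D E'))
    (restrict_extension D (Baer_sum G H E E'))"
proof -
  obtain S where S: "additive_pairing H G E E' (Baer_sum G H E E') S"
    using Baer_sum_pairing[OF E] by blast
  note B = top_extension_Baer_sum[OF E]
  show ?thesis
    by (rule Baer_sum_equivI[OF E[THEN top_extension_restrict, OF D] top_extension_restrict[OF B D]
      additive_pairing_restrict[OF S D E B]])
qed

section \<open>The Raikov completion\<close>

text \<open>A filter is round if it is unchanged by thickening its members by unit neighbourhoods. The round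
  Cauchy filters are the minimal ones: every Cauchy filter contains exactly one of them. With them as the
  points of the completion, equality of points is equality of filters, and the group laws are identities
  between filters.\<close>

definition round_filter :: "'a top_group \<Rightarrow> 'a filter \<Rightarrow> bool" where
  "round_filter G F \<longleftrightarrow> (\<forall>P. eventually P F \<longrightarrow>
     (\<exists>U. open_unit_nbhd G U \<and> (\<forall>\<^sub>F x in F. \<forall>u\<in>U. P (x \<otimes>\<^bsub>G\<^esub> u))))"

definition minimal_Cauchy :: "'a top_group \<Rightarrow> 'a filter \<Rightarrow> bool" where
  "minimal_Cauchy G F \<longleftrightarrow> Cauchy_filter_in G F \<and> round_filter G F"

definition filter_mult :: "'a top_group \<Rightarrow> 'a filter \<Rightarrow> 'a filter \<Rightarrow> 'a filter" where
  "filter_mult G F F' = filtermap (\<lambda>(x, y). x \<otimes>\<^bsub>G\<^esub> y) (F \<times>\<^sub>F F')"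

lemma eventually_filter_mult:
  "eventually P (filter_mult G F F') \<longleftrightarrow>
     (\<exists>A B. eventually A F \<and> eventually B F' \<and> (\<forall>a b. A a \<longrightarrow> B b \<longrightarrow> P (a \<otimes>\<^bsub>G\<^esub> b)))"
  by (simp add: filter_mult_def eventually_filtermap eventually_prod_filter)

text \<open>The sets of all minimal Cauchy filters containing a given open set form a base of the topology.\<close>

definition Raikov_completion :: "'a top_group \<Rightarrow> 'a filter top_group" where
  "Raikov_completion G =
     \<lparr>carrier = {F. minimal_Cauchy G F}, mult = filter_mult G, one = nhdsin (topo G) \<one>\<^bsub>G\<^esub>,
      topo = topology (\<lambda>\<U>. \<U> \<subseteq> {F. minimal_Cauchy G F} \<and>
        (\<forall>F\<in>\<U>. \<exists>A. openin (topo G) A \<and> (\<forall>\<^sub>F x in F. x \<in> A) \<and>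
           (\<forall>F'. minimal_Cauchy G F' \<longrightarrow> (\<forall>\<^sub>F x in F'. x \<in> A) \<longrightarrow> F' \<in> \<U>)))\<rparr>"

lemma Raikov_completion_simps [simp]:
  "carrier (Raikov_completion G) = {F. minimal_Cauchy G F}"
  "mult (Raikov_completion G) = filter_mult G"
  "one (Raikov_completion G) = nhdsin (topo G) \<one>\<^bsub>G\<^esub>"
  by (simp_all add: Raikov_completion_def)

lemma openin_Raikov:
  "openin (topo (Raikov_completion G)) \<U> \<longleftrightarrow> \<U> \<subseteq> {F. minimal_Cauchy G F} \<and>
     (\<forall>F\<in>\<U>. \<exists>A. openin (topo G) A \<and> (\<forall>\<^sub>F x in F. x \<in> A) \<and>
        (\<forall>F'. minimal_Cauchy G F' \<longrightarrow> (\<forall>\<^sub>F x in F'. x \<in> A) \<longrightarrow> F' \<in> \<U>))"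
proof -
  let ?op = "\<lambda>\<U>. \<U> \<subseteq> {F. minimal_Cauchy G F} \<and>
     (\<forall>F\<in>\<U>. \<exists>A. openin (topo G) A \<and> (\<forall>\<^sub>F x in F. x \<in> A) \<and>
        (\<forall>F'. minimal_Cauchy G F' \<longrightarrow> (\<forall>\<^sub>F x in F'. x \<in> A) \<longrightarrow> F' \<in> \<U>))"
  have "istopology ?op"
    unfolding istopology_def
  proof (intro conjI allI impI)
    fix S T assume S: "?op S" and T: "?op T"
    show "S \<inter> T \<subseteq> {F. minimal_Cauchy G F}" using S by blast
    show "\<forall>F\<in>S \<inter> T. \<exists>A. openin (topo G) A \<and> (\<forall>\<^sub>F x in F. x \<in> A) \<and>
        (\<forall>F'. minimal_Cauchy G F' \<longrightarrow> (\<forall>\<^sub>F x in F'. x \<in> A) \<longrightarrow> F' \<in> S \<inter> T)"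
    proof
      fix F assume F: "F \<in> S \<inter> T"
      obtain A where A: "openin (topo G) A" "\<forall>\<^sub>F x in F. x \<in> A"
        "\<forall>F'. minimal_Cauchy G F' \<longrightarrow> (\<forall>\<^sub>F x in F'. x \<in> A) \<longrightarrow> F' \<in> S" using S F by blast
      obtain B where B: "openin (topo G) B" "\<forall>\<^sub>F x in F. x \<in> B"
        "\<forall>F'. minimal_Cauchy G F' \<longrightarrow> (\<forall>\<^sub>F x in F'. x \<in> B) \<longrightarrow> F' \<in> T" using T F by blast
      show "\<exists>A. openin (topo G) A \<and> (\<forall>\<^sub>F x in F. x \<in> A) \<and>
        (\<forall>F'. minimal_Cauchy G F' \<longrightarrow> (\<forall>\<^sub>F x in F'. x \<in> A) \<longrightarrow> F' \<in> S \<inter> T)"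
        using A B by (intro exI[of _ "A \<inter> B"]) (simp add: eventually_conj_iff openin_Int)
    qed
  next
    fix K assume "\<forall>S\<in>K. ?op S"
    then show "\<Union> K \<subseteq> {F. minimal_Cauchy G F}"
      "\<forall>F\<in>\<Union> K. \<exists>A. openin (topo G) A \<and> (\<forall>\<^sub>F x in F. x \<in> A) \<and>
        (\<forall>F'. minimal_Cauchy G F' \<longrightarrow> (\<forall>\<^sub>F x in F'. x \<in> A) \<longrightarrow> F' \<in> \<Union> K)" by (blast, meson UnionE UnionI)
  qed
  then show ?thesis by (simp add: Raikov_completion_def topology_inverse')
qed

context top_ab_group
begin

lemma Cauchy_small_set:
  assumes "Cauchy_filter_in G F" "open_unit_nbhd G U"
  shows "\<exists>A. (\<forall>\<^sub>F x in F. x \<in> A) \<and> A \<subseteq> carrier G \<and> (\<forall>a\<in>A. \<forall>b\<in>A. a \<otimes> inv b \<in> U)"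
proof -
  have "\<forall>\<^sub>F (x, y) in F \<times>\<^sub>F F. x \<otimes> inv y \<in> U" and c: "\<forall>\<^sub>F x in F. x \<in> carrier G"
    using assms by (auto simp: Cauchy_filter_in_def open_unit_nbhd_def le_principal)
  then obtain P where P: "eventually P F" "\<And>x y. P x \<Longrightarrow> P y \<Longrightarrow> x \<otimes> inv y \<in> U"
    by (auto simp: eventually_prod_same)
  show ?thesis
    using P c by (intro exI[of _ "{x \<in> carrier G. P x}"]) (auto simp: eventually_conj_iff)
qed

lemma Cauchy_filterI:
  assumes "F \<noteq> bot" "\<forall>\<^sub>F x in F. x \<in> carrier G"
    and "\<And>U. open_unit_nbhd G U \<Longrightarrow> \<exists>A. (\<forall>\<^sub>F x in F. x \<in> A) \<and> (\<forall>a\<in>A. \<forall>b\<in>A. a \<otimes> inv b \<in> U)"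
  shows "Cauchy_filter_in G F"
  unfolding Cauchy_filter_in_def
proof (intro conjI allI impI)
  show "F \<le> principal (carrier G)" using assms(2) by (simp add: le_principal)
  fix U assume "openin (topo G) U \<and> \<one> \<in> U"
  then obtain A where A: "\<forall>\<^sub>F x in F. x \<in> A" "\<forall>a\<in>A. \<forall>b\<in>A. a \<otimes> inv b \<in> U"
    using assms(3)[unfolded open_unit_nbhd_def] by (elim exE conjE) blast
  show "\<forall>\<^sub>F (x, y) in F \<times>\<^sub>F F. x \<otimes> inv y \<in> U"
    unfolding eventually_prod_same using A by (intro exI[of _ "\<lambda>x. x \<in> A"]) auto
qed (rule assms)

lemma minimal_CauchyD:
  assumes "minimal_Cauchy G F"
  shows "Cauchy_filter_in G F" "F \<noteq> bot" "\<forall>\<^sub>F x in F. x \<in> carrier G"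
  using assms by (auto simp: minimal_Cauchy_def Cauchy_filter_in_def le_principal)

lemma minimal_Cauchy_round:
  assumes "minimal_Cauchy G F" "eventually P F"
  obtains U where "open_unit_nbhd G U" "\<forall>\<^sub>F x in F. \<forall>u\<in>U. P (x \<otimes> u)"
  using assms unfolding minimal_Cauchy_def round_filter_def by blast

text \<open>Round filters have a base of open sets, namely the thickenings of their members.\<close>

lemma minimal_Cauchy_open:
  assumes "minimal_Cauchy G F" "eventually P F"
  shows "\<exists>A. openin (topo G) A \<and> (\<forall>\<^sub>F x in F. x \<in> A) \<and> (\<forall>a\<in>A. P a)"
proof -
  obtain U where U: "open_unit_nbhd G U" "\<forall>\<^sub>F x in F. \<forall>u\<in>U. P (x \<otimes> u)"
    by (rule minimal_Cauchy_round[OF assms])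
  let ?A = "\<Union>x\<in>{x \<in> carrier G. \<forall>u\<in>U. P (x \<otimes> u)}. (\<lambda>u. x \<otimes> u) ` U"
  show ?thesis
  proof (intro exI conjI)
    show "openin (topo G) ?A" using openin_translate U(1) by (auto simp: open_unit_nbhd_def)
    have "x \<in> ?A" if "x \<in> carrier G" "\<forall>u\<in>U. P (x \<otimes> u)" for x
      using that U(1) by (intro UN_I[of x] image_eqI[of _ _ \<one>]) (auto simp: open_unit_nbhd_def)
    then show "\<forall>\<^sub>F x in F. x \<in> ?A"
      using eventually_conj[OF minimal_CauchyD(3)[OF assms(1)] U(2)] by (auto elim: eventually_mono)
  qed auto
qed

text \<open>If the members of two minimal Cauchy filters always meet, the filters coincide: a small member
  of \<open>F'\<close> that meets a member of \<open>F\<close> is contained in its thickening. Identities in the completion are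
  proved in this way, mostly through the special case \<open>minimal_Cauchy_le_eq\<close>, where one inclusion
  between the filters suffices.\<close>

lemma minimal_Cauchy_mesh_le:
  assumes F: "minimal_Cauchy G F" and F': "minimal_Cauchy G F'"
    and mesh: "\<And>A B. eventually A F \<Longrightarrow> eventually B F' \<Longrightarrow> \<exists>x. A x \<and> B x"
  shows "F' \<le> F"
proof (rule filter_leI)
  fix P assume "eventually P F"
  then obtain U where U: "open_unit_nbhd G U" "\<forall>\<^sub>F x in F. \<forall>u\<in>U. P (x \<otimes> u)"
    by (rule minimal_Cauchy_round[OF F])
  obtain B where B: "\<forall>\<^sub>F x in F'. x \<in> B" "B \<subseteq> carrier G" "\<forall>a\<in>B. \<forall>b\<in>B. a \<otimes> inv b \<in> U"
    using Cauchy_small_set[OF minimal_CauchyD(1)[OF F'] U(1)] by (elim exE conjE)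
  obtain x where x: "\<forall>u\<in>U. P (x \<otimes> u)" "x \<in> B" using mesh[OF U(2) B(1)] by blast
  have "P b" if b: "b \<in> B" for b
  proof -
    have "P (x \<otimes> (b \<otimes> inv x))" using x(1) B(3)[rule_format, OF b x(2)] by blast
    moreover have "x \<in> carrier G" "b \<in> carrier G" using B(2) b x(2) by blast+
    ultimately show ?thesis by (simp only: cancel_middle)
  qed
  then show "eventually P F'" using B(1) by (auto elim: eventually_mono)
qed

lemma minimal_Cauchy_eqI:
  assumes F: "minimal_Cauchy G F" and F': "minimal_Cauchy G F'"
    and mesh: "\<And>A B. eventually A F \<Longrightarrow> eventually B F' \<Longrightarrow> \<exists>x. A x \<and> B x"
  shows "F = F'"
  using minimal_Cauchy_mesh_le[OF F F' mesh] minimal_Cauchy_mesh_le[OF F' F] mesh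
  by (meson antisym)

lemma minimal_Cauchy_le_eq:
  assumes F: "minimal_Cauchy G F" and F': "minimal_Cauchy G F'" and le: "F \<le> F'"
  shows "F = F'"
proof (rule minimal_Cauchy_eqI[OF F F'])
  fix A B assume "eventually A F" "eventually B F'"
  then have "\<forall>\<^sub>F x in F. A x \<and> B x" using le by (auto simp: eventually_conj_iff filter_leD)
  then show "\<exists>x. A x \<and> B x" using eventually_happens'[OF minimal_CauchyD(2)[OF F]] by blast
qed

lemma eventually_nhdsin_carrier:
  "x \<in> carrier G \<Longrightarrow> eventually P (nhdsin (topo G) x) \<longleftrightarrow> (\<exists>S. openin (topo G) S \<and> x \<in> S \<and> (\<forall>y\<in>S. P y))"
  by (simp add: eventually_nhdsin topspace_eq)

lemma eventually_nhdsin_one: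
  "eventually P (nhdsin (topo G) \<one>) \<longleftrightarrow> (\<exists>U. open_unit_nbhd G U \<and> (\<forall>y\<in>U. P y))"
  using eventually_nhdsin_carrier[OF one_closed] by (auto simp: open_unit_nbhd_def)

lemma minimal_Cauchy_nhdsin:
  assumes x: "x \<in> carrier G"
  shows "minimal_Cauchy G (nhdsin (topo G) x)"
  unfolding minimal_Cauchy_def
proof
  show "Cauchy_filter_in G (nhdsin (topo G) x)"
  proof (rule Cauchy_filterI)
    show "nhdsin (topo G) x \<noteq> bot"
      using x by (auto simp: trivial_limit_def eventually_nhdsin_carrier)
    show "\<forall>\<^sub>F x in nhdsin (topo G) x. x \<in> carrier G"
      unfolding eventually_nhdsin_carrier[OF x] using x openin_carrier_self by blast
    fix U assume "open_unit_nbhd G U"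
    then have "openin (topo G) U" "x \<otimes> inv x \<in> U" using x by (auto simp: open_unit_nbhd_def)
    from div_nbhds[OF this(1) x x this(2)] obtain V W where VW: "openin (topo G) V" "openin (topo G) W"
      "x \<in> V" "x \<in> W" "\<forall>v\<in>V. \<forall>w\<in>W. v \<otimes> inv w \<in> U" by (elim exE conjE)
    then show "\<exists>A. (\<forall>\<^sub>F x in nhdsin (topo G) x. x \<in> A) \<and> (\<forall>a\<in>A. \<forall>b\<in>A. a \<otimes> inv b \<in> U)"
      unfolding eventually_nhdsin_carrier[OF x] by (intro exI[of _ "V \<inter> W"]) (auto intro!: exI[of _ "V \<inter> W"])
  qed
  show "round_filter G (nhdsin (topo G) x)"
    unfolding round_filter_def
  proof (intro allI impI)
    fix P assume "eventually P (nhdsin (topo G) x)"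
    then obtain S where S: "openin (topo G) S" "x \<in> S" "\<forall>y\<in>S. P y" unfolding eventually_nhdsin_carrier[OF x] by blast
    then have "x \<otimes> \<one> \<in> S" using x by simp
    from mult_nbhds[OF S(1) x one_closed this] obtain V W where VW: "openin (topo G) V" "openin (topo G) W"
      "x \<in> V" "\<one> \<in> W" "\<forall>v\<in>V. \<forall>w\<in>W. v \<otimes> w \<in> S" by (elim exE conjE)
    then show "\<exists>U. open_unit_nbhd G U \<and> (\<forall>\<^sub>F y in nhdsin (topo G) x. \<forall>u\<in>U. P (y \<otimes> u))"
      unfolding eventually_nhdsin_carrier[OF x] using S(3)
      by (intro exI[of _ W]) (auto simp: open_unit_nbhd_def intro!: exI[of _ V])
  qed
qed

text \<open>Roundness is inherited from the second factor. With the neighbourhood filter of the unit as second factor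
  this turns an arbitrary Cauchy filter into a minimal one.\<close>

lemma minimal_Cauchy_mult:
  assumes F: "Cauchy_filter_in G F" and F': "minimal_Cauchy G F'"
  shows "minimal_Cauchy G (filter_mult G F F')"
  unfolding minimal_Cauchy_def
proof
  have Fc: "F \<noteq> bot" "\<forall>\<^sub>F x in F. x \<in> carrier G"
    using F by (auto simp: Cauchy_filter_in_def le_principal)
  note F'c = minimal_CauchyD[OF F']
  show "Cauchy_filter_in G (filter_mult G F F')"
  proof (rule Cauchy_filterI)
    show "filter_mult G F F' \<noteq> bot"
      unfolding filter_mult_def using Fc F'c by (simp add: filtermap_bot_iff prod_filter_eq_bot)
    show "\<forall>\<^sub>F x in filter_mult G F F'. x \<in> carrier G"
      unfolding eventually_filter_mult using Fc F'c by blast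
    fix U assume "open_unit_nbhd G U"
    then obtain V where V: "open_unit_nbhd G V" "\<And>v w. v \<in> V \<Longrightarrow> w \<in> V \<Longrightarrow> v \<otimes> w \<in> U"
      using unit_nbhd_halve by metis
    obtain A where A: "\<forall>\<^sub>F x in F. x \<in> A" "A \<subseteq> carrier G" "\<forall>a\<in>A. \<forall>b\<in>A. a \<otimes> inv b \<in> V"
      using Cauchy_small_set[OF F V(1)] by (elim exE conjE)
    obtain B where B: "\<forall>\<^sub>F x in F'. x \<in> B" "B \<subseteq> carrier G" "\<forall>a\<in>B. \<forall>b\<in>B. a \<otimes> inv b \<in> V"
      using Cauchy_small_set[OF F'c(1) V(1)] by (elim exE conjE)
    have "(a \<otimes> b) \<otimes> inv (c \<otimes> d) \<in> U" if "a \<in> A" "b \<in> B" "c \<in> A" "d \<in> B" for a b c d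
    proof -
      have "(a \<otimes> b) \<otimes> inv (c \<otimes> d) = (a \<otimes> inv c) \<otimes> (b \<otimes> inv d)"
        using that A(2) B(2) by (intro mult_div_mult) auto
      then show ?thesis using V(2) A(3) B(3) that by simp
    qed
    then have "\<forall>x\<in>(\<lambda>(a, b). a \<otimes> b) ` (A \<times> B). \<forall>y\<in>(\<lambda>(a, b). a \<otimes> b) ` (A \<times> B). x \<otimes> inv y \<in> U" by auto
    moreover have "\<forall>\<^sub>F x in filter_mult G F F'. x \<in> (\<lambda>(a, b). a \<otimes> b) ` (A \<times> B)"
      unfolding eventually_filter_mult using A(1) B(1) by blast
    ultimately show "\<exists>A. (\<forall>\<^sub>F x in filter_mult G F F'. x \<in> A) \<and> (\<forall>a\<in>A. \<forall>b\<in>A. a \<otimes> inv b \<in> U)" by blast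
  qed
  show "round_filter G (filter_mult G F F')"
    unfolding round_filter_def
  proof (intro allI impI)
    fix P assume "eventually P (filter_mult G F F')"
    then obtain A B where AB: "eventually A F" "eventually B F'" "\<forall>a b. A a \<longrightarrow> B b \<longrightarrow> P (a \<otimes> b)"
      unfolding eventually_filter_mult by blast
    obtain U where U: "open_unit_nbhd G U" "\<forall>\<^sub>F x in F'. \<forall>u\<in>U. B (x \<otimes> u)"
      by (rule minimal_Cauchy_round[OF F' AB(2)])
    have "P ((a \<otimes> b) \<otimes> u)" if "A a \<and> a \<in> carrier G" "(\<forall>u\<in>U. B (b \<otimes> u)) \<and> b \<in> carrier G" "u \<in> U" for a b u
      using AB(3) that unit_nbhd_carrier[OF U(1) that(3)] by (simp add: m_assoc)
    then show "\<exists>U. open_unit_nbhd G U \<and> (\<forall>\<^sub>F x in filter_mult G F F'. \<forall>u\<in>U. P (x \<otimes> u))"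
      unfolding eventually_filter_mult using U(1) eventually_conj[OF AB(1) Fc(2)] eventually_conj[OF U(2) F'c(3)]
      by blast
  qed
qed

lemma filter_mult_nhdsin:
  assumes x: "x \<in> carrier G" and y: "y \<in> carrier G"
  shows "filter_mult G (nhdsin (topo G) x) (nhdsin (topo G) y) = nhdsin (topo G) (x \<otimes> y)"
proof (rule minimal_Cauchy_le_eq)
  note mc = minimal_Cauchy_nhdsin
  show "minimal_Cauchy G (filter_mult G (nhdsin (topo G) x) (nhdsin (topo G) y))"
    by (rule minimal_Cauchy_mult[OF minimal_CauchyD(1)[OF mc[OF x]] mc[OF y]])
  show "minimal_Cauchy G (nhdsin (topo G) (x \<otimes> y))" by (rule mc[OF m_closed[OF x y]])
  show "filter_mult G (nhdsin (topo G) x) (nhdsin (topo G) y) \<le> nhdsin (topo G) (x \<otimes> y)"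
  proof (rule filter_leI)
    fix P assume "eventually P (nhdsin (topo G) (x \<otimes> y))"
    then obtain S where S: "openin (topo G) S" "x \<otimes> y \<in> S" "\<forall>y\<in>S. P y"
      unfolding eventually_nhdsin_carrier[OF m_closed[OF x y]] by blast
    from mult_nbhds[OF S(1) x y S(2)] obtain V W where VW: "openin (topo G) V" "openin (topo G) W"
      "x \<in> V" "y \<in> W" "\<forall>v\<in>V. \<forall>w\<in>W. v \<otimes> w \<in> S" by (elim exE conjE)
    have "\<forall>\<^sub>F v in nhdsin (topo G) x. v \<in> V" "\<forall>\<^sub>F w in nhdsin (topo G) y. w \<in> W"
      unfolding eventually_nhdsin_carrier[OF x] eventually_nhdsin_carrier[OF y] using VW by blast+
    then show "eventually P (filter_mult G (nhdsin (topo G) x) (nhdsin (topo G) y))"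
      unfolding eventually_filter_mult using VW(5) S(3) by blast
  qed
qed

lemma le_filter_mult_one:
  assumes F: "\<forall>\<^sub>F x in F. x \<in> carrier G"
  shows "F \<le> filter_mult G F (nhdsin (topo G) \<one>)"
proof (rule filter_leI)
  fix P assume "eventually P (filter_mult G F (nhdsin (topo G) \<one>))"
  then obtain A U where A: "eventually A F" "open_unit_nbhd G U" "\<forall>a. \<forall>u\<in>U. A a \<longrightarrow> P (a \<otimes> u)"
    unfolding eventually_filter_mult eventually_nhdsin_one by blast
  have "P a" if "A a \<and> a \<in> carrier G" for a
  proof -
    have "P (a \<otimes> \<one>)" using A that by (simp only: open_unit_nbhd_def)
    then show ?thesis using that by simp
  qed
  then show "eventually P F" using eventually_mono[OF eventually_conj[OF A(1) F]] by blast
qed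

lemma filter_mult_one:
  assumes F: "minimal_Cauchy G F"
  shows "filter_mult G F (nhdsin (topo G) \<one>) = F"
  using minimal_Cauchy_le_eq[OF F minimal_Cauchy_mult[OF minimal_CauchyD(1)[OF F] minimal_Cauchy_nhdsin[OF one_closed]]
      le_filter_mult_one[OF minimal_CauchyD(3)[OF F]]] by simp

lemma filter_mult_comm:
  assumes "\<forall>\<^sub>F x in F. x \<in> carrier G" "\<forall>\<^sub>F x in F'. x \<in> carrier G"
  shows "filter_mult G F F' = filter_mult G F' F"
proof -
  have "filter_mult G F F' \<le> filter_mult G F' F"
    if c: "\<forall>\<^sub>F x in F. x \<in> carrier G" "\<forall>\<^sub>F x in F'. x \<in> carrier G" for F F'
  proof (rule filter_leI)
    fix P assume "eventually P (filter_mult G F' F)"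
    then obtain A B where AB: "eventually A F'" "eventually B F" "\<forall>a b. A a \<longrightarrow> B b \<longrightarrow> P (a \<otimes> b)"
      unfolding eventually_filter_mult by blast
    have "P (b \<otimes> a)" if "B b \<and> b \<in> carrier G" "A a \<and> a \<in> carrier G" for a b
      using that AB(3) by (simp add: m_comm[of b a])
    then show "eventually P (filter_mult G F F')"
      unfolding eventually_filter_mult using eventually_conj[OF AB(1) c(2)] eventually_conj[OF AB(2) c(1)] by blast
  qed
  then show ?thesis using assms by (simp add: antisym)
qed

lemma filter_mult_assoc_le:
  assumes "\<forall>\<^sub>F x in F. x \<in> carrier G" "\<forall>\<^sub>F x in F'. x \<in> carrier G" "\<forall>\<^sub>F x in F''. x \<in> carrier G"
  shows "filter_mult G (filter_mult G F F') F'' \<le> filter_mult G F (filter_mult G F' F'')"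
proof (rule filter_leI)
  fix P assume "eventually P (filter_mult G F (filter_mult G F' F''))"
  then obtain A B where A: "eventually A F" "eventually B (filter_mult G F' F'')" "\<forall>a b. A a \<longrightarrow> B b \<longrightarrow> P (a \<otimes> b)"
    unfolding eventually_filter_mult[of P] by blast
  then obtain C D where C: "eventually C F'" "eventually D F''" "\<forall>c d. C c \<longrightarrow> D d \<longrightarrow> B (c \<otimes> d)"
    unfolding eventually_filter_mult by blast
  let ?A = "\<lambda>a. A a \<and> a \<in> carrier G" and ?C = "\<lambda>a. C a \<and> a \<in> carrier G" and ?D = "\<lambda>a. D a \<and> a \<in> carrier G"
  let ?M = "\<lambda>z. \<exists>a c. ?A a \<and> ?C c \<and> z = a \<otimes> c"
  have "eventually ?M (filter_mult G F F')"
    unfolding eventually_filter_mult using eventually_conj[OF A(1) assms(1)] eventually_conj[OF C(1) assms(2)]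
    by (intro exI[of _ ?A] exI[of _ ?C]) blast
  moreover have "P (z \<otimes> d)" if M: "?M z" and d: "?D d" for z d
  proof -
    obtain a c where ac: "?A a" "?C c" "z = a \<otimes> c" using M by (elim exE conjE) simp
    have "P (a \<otimes> (c \<otimes> d))" using ac d A(3) C(3) by simp
    then show ?thesis using ac d by (simp add: m_assoc)
  qed
  ultimately show "eventually P (filter_mult G (filter_mult G F F') F'')"
    unfolding eventually_filter_mult[of P] using eventually_conj[OF C(2) assms(3)]
    by (intro exI[of _ ?M] exI[of _ ?D]) blast
qed

lemma minimal_Cauchy_inv:
  assumes F: "minimal_Cauchy G F"
  shows "minimal_Cauchy G (filtermap (\<lambda>x. inv x) F)"
  unfolding minimal_Cauchy_def
proof
  note Fc = minimal_CauchyD[OF F]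
  show "Cauchy_filter_in G (filtermap (\<lambda>x. inv x) F)"
  proof (rule Cauchy_filterI)
    show "filtermap (\<lambda>x. inv x) F \<noteq> bot" using Fc by (simp add: filtermap_bot_iff)
    show "\<forall>\<^sub>F x in filtermap (\<lambda>x. inv x) F. x \<in> carrier G"
      unfolding eventually_filtermap using Fc(3) by (auto elim: eventually_mono)
    fix U assume U: "open_unit_nbhd G U"
    obtain A where A: "\<forall>\<^sub>F x in F. x \<in> A" "A \<subseteq> carrier G" "\<forall>a\<in>A. \<forall>b\<in>A. a \<otimes> inv b \<in> U"
      using Cauchy_small_set[OF Fc(1) U] by (elim exE conjE)
    have "inv a \<otimes> inv (inv b) \<in> U" if "a \<in> A" "b \<in> A" for a b
    proof -
      have "a \<in> carrier G" "b \<in> carrier G" using A(2) that by blast+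
      then have "inv a \<otimes> inv (inv b) = b \<otimes> inv a" by (simp add: m_comm)
      then show ?thesis using A(3)[rule_format, OF that(2,1)] by simp
    qed
    then show "\<exists>A. (\<forall>\<^sub>F x in filtermap (\<lambda>x. inv x) F. x \<in> A) \<and> (\<forall>a\<in>A. \<forall>b\<in>A. a \<otimes> inv b \<in> U)"
      unfolding eventually_filtermap
      by (intro exI[of _ "(\<lambda>x. inv x) ` A"] conjI eventually_mono[OF A(1)]) auto
  qed
  show "round_filter G (filtermap (\<lambda>x. inv x) F)"
    unfolding round_filter_def eventually_filtermap
  proof (intro allI impI)
    fix P assume "\<forall>\<^sub>F x in F. P (inv x)"
    then obtain U where U: "open_unit_nbhd G U" "\<forall>\<^sub>F x in F. \<forall>u\<in>U. P (inv (x \<otimes> u))"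
      by (rule minimal_Cauchy_round[OF F])
    obtain V where V: "open_unit_nbhd G V" "V \<subseteq> U" "\<And>v. v \<in> V \<Longrightarrow> inv v \<in> V"
      using unit_nbhd_halve[OF U(1)] by metis
    have "\<forall>u\<in>V. P (inv x \<otimes> u)" if x: "(\<forall>u\<in>U. P (inv (x \<otimes> u))) \<and> x \<in> carrier G" for x
    proof
      fix u assume u: "u \<in> V"
      then have uc: "u \<in> carrier G" using unit_nbhd_carrier[OF V(1)] by simp
      have "P (inv (x \<otimes> inv u))" using x V(2,3) u by blast
      then show "P (inv x \<otimes> u)" using uc x by (simp add: inv_mult)
    qed
    from eventually_mono[OF eventually_conj[OF U(2) Fc(3)] this]
    show "\<exists>U. open_unit_nbhd G U \<and> (\<forall>\<^sub>F x in F. \<forall>u\<in>U. P (inv x \<otimes> u))"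
      using V(1) by (intro exI[of _ V] conjI)
  qed
qed

lemma filter_mult_inv:
  assumes F: "minimal_Cauchy G F"
  shows "filter_mult G (filtermap (\<lambda>x. inv x) F) F = nhdsin (topo G) \<one>"
proof (rule minimal_Cauchy_le_eq)
  show "minimal_Cauchy G (filter_mult G (filtermap (\<lambda>x. inv x) F) F)"
    by (rule minimal_Cauchy_mult[OF minimal_CauchyD(1)[OF minimal_Cauchy_inv[OF F]] F])
  show "minimal_Cauchy G (nhdsin (topo G) \<one>)" by (rule minimal_Cauchy_nhdsin[OF one_closed])
  show "filter_mult G (filtermap (\<lambda>x. inv x) F) F \<le> nhdsin (topo G) \<one>"
  proof (rule filter_leI)
    fix P assume "eventually P (nhdsin (topo G) \<one>)"
    then obtain U where U: "open_unit_nbhd G U" "\<forall>y\<in>U. P y" unfolding eventually_nhdsin_one by blast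
    obtain A where A: "\<forall>\<^sub>F x in F. x \<in> A" "A \<subseteq> carrier G" "\<forall>a\<in>A. \<forall>b\<in>A. a \<otimes> inv b \<in> U"
      using Cauchy_small_set[OF minimal_CauchyD(1)[OF F] U(1)] by (elim exE conjE)
    have "P (inv a \<otimes> b)" if ab: "a \<in> A" "b \<in> A" for a b
    proof -
      have "inv a \<otimes> b = b \<otimes> inv a" using ab A(2) by (intro m_comm) auto
      then show ?thesis using U(2) A(3)[rule_format, OF ab(2,1)] by simp
    qed
    moreover have "\<forall>\<^sub>F x in filtermap (\<lambda>x. inv x) F. \<exists>a\<in>A. x = inv a"
      unfolding eventually_filtermap by (rule eventually_mono[OF A(1)]) auto
    ultimately show "eventually P (filter_mult G (filtermap (\<lambda>x. inv x) F) F)"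
      unfolding eventually_filter_mult using A(1)
      by (intro exI[of _ "\<lambda>x. \<exists>a\<in>A. x = inv a"] exI[of _ "\<lambda>x. x \<in> A"]) auto
  qed
qed

lemma comm_group_Raikov: "comm_group (Raikov_completion G)"
proof (rule comm_groupI; simp only: Raikov_completion_simps mem_Collect_eq)
  note c = minimal_CauchyD(3)
  fix F F' assume F: "minimal_Cauchy G F" and F': "minimal_Cauchy G F'"
  show m: "minimal_Cauchy G (filter_mult G F F')" by (rule minimal_Cauchy_mult[OF minimal_CauchyD(1)[OF F] F'])
  show "filter_mult G F F' = filter_mult G F' F" by (rule filter_mult_comm[OF c[OF F] c[OF F']])
  fix F'' assume F'': "minimal_Cauchy G F''"
  show "filter_mult G (filter_mult G F F') F'' = filter_mult G F (filter_mult G F' F'')"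
  proof (rule minimal_Cauchy_le_eq[OF _ _ filter_mult_assoc_le[OF c[OF F] c[OF F'] c[OF F'']]])
    show "minimal_Cauchy G (filter_mult G (filter_mult G F F') F'')"
      by (rule minimal_Cauchy_mult[OF minimal_CauchyD(1)[OF m] F''])
    show "minimal_Cauchy G (filter_mult G F (filter_mult G F' F''))"
      by (intro minimal_Cauchy_mult minimal_CauchyD(1)[OF F] minimal_CauchyD(1)[OF F'] F'')
  qed
next
  fix F assume F: "minimal_Cauchy G F"
  note one = minimal_Cauchy_nhdsin[OF one_closed]
  show "filter_mult G (nhdsin (topo G) \<one>) F = F"
    using filter_mult_one[OF F] filter_mult_comm[OF minimal_CauchyD(3)[OF F] minimal_CauchyD(3)[OF one]] by simp
  show "\<exists>y\<in>{F. minimal_Cauchy G F}. filter_mult G y F = nhdsin (topo G) \<one>"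
    using minimal_Cauchy_inv[OF F] filter_mult_inv[OF F] by blast
qed (rule minimal_Cauchy_nhdsin[OF one_closed])

lemma inv_Raikov:
  assumes F: "minimal_Cauchy G F"
  shows "inv\<^bsub>Raikov_completion G\<^esub> F = filtermap (\<lambda>x. inv x) F"
proof -
  interpret R: comm_group "Raikov_completion G" by (rule comm_group_Raikov)
  show ?thesis using F minimal_Cauchy_inv[OF F] filter_mult_inv[OF F] by (intro R.inv_equality) simp_all
qed

lemma openin_Raikov_basic:
  assumes "openin (topo G) A"
  shows "openin (topo (Raikov_completion G)) {F. minimal_Cauchy G F \<and> (\<forall>\<^sub>F x in F. x \<in> A)}"
  unfolding openin_Raikov using assms by blast

lemma topspace_Raikov: "topspace (topo (Raikov_completion G)) = {F. minimal_Cauchy G F}"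
proof -
  have "openin (topo (Raikov_completion G)) {F. minimal_Cauchy G F}"
    using openin_Raikov_basic[OF openin_carrier_self] minimal_CauchyD(3) by (simp add: conj_absorb cong: conj_cong)
  then have "{F. minimal_Cauchy G F} \<subseteq> topspace (topo (Raikov_completion G))" by (rule openin_subset)
  moreover have "topspace (topo (Raikov_completion G)) \<subseteq> {F. minimal_Cauchy G F}"
    using openin_topspace[of "topo (Raikov_completion G)"] unfolding openin_Raikov by (rule conjunct1)
  ultimately show ?thesis by (rule antisym[rotated])
qed

lemma top_ab_group_Raikov: "top_ab_group (Raikov_completion G)"
proof (rule top_ab_groupI[OF comm_group_Raikov])
  show "topspace (topo (Raikov_completion G)) = carrier (Raikov_completion G)" by (simp add: topspace_Raikov)
next
  fix \<U> F F' assume U: "openin (topo (Raikov_completion G)) \<U>" and "F \<in> carrier (Raikov_completion G)"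
    "F' \<in> carrier (Raikov_completion G)" and FU: "F \<otimes>\<^bsub>Raikov_completion G\<^esub> F' \<in> \<U>"
  then have F: "minimal_Cauchy G F" and F': "minimal_Cauchy G F'" by simp_all
  obtain A where A: "openin (topo G) A" "\<forall>\<^sub>F x in filter_mult G F F'. x \<in> A"
    "\<forall>F'. minimal_Cauchy G F' \<longrightarrow> (\<forall>\<^sub>F x in F'. x \<in> A) \<longrightarrow> F' \<in> \<U>"
    using U[unfolded openin_Raikov, THEN conjunct2, rule_format, OF FU] by (simp only: Raikov_completion_simps) (elim exE conjE)
  obtain P Q where PQ: "eventually P F" "eventually Q F'" "\<forall>a b. P a \<longrightarrow> Q b \<longrightarrow> a \<otimes> b \<in> A"
    using A(2) unfolding eventually_filter_mult by blast
  obtain V where V: "openin (topo G) V" "\<forall>\<^sub>F x in F. x \<in> V" "\<forall>a\<in>V. P a"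
    using minimal_Cauchy_open[OF F PQ(1)] by (elim exE conjE)
  obtain W where W: "openin (topo G) W" "\<forall>\<^sub>F x in F'. x \<in> W" "\<forall>a\<in>W. Q a"
    using minimal_Cauchy_open[OF F' PQ(2)] by (elim exE conjE)
  let ?V = "{F. minimal_Cauchy G F \<and> (\<forall>\<^sub>F x in F. x \<in> V)}" and ?W = "{F. minimal_Cauchy G F \<and> (\<forall>\<^sub>F x in F. x \<in> W)}"
  have "v \<otimes>\<^bsub>Raikov_completion G\<^esub> w \<in> \<U>" if vw: "v \<in> ?V" "w \<in> ?W" for v w
  proof -
    have "minimal_Cauchy G (filter_mult G v w)" 
      using vw by (intro minimal_Cauchy_mult minimal_CauchyD(1)) simp_all
    moreover have "\<forall>\<^sub>F x in filter_mult G v w. x \<in> A"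
      unfolding eventually_filter_mult using vw PQ(3) V(3) W(3)
      by - (rule exI[of _ "\<lambda>x. x \<in> V"], rule exI[of _ "\<lambda>x. x \<in> W"], simp)
    ultimately show ?thesis using A(3) by simp
  qed
  then show "\<exists>V W. openin (topo (Raikov_completion G)) V \<and> openin (topo (Raikov_completion G)) W \<and> F \<in> V \<and> F' \<in> W \<and>
      (\<forall>v\<in>V. \<forall>w\<in>W. v \<otimes>\<^bsub>Raikov_completion G\<^esub> w \<in> \<U>)"
    using openin_Raikov_basic[OF V(1)] openin_Raikov_basic[OF W(1)] F F' V(2) W(2)
    by - (rule exI[of _ ?V], rule exI[of _ ?W], blast)
next
  fix \<U> F assume U: "openin (topo (Raikov_completion G)) \<U>" and "F \<in> carrier (Raikov_completion G)"
    and FU: "inv\<^bsub>Raikov_completion G\<^esub> F \<in> \<U>"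
  then have F: "minimal_Cauchy G F" by simp
  have FU': "filtermap (\<lambda>x. inv x) F \<in> \<U>" using FU by (simp only: inv_Raikov[OF F])
  obtain A where A: "openin (topo G) A" "\<forall>\<^sub>F x in filtermap (\<lambda>x. inv x) F. x \<in> A"
    "\<forall>F'. minimal_Cauchy G F' \<longrightarrow> (\<forall>\<^sub>F x in F'. x \<in> A) \<longrightarrow> F' \<in> \<U>"
    using U[unfolded openin_Raikov, THEN conjunct2, rule_format, OF FU'] by (elim exE conjE)
  let ?B = "{x \<in> carrier G. inv x \<in> A}"
  let ?V = "{F. minimal_Cauchy G F \<and> (\<forall>\<^sub>F x in F. x \<in> ?B)}"
  have "inv\<^bsub>Raikov_completion G\<^esub> v \<in> \<U>" if v: "v \<in> ?V" for v
  proof -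
    have "\<forall>\<^sub>F x in filtermap (\<lambda>x. inv x) v. x \<in> A" unfolding eventually_filtermap using v by (auto elim: eventually_mono)
    then show ?thesis using A(3) v minimal_Cauchy_inv[of v] inv_Raikov[of v] by simp
  qed
  moreover have "F \<in> ?V" using F A(2) minimal_CauchyD(3)[OF F] by (simp add: eventually_conj_iff eventually_filtermap)
  ultimately show "\<exists>V. openin (topo (Raikov_completion G)) V \<and> F \<in> V \<and> (\<forall>v\<in>V. inv\<^bsub>Raikov_completion G\<^esub> v \<in> \<U>)"
    using openin_Raikov_basic[OF openin_inv_preimage[OF A(1)]] by blast
next
  fix F F' assume "F \<in> carrier (Raikov_completion G)" "F' \<in> carrier (Raikov_completion G)" and ne: "F \<noteq> F'"
  then have F: "minimal_Cauchy G F" and F': "minimal_Cauchy G F'" by simp_all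
  obtain P Q where PQ: "eventually P F" "eventually Q F'" "\<not> (\<exists>x. P x \<and> Q x)"
    using minimal_Cauchy_eqI[OF F F'] ne by blast
  obtain V where V: "openin (topo G) V" "\<forall>\<^sub>F x in F. x \<in> V" "\<forall>a\<in>V. P a"
    using minimal_Cauchy_open[OF F PQ(1)] by (elim exE conjE)
  obtain W where W: "openin (topo G) W" "\<forall>\<^sub>F x in F'. x \<in> W" "\<forall>a\<in>W. Q a"
    using minimal_Cauchy_open[OF F' PQ(2)] by (elim exE conjE)
  let ?V = "{F. minimal_Cauchy G F \<and> (\<forall>\<^sub>F x in F. x \<in> V)}" and ?W = "{F. minimal_Cauchy G F \<and> (\<forall>\<^sub>F x in F. x \<in> W)}"
  have "?V \<inter> ?W = {}"
  proof (rule ccontr)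
    assume "?V \<inter> ?W \<noteq> {}"
    then obtain K where K: "minimal_Cauchy G K" "\<forall>\<^sub>F x in K. x \<in> V" "\<forall>\<^sub>F x in K. x \<in> W" by blast
    then show False
      using eventually_happens'[OF minimal_CauchyD(2)[OF K(1)] eventually_conj[OF K(2,3)]] PQ(3) V(3) W(3) by blast
  qed
  then show "\<exists>V W. openin (topo (Raikov_completion G)) V \<and> openin (topo (Raikov_completion G)) W \<and> F \<in> V \<and> F' \<in> W \<and> V \<inter> W = {}"
    using openin_Raikov_basic[OF V(1)] openin_Raikov_basic[OF W(1)] F F' V(2) W(2)
    by - (rule exI[of _ ?V], rule exI[of _ ?W], blast)
qed

end

section \<open>Ultrafilters\<close>

text \<open>The ultrafilter lemma, by Zorn's lemma: a minimal proper filter below \<open>F\<close> decides every predicate.\<close>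

lemma ultrafilter_below:
  assumes F: "F \<noteq> bot"
  shows "\<exists>M. M \<noteq> bot \<and> M \<le> F \<and> (\<forall>P. eventually P M \<or> (\<forall>\<^sub>F x in M. \<not> P x))"
proof -
  let ?A = "{M. M \<noteq> bot \<and> M \<le> F}"
  let ?R = "relation_of (\<lambda>M N. N \<le> M) ?A"
  have "\<exists>m\<in>?A. \<forall>a\<in>?A. a \<le> m \<longrightarrow> a = m"
  proof (rule predicate_Zorn)
    show "partial_order_on ?A ?R"
      by (rule partial_order_on_relation_ofI) auto
    fix C assume C: "C \<in> Chains ?R"
    then have CA: "C \<subseteq> ?A" and lin: "\<And>M N. M \<in> C \<Longrightarrow> N \<in> C \<Longrightarrow> M \<le> N \<or> N \<le> M"
      by (auto simp: Chains_def relation_of_def)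
    show "\<exists>u\<in>?A. \<forall>a\<in>C. u \<le> a"
    proof (cases "C = {}")
      case True
      then show ?thesis using F by auto
    next
      case False
      have "\<exists>x\<in>C. x \<le> inf M N" if "M \<in> C" "N \<in> C" for M N
        using lin[OF that] that by (auto simp: le_inf_iff)
      then have "eventually P (Inf C) \<longleftrightarrow> (\<exists>M\<in>C. eventually P M)" for P
        by (intro eventually_Inf_base False)
      then have "Inf C \<noteq> bot" using CA by (auto simp: trivial_limit_def)
      moreover have "Inf C \<le> F" using False CA by (auto intro: Inf_lower2)
      ultimately show ?thesis by (auto intro: Inf_lower)
    qed
  qed
  then obtain M where M: "M \<noteq> bot" "M \<le> F" "\<And>N. N \<noteq> bot \<Longrightarrow> N \<le> M \<Longrightarrow> N = M"
    by (auto dest: order_trans)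
  have "eventually P M \<or> (\<forall>\<^sub>F x in M. \<not> P x)" for P
  proof (rule disjCI)
    assume "\<not> (\<forall>\<^sub>F x in M. \<not> P x)"
    then have "inf M (principal {x. P x}) \<noteq> bot"
      by (simp add: trivial_limit_def eventually_inf_principal)
    then have "inf M (principal {x. P x}) = M" by (intro M(3)) auto
    then have "M \<le> principal {x. P x}" by (simp add: inf.orderI)
    then show "eventually P M" by (simp add: le_principal)
  qed
  then show ?thesis using M(1,2) by blast
qed

lemma ultrafilter_finite_cover:
  assumes "M \<noteq> bot" and ultra: "\<And>P. eventually P M \<or> (\<forall>\<^sub>F x in M. \<not> P x)"
    and "finite S" and ev: "\<forall>\<^sub>F x in M. \<exists>s\<in>S. P s x"
  shows "\<exists>s\<in>S. eventually (P s) M"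
proof (rule ccontr)
  assume "\<not> (\<exists>s\<in>S. eventually (P s) M)"
  then have "\<forall>s\<in>S. \<forall>\<^sub>F x in M. \<not> P s x" using ultra by blast
  then have "\<forall>\<^sub>F x in M. \<forall>s\<in>S. \<not> P s x" using \<open>finite S\<close> by (simp add: eventually_ball_finite)
  then have "\<forall>\<^sub>F x in M. False" using ev by eventually_elim blast
  then show False using assms(1) by simp
qed

section \<open>Lifting Cauchy filters\<close>

text \<open>Almost metrizability enters the proof in this form. If \<open>k\<close> is a point of the compact set
  \<open>K\<close> and \<open>V n\<close> runs through open sets inside a countable base of neighbourhoods of \<open>K\<close>, translate \<open>V n\<close>
  by the inverse of \<open>k\<close>. Finitely many translates of \<open>U\<close> cover \<open>K\<close>; their union is a neighbourhood of
  \<open>K\<close> and therefore contains some \<open>V n\<close>.\<close>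

lemma (in top_ab_group) almost_metrizable_total_bound:
  assumes "almost_metrizable G"
  shows "\<exists>N :: nat \<Rightarrow> 'a set. (\<forall>n. open_unit_nbhd G (N n)) \<and>
    (\<forall>U. open_unit_nbhd G U \<longrightarrow>
      (\<exists>n S. finite S \<and> S \<subseteq> carrier G \<and> (\<forall>x\<in>N n. \<exists>s\<in>S. \<exists>u\<in>U. x = s \<otimes> u)))"
proof -
  obtain K B where K: "K \<noteq> {}" "compactin (topo G) K" and B: "countable B"
    "\<forall>N\<in>B. neighbourhood_of (topo G) K N"
    "\<forall>M. neighbourhood_of (topo G) K M \<longrightarrow> (\<exists>N\<in>B. N \<subseteq> M)"
    using assms unfolding almost_metrizable_def by blast
  obtain k where k: "k \<in> K" using K(1) by blast
  have Kc: "K \<subseteq> carrier G" using compactin_subset_topspace[OF K(2)] by (simp add: topspace_eq)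
  then have kc: "k \<in> carrier G" using k by blast
  have "neighbourhood_of (topo G) K (carrier G)"
    unfolding neighbourhood_of_def using Kc openin_carrier_self topspace_eq by auto
  then have "B \<noteq> {}" using B(3) by blast
  then have rng: "range (from_nat_into B) = B" using B(1) by (simp add: range_from_nat_into)
  have "\<exists>V. openin (topo G) V \<and> K \<subseteq> V \<and> V \<subseteq> from_nat_into B n" for n
    using B(2) rng unfolding neighbourhood_of_def by blast
  then obtain V where V: "\<And>n. openin (topo G) (V n)" "\<And>n. K \<subseteq> V n" "\<And>n. V n \<subseteq> from_nat_into B n" by metis
  define N where "N n = {u \<in> carrier G. k \<otimes> u \<in> V n}" for n
  have "open_unit_nbhd G (N n)" for n
    unfolding N_def using V(1,2) k by (intro unit_nbhd_of_point) auto
  moreover have "\<exists>n S. finite S \<and> S \<subseteq> carrier G \<and> (\<forall>x\<in>N n. \<exists>s\<in>S. \<exists>u\<in>U. x = s \<otimes> u)"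
    if U: "open_unit_nbhd G U" for U
  proof -
    let ?t = "\<lambda>x. (\<lambda>u. x \<otimes> u) ` U"
    have opn: "openin (topo G) (?t x)" if "x \<in> K" for x
      using U Kc that by (intro openin_translate) (auto simp: open_unit_nbhd_def)
    have "x \<in> ?t x" if "x \<in> K" for x
      using U Kc that by (intro image_eqI[of _ _ \<one>]) (auto simp: open_unit_nbhd_def)
    then have "K \<subseteq> \<Union> (?t ` K)" by blast
    with compactinD[OF K(2), of "?t ` K"] opn
    obtain \<F> where F: "finite \<F>" "\<F> \<subseteq> ?t ` K" "K \<subseteq> \<Union>\<F>" by blast
    obtain S where S: "S \<subseteq> K" "finite S" "\<F> = ?t ` S" using finite_subset_image[OF F(1,2)] by blast
    have "openin (topo G) (\<Union>\<F>)" using opn S by blast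
    then have "neighbourhood_of (topo G) K (\<Union>\<F>)"
      unfolding neighbourhood_of_def using F(3) openin_subset by blast
    then obtain M where "M \<in> B" "M \<subseteq> \<Union>\<F>" using B(3) by blast
    then obtain n where n: "from_nat_into B n \<subseteq> \<Union>\<F>" using rng by (metis imageE)
    let ?S = "(\<lambda>s. inv k \<otimes> s) ` S"
    have "\<exists>s\<in>?S. \<exists>u\<in>U. x = s \<otimes> u" if x: "x \<in> N n" for x
    proof -
      have xc: "x \<in> carrier G" and "k \<otimes> x \<in> \<Union>\<F>" using x V(3)[of n] n by (auto simp: N_def)
      then obtain s u where su: "s \<in> S" "u \<in> U" "k \<otimes> x = s \<otimes> u" using S(3) by blast
      have c: "s \<in> carrier G" "u \<in> carrier G" using su S(1) Kc unit_nbhd_carrier[OF U] by blast+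
      have "x = inv k \<otimes> (k \<otimes> x)" using kc xc by (simp add: cancel_left)
      also have "\<dots> = (inv k \<otimes> s) \<otimes> u" using c kc by (simp add: su(3) m_assoc)
      finally show ?thesis using su by (intro bexI[of _ "inv k \<otimes> s"] bexI[of _ u]) simp_all
    qed
    moreover have "?S \<subseteq> carrier G" using S(1) Kc kc by auto
    ultimately show ?thesis using S(2) by (intro exI[of _ n] exI[of _ ?S]) simp
  qed
  ultimately show ?thesis by blast
qed

text \<open>The situation in which an extension has to be extended: \<open>Y\<close> is an extension of the dense subgroup
  \<open>D\<close> of \<open>G\<close>. Points of \<open>D\<close> are treated as points of \<open>G\<close> throughout, which the next lemmas arrange.\<close>

locale dense_extension = top_extension "tg_sub G D" H Y
  for G :: "'g top_group" and D :: "'g set" and H :: "'h top_group" and Y :: "('h, 'y, 'g) extn" +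
  assumes top_G: "top_ab_group G" and D: "subgroup D G" and dense: "topo G closure_of D = carrier G"

sublocale dense_extension \<subseteq> GG: top_ab_group G by (rule top_G)

sublocale dense_extension \<subseteq> DD: subgroup D G by (rule D)

context dense_extension
begin

lemma prj_D: "y \<in> carrier (mid Y) \<Longrightarrow> prj Y y \<in> D"
  using p.hom_closed by simp

lemma prj_carrier: "y \<in> carrier (mid Y) \<Longrightarrow> prj Y y \<in> carrier G"
  using prj_D by simp

lemma prj_mult: "x \<in> carrier (mid Y) \<Longrightarrow> y \<in> carrier (mid Y) \<Longrightarrow>
    prj Y (x \<otimes>\<^bsub>mid Y\<^esub> y) = prj Y x \<otimes>\<^bsub>G\<^esub> prj Y y"
  using p.hom_mult by simp

lemma prj_one: "prj Y \<one>\<^bsub>mid Y\<^esub> = \<one>\<^bsub>G\<^esub>"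
  using p.hom_one by simp

lemma prj_inv: "y \<in> carrier (mid Y) \<Longrightarrow> prj Y (inv\<^bsub>mid Y\<^esub> y) = inv\<^bsub>G\<^esub> (prj Y y)"
  using p.hom_inv inv_tg_sub[OF top_G D prj_D] by simp

lemma prj_lift: "d \<in> D \<Longrightarrow> \<exists>y\<in>carrier (mid Y). prj Y y = d"
  using prj_surj by simp

lemma prj_tg_hom_G: "prj Y \<in> tg_hom (mid Y) G"
proof -
  have "(\<lambda>x. x) \<in> tg_hom (tg_sub G D) G" by (rule tg_hom_from_sub[OF tg_hom_ident DD.subset])
  from tg_hom_compose[OF prj_tg_hom this] show ?thesis .
qed

lemma dense_meets:
  assumes "openin (topo G) U" "x \<in> U"
  shows "\<exists>d\<in>D. d \<in> U"
proof -
  have "x \<in> topo G closure_of D" using GG.openin_carrier[OF assms(1)] assms(2) dense by blast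
  then show ?thesis using assms unfolding in_closure_of by blast
qed

lemma prj_unit_nbhd:
  assumes "open_unit_nbhd (mid Y) U"
  shows "\<exists>W. open_unit_nbhd G W \<and> (\<forall>d\<in>W \<inter> D. \<exists>u\<in>U. prj Y u = d)"
proof -
  obtain W where W: "open_unit_nbhd G W" "prj Y ` U = W \<inter> D"
    using unit_nbhd_prj[OF assms] by (rule unit_nbhd_subE)
  have "\<forall>d\<in>W \<inter> D. \<exists>u\<in>U. prj Y u = d" unfolding W(2)[symmetric] by blast
  then show ?thesis using W(1) by blast
qed

lemma open_nbhd_difference:
  assumes W: "open_unit_nbhd G W" and g: "g \<in> carrier G"
  shows "\<exists>R. openin (topo G) R \<and> g \<in> R \<and> (\<forall>a\<in>R. \<forall>b\<in>R. a \<otimes>\<^bsub>G\<^esub> inv\<^bsub>G\<^esub> b \<in> W)"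
proof -
  have "openin (topo G) W" "g \<otimes>\<^bsub>G\<^esub> inv\<^bsub>G\<^esub> g \<in> W" using W g by (auto simp: open_unit_nbhd_def)
  from GG.div_nbhds[OF this(1) g g this(2)] obtain A B where "openin (topo G) A" "openin (topo G) B"
    "g \<in> A" "g \<in> B" "\<forall>v\<in>A. \<forall>w\<in>B. v \<otimes>\<^bsub>G\<^esub> inv\<^bsub>G\<^esub> w \<in> W" by (elim exE conjE)
  then show ?thesis by (intro exI[of _ "A \<inter> B"]) auto
qed

text \<open>Choose unit neighbourhoods \<open>V n\<close> of the middle group that shrink under squaring and whose traces on
  \<open>H\<close> lie in the sets \<open>N n\<close> of \<open>almost_metrizable_total_bound\<close>, then neighbourhoods \<open>R n\<close> of \<open>g\<close> whose
  differences lift to \<open>V n\<close>, and points \<open>y n\<close> over \<open>R n\<close> with consecutive steps in \<open>V n\<close>. The sets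
  \<open>B n = (y n) (V n) (V n)\<close> decrease and meet the preimage of every neighbourhood of \<open>g\<close>, so there is an
  ultrafilter \<open>F\<close> containing all of them. It is Cauchy: if \<open>a\<close> and \<open>b\<close> lie in a late \<open>B m\<close> and over
  nearby points of \<open>G\<close>, the difference of \<open>a\<close> and \<open>b\<close> is a small element times an \<open>h\<close> in \<open>N n\<close>, and \<open>N n\<close> is
  covered by finitely many small translates; since \<open>F\<close> is an ultrafilter, one of the resulting
  finitely many small sets belongs to \<open>F\<close>.\<close>

lemma Cauchy_filter_lift:
  assumes am: "almost_metrizable H" and g: "g \<in> carrier G"
  shows "\<exists>F. Cauchy_filter_in (mid Y) F \<and> limitin (topo G) (prj Y) g F"
proof -
  let ?X = "mid Y"
  obtain N :: "nat \<Rightarrow> 'h set" where N: "\<forall>n. open_unit_nbhd H (N n)"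
    "\<forall>U. open_unit_nbhd H U \<longrightarrow>
      (\<exists>n S. finite S \<and> S \<subseteq> carrier H \<and> (\<forall>x\<in>N n. \<exists>s\<in>S. \<exists>u\<in>U. x = s \<otimes>\<^bsub>H\<^esub> u))"
    using H.almost_metrizable_total_bound[OF am] by (elim exE conjE)
  have "\<forall>n. \<exists>M. open_unit_nbhd ?X M \<and> (\<forall>h\<in>carrier H. inc Y h \<in> M \<longrightarrow> h \<in> N n)"
    using unit_nbhd_inc N(1) by blast
  then obtain M where M: "\<And>n. open_unit_nbhd ?X (M n)"
    "\<And>n h. h \<in> carrier H \<Longrightarrow> inc Y h \<in> M n \<Longrightarrow> h \<in> N n" by metis
  \<comment> \<open>The squaring condition is placed between consecutive terms, so a product of \<open>2 ^ j\<close> elements of \<open>V (n + j)\<close> stays in \<open>V n\<close>.\<close>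
  have "\<exists>V. \<forall>n. (open_unit_nbhd ?X (V n) \<and> (\<forall>v\<in>V n. inv\<^bsub>?X\<^esub> v \<in> V n) \<and> V n \<subseteq> M n) \<and>
      (\<forall>v\<in>V (Suc n). \<forall>w\<in>V (Suc n). v \<otimes>\<^bsub>?X\<^esub> w \<in> V n)"
  proof (rule dependent_nat_choice)
    show "\<exists>V. open_unit_nbhd ?X V \<and> (\<forall>v\<in>V. inv\<^bsub>?X\<^esub> v \<in> V) \<and> V \<subseteq> M 0"
      using X.unit_nbhd_halve[OF M(1)[of 0]] by metis
    fix V n assume "open_unit_nbhd ?X V \<and> (\<forall>v\<in>V. inv\<^bsub>?X\<^esub> v \<in> V) \<and> V \<subseteq> M n"
    then have "open_unit_nbhd ?X (V \<inter> M (Suc n))" using M(1) X.unit_nbhd_Int by blast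
    from X.unit_nbhd_halve[OF this] obtain W where "open_unit_nbhd ?X W" "W \<subseteq> V \<inter> M (Suc n)"
      "\<And>v. v \<in> W \<Longrightarrow> inv\<^bsub>?X\<^esub> v \<in> W" "\<And>v w. v \<in> W \<Longrightarrow> w \<in> W \<Longrightarrow> v \<otimes>\<^bsub>?X\<^esub> w \<in> V \<inter> M (Suc n)"
      by metis
    then show "\<exists>W. (open_unit_nbhd ?X W \<and> (\<forall>v\<in>W. inv\<^bsub>?X\<^esub> v \<in> W) \<and> W \<subseteq> M (Suc n)) \<and>
      (\<forall>v\<in>W. \<forall>w\<in>W. v \<otimes>\<^bsub>?X\<^esub> w \<in> V)" by (intro exI[of _ W]) auto
  qed
  then obtain V where V: "\<And>n. open_unit_nbhd ?X (V n)" "\<And>n v. v \<in> V n \<Longrightarrow> inv\<^bsub>?X\<^esub> v \<in> V n"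
    "\<And>n. V n \<subseteq> M n" "\<And>n v w. v \<in> V (Suc n) \<Longrightarrow> w \<in> V (Suc n) \<Longrightarrow> v \<otimes>\<^bsub>?X\<^esub> w \<in> V n"
    by metis
  have Vc: "v \<in> carrier ?X" if "v \<in> V n" for v n using X.unit_nbhd_carrier[OF V(1) that] .
  have Vone: "\<one>\<^bsub>?X\<^esub> \<in> V n" for n using V(1)[of n] by (simp add: open_unit_nbhd_def)
  have "\<exists>R. openin (topo G) R \<and> g \<in> R \<and> (\<forall>a\<in>R. \<forall>b\<in>R. a \<otimes>\<^bsub>G\<^esub> inv\<^bsub>G\<^esub> b \<in> D \<longrightarrow>
      (\<exists>v\<in>U. prj Y v = a \<otimes>\<^bsub>G\<^esub> inv\<^bsub>G\<^esub> b))" if U: "open_unit_nbhd ?X U" for U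
  proof -
    obtain W where W: "open_unit_nbhd G W" "\<forall>d\<in>W \<inter> D. \<exists>u\<in>U. prj Y u = d"
      using prj_unit_nbhd[OF U] by (elim exE conjE)
    obtain R where "openin (topo G) R" "g \<in> R" "\<forall>a\<in>R. \<forall>b\<in>R. a \<otimes>\<^bsub>G\<^esub> inv\<^bsub>G\<^esub> b \<in> W"
      using open_nbhd_difference[OF W(1) g] by (elim exE conjE)
    then show ?thesis using W(2) by (intro exI[of _ R]) simp
  qed
  note small = this
  have "\<forall>n. \<exists>R. openin (topo G) R \<and> g \<in> R \<and> (\<forall>a\<in>R. \<forall>b\<in>R. a \<otimes>\<^bsub>G\<^esub> inv\<^bsub>G\<^esub> b \<in> D \<longrightarrow>
      (\<exists>v\<in>V n. prj Y v = a \<otimes>\<^bsub>G\<^esub> inv\<^bsub>G\<^esub> b))" by (intro allI small V(1))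
  from choice[OF this] obtain R0 where R0': "\<forall>n. openin (topo G) (R0 n) \<and> g \<in> R0 n \<and>
      (\<forall>a\<in>R0 n. \<forall>b\<in>R0 n. a \<otimes>\<^bsub>G\<^esub> inv\<^bsub>G\<^esub> b \<in> D \<longrightarrow> (\<exists>v\<in>V n. prj Y v = a \<otimes>\<^bsub>G\<^esub> inv\<^bsub>G\<^esub> b))"
    by (elim exE)
  have R0: "openin (topo G) (R0 n)" "g \<in> R0 n"
    "a \<in> R0 n \<Longrightarrow> b \<in> R0 n \<Longrightarrow> a \<otimes>\<^bsub>G\<^esub> inv\<^bsub>G\<^esub> b \<in> D \<Longrightarrow> \<exists>v\<in>V n. prj Y v = a \<otimes>\<^bsub>G\<^esub> inv\<^bsub>G\<^esub> b" for n a b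
    using R0' by simp_all
  define R where "R n = (\<Inter>k\<in>{..n}. R0 k)" for n
  have R: "openin (topo G) (R n)" "g \<in> R n" "R n \<subseteq> R0 n" "R (Suc n) \<subseteq> R n" for n
    using R0(1,2) by (auto simp: R_def intro!: openin_Inter)
  have move: "\<exists>v\<in>V n. prj Y (y \<otimes>\<^bsub>?X\<^esub> v) = d"
    if y: "y \<in> carrier ?X" "prj Y y \<in> R n" and d: "d \<in> D" "d \<in> R n" for y d n
  proof -
    have "d \<otimes>\<^bsub>G\<^esub> inv\<^bsub>G\<^esub> (prj Y y) \<in> D" using d prj_D[OF y(1)] by simp
    then obtain v where v: "v \<in> V n" "prj Y v = d \<otimes>\<^bsub>G\<^esub> inv\<^bsub>G\<^esub> (prj Y y)"
      using R0(3)[of d n "prj Y y"] R(3) y d by blast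
    have "prj Y (y \<otimes>\<^bsub>?X\<^esub> v) = prj Y y \<otimes>\<^bsub>G\<^esub> (d \<otimes>\<^bsub>G\<^esub> inv\<^bsub>G\<^esub> (prj Y y))"
      using prj_mult[OF y(1) Vc[OF v(1)]] v(2) by simp
    also have "\<dots> = d" using prj_carrier[OF y(1)] d by (simp add: GG.cancel_middle)
    finally show ?thesis using v(1) by blast
  qed
  have "\<exists>y. \<forall>n. (y n \<in> carrier ?X \<and> prj Y (y n) \<in> R n) \<and> (\<exists>v\<in>V n. y (Suc n) = y n \<otimes>\<^bsub>?X\<^esub> v)"
  proof (rule dependent_nat_choice)
    obtain d where "d \<in> D" "d \<in> R 0" using dense_meets[OF R(1,2)] by blast
    then show "\<exists>y. y \<in> carrier ?X \<and> prj Y y \<in> R 0" using prj_lift by blast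
    fix y n assume y: "y \<in> carrier ?X \<and> prj Y y \<in> R n"
    obtain d where d: "d \<in> D" "d \<in> R (Suc n)" using dense_meets[OF R(1,2)] by blast
    then obtain v where v: "v \<in> V n" "prj Y (y \<otimes>\<^bsub>?X\<^esub> v) = d" using move[of y n d] y R(4) by blast
    then show "\<exists>y'. (y' \<in> carrier ?X \<and> prj Y y' \<in> R (Suc n)) \<and> (\<exists>v\<in>V n. y' = y \<otimes>\<^bsub>?X\<^esub> v)"
      using y d Vc[OF v(1)] by (intro exI[of _ "y \<otimes>\<^bsub>?X\<^esub> v"]) auto
  qed
  then obtain y where y: "\<And>n. y n \<in> carrier ?X" "\<And>n. prj Y (y n) \<in> R n"
    "\<And>n. \<exists>v\<in>V n. y (Suc n) = y n \<otimes>\<^bsub>?X\<^esub> v" by metis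
  define B where "B n = {x. \<exists>v\<in>V n. \<exists>w\<in>V n. x = y n \<otimes>\<^bsub>?X\<^esub> (v \<otimes>\<^bsub>?X\<^esub> w)}" for n
  have Bc: "B n \<subseteq> carrier ?X" for n using Vc y(1) by (auto simp: B_def)
  have "B (Suc n) \<subseteq> B n" for n
  proof
    fix x assume "x \<in> B (Suc n)"
    then obtain v w where x: "v \<in> V (Suc n)" "w \<in> V (Suc n)" "x = y (Suc n) \<otimes>\<^bsub>?X\<^esub> (v \<otimes>\<^bsub>?X\<^esub> w)"
      unfolding B_def by blast
    obtain v0 where v0: "v0 \<in> V n" "y (Suc n) = y n \<otimes>\<^bsub>?X\<^esub> v0" using y(3) by blast
    have "x = y n \<otimes>\<^bsub>?X\<^esub> (v0 \<otimes>\<^bsub>?X\<^esub> (v \<otimes>\<^bsub>?X\<^esub> w))"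
      unfolding x(3) v0(2) using y(1) Vc[OF v0(1)] Vc[OF x(1)] Vc[OF x(2)] by (simp add: X.m_assoc)
    then show "x \<in> B n" unfolding B_def using v0(1) V(4)[OF x(1,2)] by blast
  qed
  then have Bmono: "B m \<subseteq> B n" if "n \<le> m" for n m using that by (rule lift_Suc_antimono_le)
  let ?I = "(UNIV :: nat set) \<times> {O'. openin (topo G) O' \<and> g \<in> O'}"
  define A where "A z = {x \<in> B (fst z). prj Y x \<in> snd z}" for z
  \<comment> \<open>The index pairs combine an \<open>n\<close> with a neighbourhood of \<open>g\<close>, so that the filter is generated by a directed family.\<close>
  define F0 where "F0 = (INF z\<in>?I. principal (A z))"
  have ev_F0: "eventually P F0 \<longleftrightarrow> (\<exists>z\<in>?I. eventually P (principal (A z)))" for P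
    unfolding F0_def
  proof (rule eventually_INF_base)
    show "?I \<noteq> {}" using GG.openin_carrier_self g by blast
    fix a b assume "a \<in> ?I" "b \<in> ?I"
    then show "\<exists>x\<in>?I. principal (A x) \<le> inf (principal (A a)) (principal (A b))"
      using Bmono[of "fst a" "max (fst a) (fst b)"] Bmono[of "fst b" "max (fst a) (fst b)"]
      by (intro bexI[of _ "(max (fst a) (fst b), snd a \<inter> snd b)"]) (auto simp: A_def)
  qed
  have "A z \<noteq> {}" if z: "z \<in> ?I" for z
  proof -
    have "openin (topo G) (snd z \<inter> R (fst z))" "g \<in> snd z \<inter> R (fst z)" using z R by auto
    then obtain d where d: "d \<in> D" "d \<in> snd z" "d \<in> R (fst z)" using dense_meets by blast
    obtain v where v: "v \<in> V (fst z)" "prj Y (y (fst z) \<otimes>\<^bsub>?X\<^esub> v) = d"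
      using move[OF y(1,2) d(1,3)] by blast
    have "y (fst z) \<otimes>\<^bsub>?X\<^esub> v = y (fst z) \<otimes>\<^bsub>?X\<^esub> (v \<otimes>\<^bsub>?X\<^esub> \<one>\<^bsub>?X\<^esub>)" using Vc[OF v(1)] by simp
    then have "y (fst z) \<otimes>\<^bsub>?X\<^esub> v \<in> A z" unfolding A_def B_def using v d(2) Vone by blast
    then show ?thesis by blast
  qed
  then have "F0 \<noteq> bot" unfolding trivial_limit_def ev_F0 by (auto simp: eventually_principal)
  then obtain F where F: "F \<noteq> bot" "F \<le> F0" "\<And>P. eventually P F \<or> (\<forall>\<^sub>F x in F. \<not> P x)"
    using ultrafilter_below by metis
  have ev_F: "\<forall>\<^sub>F x in F. x \<in> B n \<and> prj Y x \<in> O'" if "openin (topo G) O'" "g \<in> O'" for n O'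
    by (rule filter_leD[OF F(2)], subst ev_F0, rule bexI[of _ "(n, O')"])
      (use that in \<open>auto simp: A_def eventually_principal\<close>)
  have "limitin (topo G) (prj Y) g F"
    unfolding limitin_def using g GG.topspace_eq ev_F[of _ 0] by (simp add: eventually_conj_iff)
  moreover have "Cauchy_filter_in ?X F"
  proof (rule X.Cauchy_filterI[OF F(1)])
    show "\<forall>\<^sub>F x in F. x \<in> carrier ?X"
      using ev_F[OF GG.openin_carrier_self g, of 0] Bc[of 0] by (auto elim: eventually_mono)
    fix U assume "open_unit_nbhd ?X U"
    then obtain U1 where U1: "open_unit_nbhd ?X U1" "\<And>v. v \<in> U1 \<Longrightarrow> inv\<^bsub>?X\<^esub> v \<in> U1"
      "\<And>v w. v \<in> U1 \<Longrightarrow> w \<in> U1 \<Longrightarrow> v \<otimes>\<^bsub>?X\<^esub> w \<in> U" using X.unit_nbhd_halve by metis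
    then obtain U2 where U2: "open_unit_nbhd ?X U2" "\<And>v w. v \<in> U2 \<Longrightarrow> w \<in> U2 \<Longrightarrow> v \<otimes>\<^bsub>?X\<^esub> w \<in> U1"
      using X.unit_nbhd_halve[OF U1(1)] by metis
    obtain n S where S: "finite S" "S \<subseteq> carrier H"
      "\<forall>x\<in>N n. \<exists>s\<in>S. \<exists>u\<in>{h \<in> carrier H. inc Y h \<in> U2}. x = s \<otimes>\<^bsub>H\<^esub> u"
      using N(2)[rule_format, OF tg_hom_unit_nbhd[OF inc_tg_hom H X.top_ab_group_axioms U2(1)]]
      by (elim exE conjE)
    obtain R' where R': "openin (topo G) R'" "g \<in> R'"
      "\<forall>a\<in>R'. \<forall>b\<in>R'. a \<otimes>\<^bsub>G\<^esub> inv\<^bsub>G\<^esub> b \<in> D \<longrightarrow> (\<exists>v\<in>U2 \<inter> V (Suc n). prj Y v = a \<otimes>\<^bsub>G\<^esub> inv\<^bsub>G\<^esub> b)"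
      using small[OF X.unit_nbhd_Int[OF U2(1) V(1)[of "Suc n"]]] by (elim exE conjE)
    \<comment> \<open>Products of two elements of \<open>V m\<close> lie in \<open>V (n + 2)\<close>, quotients of such products in \<open>V (n + 1)\<close>, and the correction by \<open>u\<close> below leads to \<open>V n\<close>.\<close>
    define m where "m = Suc (Suc (Suc n))"
    let ?A = "\<lambda>x. x \<in> B m \<and> prj Y x \<in> R'"
    have cover: "\<exists>s\<in>S. \<exists>e\<in>U1. a \<otimes>\<^bsub>?X\<^esub> inv\<^bsub>?X\<^esub> b = inc Y s \<otimes>\<^bsub>?X\<^esub> e" if a: "?A a" and b: "?A b" for a b
    proof -
      have ac: "a \<in> carrier ?X" and bc: "b \<in> carrier ?X" using a b Bc by blast+
      obtain v w where v: "v \<in> V m" "w \<in> V m" "a = y m \<otimes>\<^bsub>?X\<^esub> (v \<otimes>\<^bsub>?X\<^esub> w)" using a unfolding B_def by blast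
      obtain v' w' where v': "v' \<in> V m" "w' \<in> V m" "b = y m \<otimes>\<^bsub>?X\<^esub> (v' \<otimes>\<^bsub>?X\<^esub> w')" using b unfolding B_def by blast
      have vw: "v \<otimes>\<^bsub>?X\<^esub> w \<in> V (Suc (Suc n))" "v' \<otimes>\<^bsub>?X\<^esub> w' \<in> V (Suc (Suc n))"
        using V(4) v(1,2) v'(1,2) by (simp_all add: m_def)
      have "a \<otimes>\<^bsub>?X\<^esub> inv\<^bsub>?X\<^esub> b = (v \<otimes>\<^bsub>?X\<^esub> w) \<otimes>\<^bsub>?X\<^esub> inv\<^bsub>?X\<^esub> (v' \<otimes>\<^bsub>?X\<^esub> w')"
        unfolding v(3) v'(3) using X.mult_div_mult[OF y(1) Vc[OF vw(1)] y(1) Vc[OF vw(2)], of m m]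
          Vc[OF vw(1)] Vc[OF vw(2)] y(1)[of m] by simp
      then have abV: "a \<otimes>\<^bsub>?X\<^esub> inv\<^bsub>?X\<^esub> b \<in> V (Suc n)" using V(4)[OF vw(1) V(2)[OF vw(2)]] by simp
      have pab: "prj Y (a \<otimes>\<^bsub>?X\<^esub> inv\<^bsub>?X\<^esub> b) = prj Y a \<otimes>\<^bsub>G\<^esub> inv\<^bsub>G\<^esub> (prj Y b)"
        using ac bc by (simp only: prj_mult prj_inv X.inv_closed)
      have "prj Y a \<otimes>\<^bsub>G\<^esub> inv\<^bsub>G\<^esub> (prj Y b) \<in> D" using prj_D[OF ac] prj_D[OF bc] by simp
      then obtain u where u: "u \<in> U2" "u \<in> V (Suc n)" "prj Y u = prj Y a \<otimes>\<^bsub>G\<^esub> inv\<^bsub>G\<^esub> (prj Y b)"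
        using R'(3) a b by blast
      have abc: "a \<otimes>\<^bsub>?X\<^esub> inv\<^bsub>?X\<^esub> b \<in> carrier ?X" using ac bc by simp
      have uc: "u \<in> carrier ?X" using Vc[OF u(2)] .
      have "prj Y (a \<otimes>\<^bsub>?X\<^esub> inv\<^bsub>?X\<^esub> b) = prj Y u" using pab u(3) by simp
      from prj_eq[OF abc uc this] obtain h where h: "h \<in> carrier H" "a \<otimes>\<^bsub>?X\<^esub> inv\<^bsub>?X\<^esub> b = u \<otimes>\<^bsub>?X\<^esub> inc Y h" .
      have "inc Y h = inv\<^bsub>?X\<^esub> u \<otimes>\<^bsub>?X\<^esub> (a \<otimes>\<^bsub>?X\<^esub> inv\<^bsub>?X\<^esub> b)"
        unfolding h(2) using uc h(1) by (simp add: X.cancel_left)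
      then have "inc Y h \<in> V n" using V(4)[OF V(2)[OF u(2)] abV] by simp
      then have "h \<in> N n" using M(2)[OF h(1)] V(3) by blast
      then obtain s k where sk: "s \<in> S" "k \<in> carrier H" "inc Y k \<in> U2" "h = s \<otimes>\<^bsub>H\<^esub> k" using S(3) by blast
      have sc: "s \<in> carrier H" using sk(1) S(2) by blast
      have "a \<otimes>\<^bsub>?X\<^esub> inv\<^bsub>?X\<^esub> b = inc Y s \<otimes>\<^bsub>?X\<^esub> (u \<otimes>\<^bsub>?X\<^esub> inc Y k)"
        unfolding h(2) sk(4) using uc sc sk(2) by (simp add: X.m_lcomm)
      then show ?thesis using sk(1) U2(2)[OF u(1) sk(3)] by blast
    qed
    have evA: "eventually ?A F" by (rule ev_F[OF R'(1,2)])
    then obtain b where b: "?A b" using eventually_happens'[OF F(1)] by blast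
    have "\<forall>\<^sub>F a in F. \<exists>s\<in>S. a \<in> carrier ?X \<and> (\<exists>e\<in>U1. a \<otimes>\<^bsub>?X\<^esub> inv\<^bsub>?X\<^esub> b = inc Y s \<otimes>\<^bsub>?X\<^esub> e)"
    proof (rule eventually_mono[OF evA])
      fix a assume a: "?A a"
      then have "a \<in> carrier ?X" using Bc by blast
      then show "\<exists>s\<in>S. a \<in> carrier ?X \<and> (\<exists>e\<in>U1. a \<otimes>\<^bsub>?X\<^esub> inv\<^bsub>?X\<^esub> b = inc Y s \<otimes>\<^bsub>?X\<^esub> e)"
        using cover[OF a b] by (simp only: simp_thms)
    qed
    from ultrafilter_finite_cover[OF F(1) F(3) S(1) this]
    obtain s where s: "s \<in> S" and
      evs: "\<forall>\<^sub>F a in F. a \<in> carrier ?X \<and> (\<exists>e\<in>U1. a \<otimes>\<^bsub>?X\<^esub> inv\<^bsub>?X\<^esub> b = inc Y s \<otimes>\<^bsub>?X\<^esub> e)" by (elim bexE)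
    let ?C = "{a \<in> carrier ?X. \<exists>e\<in>U1. a \<otimes>\<^bsub>?X\<^esub> inv\<^bsub>?X\<^esub> b = inc Y s \<otimes>\<^bsub>?X\<^esub> e}"
    have bc: "b \<in> carrier ?X" using b Bc by blast
    have sc: "inc Y s \<in> carrier ?X" using s S(2) by auto
    have "a \<otimes>\<^bsub>?X\<^esub> inv\<^bsub>?X\<^esub> a' \<in> U" if a: "a \<in> ?C" and a': "a' \<in> ?C" for a a'
    proof -
      obtain e where e: "e \<in> U1" "a \<otimes>\<^bsub>?X\<^esub> inv\<^bsub>?X\<^esub> b = inc Y s \<otimes>\<^bsub>?X\<^esub> e" using a by (elim CollectE conjE bexE)
      obtain e' where e': "e' \<in> U1" "a' \<otimes>\<^bsub>?X\<^esub> inv\<^bsub>?X\<^esub> b = inc Y s \<otimes>\<^bsub>?X\<^esub> e'" using a' by (elim CollectE conjE bexE)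
      have c: "a \<in> carrier ?X" "a' \<in> carrier ?X" "e \<in> carrier ?X" "e' \<in> carrier ?X"
        using a a' X.unit_nbhd_carrier[OF U1(1)] e(1) e'(1) by (simp_all only: mem_Collect_eq)
      have "a \<otimes>\<^bsub>?X\<^esub> inv\<^bsub>?X\<^esub> a' = (a \<otimes>\<^bsub>?X\<^esub> inv\<^bsub>?X\<^esub> b) \<otimes>\<^bsub>?X\<^esub> inv\<^bsub>?X\<^esub> (a' \<otimes>\<^bsub>?X\<^esub> inv\<^bsub>?X\<^esub> b)"
        using X.mult_div_mult[OF c(1) X.inv_closed[OF bc] c(2) X.inv_closed[OF bc]] c bc by simp
      also have "\<dots> = e \<otimes>\<^bsub>?X\<^esub> inv\<^bsub>?X\<^esub> e'"
        unfolding e(2) e'(2) using X.mult_div_mult[OF sc c(3) sc c(4)] c sc by simp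
      finally show ?thesis using U1(3)[OF e(1) U1(2)[OF e'(1)]] by simp
    qed
    moreover have "\<forall>\<^sub>F a in F. a \<in> ?C" using evs by simp
    ultimately show "\<exists>A. (\<forall>\<^sub>F x in F. x \<in> A) \<and> (\<forall>a\<in>A. \<forall>b\<in>A. a \<otimes>\<^bsub>?X\<^esub> inv\<^bsub>?X\<^esub> b \<in> U)" by blast
  qed
  ultimately show ?thesis by blast
qed

end

section \<open>Extending an extension from a dense subgroup\<close>

lemma (in top_ab_group) eventually_nhdsin_open:
  "openin (topo G) S \<Longrightarrow> x \<in> S \<Longrightarrow> \<forall>\<^sub>F y in nhdsin (topo G) x. y \<in> S"
  using openin_carrier by (auto simp: eventually_nhdsin)

lemma (in top_ab_group) eventually_nhdsin_self:
  assumes x: "x \<in> carrier G" and ev: "eventually P (nhdsin (topo G) x)"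
  shows "P x"
  using ev unfolding eventually_nhdsin_carrier[OF x] by blast

lemma (in top_ab_group) nhdsin_tg_hom: "nhdsin (topo G) \<in> tg_hom G (Raikov_completion G)"
proof (rule tg_homI[OF top_ab_group_axioms top_ab_group_Raikov])
  show "nhdsin (topo G) \<in> hom G (Raikov_completion G)"
    by (rule homI) (simp_all add: minimal_Cauchy_nhdsin filter_mult_nhdsin)
  fix \<V> assume V: "open_unit_nbhd (Raikov_completion G) \<V>"
  then have "openin (topo (Raikov_completion G)) \<V>" "nhdsin (topo G) \<one> \<in> \<V>" by (simp_all add: open_unit_nbhd_def)
  then obtain A where A: "openin (topo G) A" "\<forall>\<^sub>F x in nhdsin (topo G) \<one>. x \<in> A"
    "\<forall>F'. minimal_Cauchy G F' \<longrightarrow> (\<forall>\<^sub>F x in F'. x \<in> A) \<longrightarrow> F' \<in> \<V>"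
    unfolding openin_Raikov by blast
  have "\<one> \<in> A" by (rule eventually_nhdsin_self[OF one_closed A(2)])
  then show "\<exists>U. open_unit_nbhd G U \<and> (\<forall>u\<in>U. nhdsin (topo G) u \<in> \<V>)"
    using A(1,3) minimal_Cauchy_nhdsin eventually_nhdsin_open[OF A(1)] openin_carrier[OF A(1)]
    by (intro exI[of _ A]) (auto simp: open_unit_nbhd_def)
qed

lemma (in top_ab_group) nhdsin_eqD:
  assumes x: "x \<in> carrier G" and y: "y \<in> carrier G" and eq: "nhdsin (topo G) x = nhdsin (topo G) y"
  shows "x = y"
proof (rule ccontr)
  assume "x \<noteq> y"
  then obtain V W where VW: "openin (topo G) V" "openin (topo G) W" "x \<in> V" "y \<in> W" "disjnt V W"
    using Hausdorff x y unfolding Hausdorff_space_def topspace_eq by blast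
  then have "x \<in> W" using eventually_nhdsin_self[OF x, of "\<lambda>z. z \<in> W"] eventually_nhdsin_open[OF VW(2,4)] eq by simp
  then show False using VW by (auto simp: disjnt_def)
qed

lemma limitin_filter_mult:
  assumes G: "top_ab_group G" and p: "p \<in> tg_hom X G"
    and F: "limitin (topo G) p g F" "\<forall>\<^sub>F x in F. x \<in> carrier X"
    and F': "limitin (topo G) p g' F'" "\<forall>\<^sub>F x in F'. x \<in> carrier X"
  shows "limitin (topo G) p (g \<otimes>\<^bsub>G\<^esub> g') (filter_mult X F F')"
proof -
  interpret G: top_ab_group G by fact
  have g: "g \<in> carrier G" "g' \<in> carrier G" using F(1) F'(1) limitin_topspace G.topspace_eq by metis+
  show ?thesis
    unfolding limitin_def
  proof (intro conjI allI impI)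
    show "g \<otimes>\<^bsub>G\<^esub> g' \<in> topspace (topo G)" using g G.topspace_eq by simp
    fix U assume U: "openin (topo G) U \<and> g \<otimes>\<^bsub>G\<^esub> g' \<in> U"
    then obtain V W where VW: "openin (topo G) V" "openin (topo G) W" "g \<in> V" "g' \<in> W"
      "\<forall>v\<in>V. \<forall>w\<in>W. v \<otimes>\<^bsub>G\<^esub> w \<in> U" using G.mult_nbhds[of U g g'] g by (elim conjE) metis
    have "\<forall>\<^sub>F x in F. p x \<in> V" "\<forall>\<^sub>F x in F'. p x \<in> W" using F(1) F'(1) VW unfolding limitin_def by blast+
    then have "\<forall>\<^sub>F x in F. p x \<in> V \<and> x \<in> carrier X" "\<forall>\<^sub>F x in F'. p x \<in> W \<and> x \<in> carrier X"
      using F(2) F'(2) by (simp_all add: eventually_conj_iff)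
    then show "\<forall>\<^sub>F x in filter_mult X F F'. p x \<in> U"
      unfolding eventually_filter_mult using VW(5) tg_hom_mult[OF p]
      by - (rule exI[of _ "\<lambda>x. p x \<in> V \<and> x \<in> carrier X"], rule exI[of _ "\<lambda>x. p x \<in> W \<and> x \<in> carrier X"], simp)
  qed
qed

lemma limitin_nhdsin:
  assumes X: "top_ab_group X" and p: "p \<in> tg_hom X G" and x: "x \<in> carrier X"
    and top: "topspace (topo G) = carrier G"
  shows "limitin (topo G) p (p x) (nhdsin (topo X) x)"
proof -
  interpret X: top_ab_group X by fact
  show ?thesis
    unfolding limitin_def
  proof (intro conjI allI impI)
    show "p x \<in> topspace (topo G)" using tg_hom_closed[OF p x] top by simp
    fix U assume U: "openin (topo G) U \<and> p x \<in> U"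
    have "openin (topo X) {x \<in> carrier X. p x \<in> U}"
      using openin_continuous_map_preimage[of "topo X" "topo G" p U] p U by (simp add: tg_hom_def X.topspace_eq)
    from X.eventually_nhdsin_open[OF this, of x] show "\<forall>\<^sub>F x in nhdsin (topo X) x. p x \<in> U"
      using U x by (simp add: eventually_conj_iff)
  qed
qed

context dense_extension
begin

abbreviation "C \<equiv> Raikov_completion (mid Y)"

text \<open>The projection of the completed extension. Uniqueness of limits in \<open>G\<close> makes it well defined on
  \<open>completion_points\<close>, the middle group.\<close>

definition limit_of :: "'y filter \<Rightarrow> 'g" where
  "limit_of F = (THE g. limitin (topo G) (prj Y) g F)"

definition completion_points :: "'y filter set" where
  "completion_points = {F. minimal_Cauchy (mid Y) F \<and> (\<exists>g. limitin (topo G) (prj Y) g F)}"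

definition completion_extension :: "('h, 'y filter, 'g) extn" where
  "completion_extension = \<lparr>mid = tg_sub C completion_points,
     inc = (\<lambda>h. nhdsin (topo (mid Y)) (inc Y h)), prj = limit_of\<rparr>"

lemma completion_extension_simps [simp]:
  "mid completion_extension = tg_sub C completion_points"
  "inc completion_extension = (\<lambda>h. nhdsin (topo (mid Y)) (inc Y h))"
  "prj completion_extension = limit_of"
  by (simp_all add: completion_extension_def)

lemma limit_of_eq:
  assumes "minimal_Cauchy (mid Y) F" "limitin (topo G) (prj Y) g F"
  shows "limit_of F = g"
  unfolding limit_of_def
proof (rule the_equality)
  show "limitin (topo G) (prj Y) g F" by (rule assms(2))
  fix g' assume "limitin (topo G) (prj Y) g' F"
  then show "g' = g"
    using assms(2) X.minimal_CauchyD(2)[OF assms(1)] GG.Hausdorff by (rule limitin_Hausdorff_unique)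
qed

lemma completion_pointsI:
  assumes "minimal_Cauchy (mid Y) F" "limitin (topo G) (prj Y) g F"
  shows "F \<in> completion_points"
  using assms by (auto simp: completion_points_def)

lemma completion_pointsD:
  assumes "F \<in> completion_points"
  shows "minimal_Cauchy (mid Y) F" "limitin (topo G) (prj Y) (limit_of F) F" "limit_of F \<in> carrier G"
proof -
  show mc: "minimal_Cauchy (mid Y) F" using assms by (simp add: completion_points_def)
  obtain g where g: "limitin (topo G) (prj Y) g F" using assms unfolding completion_points_def by blast
  then show "limitin (topo G) (prj Y) (limit_of F) F" using limit_of_eq[OF mc g] by simp
  then show "limit_of F \<in> carrier G" using limitin_topspace GG.topspace_eq by metis
qed

lemma mult_points:
  assumes F: "F \<in> completion_points" and F': "F' \<in> completion_points"
  shows "filter_mult (mid Y) F F' \<in> completion_points"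
    and "limit_of (filter_mult (mid Y) F F') = limit_of F \<otimes>\<^bsub>G\<^esub> limit_of F'"
proof -
  note f = completion_pointsD[OF F] and f' = completion_pointsD[OF F']
  have m: "minimal_Cauchy (mid Y) (filter_mult (mid Y) F F')"
    by (rule X.minimal_Cauchy_mult[OF X.minimal_CauchyD(1)[OF f(1)] f'(1)])
  have l: "limitin (topo G) (prj Y) (limit_of F \<otimes>\<^bsub>G\<^esub> limit_of F') (filter_mult (mid Y) F F')"
    by (rule limitin_filter_mult[OF top_G prj_tg_hom_G f(2) X.minimal_CauchyD(3)[OF f(1)]
       f'(2) X.minimal_CauchyD(3)[OF f'(1)]])
  show "filter_mult (mid Y) F F' \<in> completion_points"
    "limit_of (filter_mult (mid Y) F F') = limit_of F \<otimes>\<^bsub>G\<^esub> limit_of F'"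
    using completion_pointsI[OF m l] limit_of_eq[OF m l] .
qed

lemma nhdsin_points:
  assumes y: "y \<in> carrier (mid Y)"
  shows "nhdsin (topo (mid Y)) y \<in> completion_points" and "limit_of (nhdsin (topo (mid Y)) y) = prj Y y"
proof -
  note m = X.minimal_Cauchy_nhdsin[OF y]
    and l = limitin_nhdsin[OF X.top_ab_group_axioms prj_tg_hom_G y GG.topspace_eq]
  show "nhdsin (topo (mid Y)) y \<in> completion_points" "limit_of (nhdsin (topo (mid Y)) y) = prj Y y"
    using completion_pointsI[OF m l] limit_of_eq[OF m l] .
qed

lemma inv_points:
  assumes F: "F \<in> completion_points"
  shows "filtermap (\<lambda>x. inv\<^bsub>mid Y\<^esub> x) F \<in> completion_points"
proof (rule completion_pointsI)
  note f = completion_pointsD[OF F]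
  show "minimal_Cauchy (mid Y) (filtermap (\<lambda>x. inv\<^bsub>mid Y\<^esub> x) F)" by (rule X.minimal_Cauchy_inv[OF f(1)])
  show "limitin (topo G) (prj Y) (inv\<^bsub>G\<^esub> (limit_of F)) (filtermap (\<lambda>x. inv\<^bsub>mid Y\<^esub> x) F)"
    unfolding limitin_def eventually_filtermap
  proof (intro conjI allI impI)
    show "inv\<^bsub>G\<^esub> (limit_of F) \<in> topspace (topo G)" using f(3) GG.topspace_eq by simp
    fix U assume U: "openin (topo G) U \<and> inv\<^bsub>G\<^esub> (limit_of F) \<in> U"
    have "\<forall>\<^sub>F x in F. prj Y x \<in> {x \<in> carrier G. inv\<^bsub>G\<^esub> x \<in> U}"
      using f(2,3) GG.openin_inv_preimage U unfolding limitin_def by blast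
    then show "\<forall>\<^sub>F x in F. prj Y (inv\<^bsub>mid Y\<^esub> x) \<in> U"
      using X.minimal_CauchyD(3)[OF f(1)] by eventually_elim (simp add: prj_inv del: p.hom_inv)
  qed
qed

lemma subgroup_completion_points: "subgroup completion_points C"
proof -
  interpret C: top_ab_group C by (rule X.top_ab_group_Raikov)
  show ?thesis
  proof (rule C.subgroupI)
    show "completion_points \<subseteq> carrier C" using completion_pointsD(1) by auto
    show "completion_points \<noteq> {}" using nhdsin_points(1)[OF X.one_closed] by blast
  next
    fix F assume F: "F \<in> completion_points"
    then show "inv\<^bsub>C\<^esub> F \<in> completion_points"
      using inv_points[OF F] X.inv_Raikov[OF completion_pointsD(1)[OF F]] by simp
  next
    fix F F' assume "F \<in> completion_points" "F' \<in> completion_points"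
    then show "F \<otimes>\<^bsub>C\<^esub> F' \<in> completion_points" using mult_points(1) by simp
  qed
qed

lemma point_over:
  assumes am: "almost_metrizable H" and g: "g \<in> carrier G"
  shows "\<exists>F\<in>completion_points. limit_of F = g"
proof -
  obtain F where F: "Cauchy_filter_in (mid Y) F" "limitin (topo G) (prj Y) g F"
    using Cauchy_filter_lift[OF am g] by (elim exE conjE)
  have c: "\<forall>\<^sub>F x in F. x \<in> carrier (mid Y)" using F(1) by (simp add: Cauchy_filter_in_def le_principal)
  let ?N = "nhdsin (topo (mid Y)) \<one>\<^bsub>mid Y\<^esub>"
  note N = X.minimal_Cauchy_nhdsin[OF X.one_closed]
  have m: "minimal_Cauchy (mid Y) (filter_mult (mid Y) F ?N)" by (rule X.minimal_Cauchy_mult[OF F(1) N])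
  have "limitin (topo G) (prj Y) (g \<otimes>\<^bsub>G\<^esub> prj Y \<one>\<^bsub>mid Y\<^esub>) (filter_mult (mid Y) F ?N)"
    by (rule limitin_filter_mult[OF top_G prj_tg_hom_G F(2) c
        limitin_nhdsin[OF X.top_ab_group_axioms prj_tg_hom_G X.one_closed GG.topspace_eq] X.minimal_CauchyD(3)[OF N]])
  then have l: "limitin (topo G) (prj Y) g (filter_mult (mid Y) F ?N)" using g by (simp add: prj_one)
  show ?thesis using completion_pointsI[OF m l] limit_of_eq[OF m l] by blast
qed

text \<open>Continuity at the unit: a filter containing the preimage of \<open>W\<close> has its limit in the closure of \<open>W\<close>,
  which is contained in the square of \<open>W\<close> when \<open>W\<close> is symmetric.\<close>

lemma limit_of_tg_hom: "limit_of \<in> tg_hom (tg_sub C completion_points) G"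
proof (rule tg_homI[OF top_ab_group_sub[OF X.top_ab_group_Raikov subgroup_completion_points] top_G])
  show "limit_of \<in> hom (tg_sub C completion_points) G"
    by (rule homI) (simp_all add: completion_pointsD(3) mult_points(2))
  fix V assume "open_unit_nbhd G V"
  then obtain W where W: "open_unit_nbhd G W" "\<And>v. v \<in> W \<Longrightarrow> inv\<^bsub>G\<^esub> v \<in> W"
    "\<And>v w. v \<in> W \<Longrightarrow> w \<in> W \<Longrightarrow> v \<otimes>\<^bsub>G\<^esub> w \<in> V" using GG.unit_nbhd_halve by metis
  let ?B = "{y \<in> carrier (mid Y). prj Y y \<in> W}"
  let ?U = "{F. minimal_Cauchy (mid Y) F \<and> (\<forall>\<^sub>F x in F. x \<in> ?B)}"
  have B: "open_unit_nbhd (mid Y) ?B" by (rule tg_hom_unit_nbhd[OF prj_tg_hom_G X.top_ab_group_axioms top_G W(1)])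
  then have "openin (topo C) ?U" by (intro X.openin_Raikov_basic) (simp only: open_unit_nbhd_def)
  moreover have "nhdsin (topo (mid Y)) \<one>\<^bsub>mid Y\<^esub> \<in> ?U"
    using X.minimal_Cauchy_nhdsin[OF X.one_closed] X.eventually_nhdsin_open[of ?B "\<one>\<^bsub>mid Y\<^esub>"] B
    by (simp only: open_unit_nbhd_def mem_Collect_eq simp_thms)
  ultimately have "open_unit_nbhd C ?U" by (simp only: open_unit_nbhd_def Raikov_completion_simps simp_thms)
  then have U: "open_unit_nbhd (tg_sub C completion_points) (?U \<inter> completion_points)"
    by (rule unit_nbhd_sub) (use nhdsin_points(1)[OF X.one_closed] in simp)
  have "limit_of F \<in> V" if F: "F \<in> ?U \<inter> completion_points" for F
  proof -
    note f = completion_pointsD[of F]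
    have l: "limitin (topo G) (prj Y) (limit_of F) F" "limit_of F \<in> carrier G" using f F by auto
    let ?L = "(\<lambda>u. limit_of F \<otimes>\<^bsub>G\<^esub> u) ` W"
    have "openin (topo G) ?L" using W(1) l(2) by (intro GG.openin_translate) (auto simp: open_unit_nbhd_def)
    moreover have "limit_of F \<in> ?L"
      using W(1) l(2) by (intro image_eqI[of _ _ "\<one>\<^bsub>G\<^esub>"]) (auto simp: open_unit_nbhd_def)
    ultimately have "\<forall>\<^sub>F x in F. prj Y x \<in> ?L" using l(1) unfolding limitin_def by blast
    moreover have "\<forall>\<^sub>F x in F. x \<in> ?B" "F \<noteq> bot" using F X.minimal_CauchyD(2) by blast+
    ultimately obtain x where x: "prj Y x \<in> ?L" "x \<in> ?B"
      using eventually_happens'[OF _ eventually_conj] by blast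
    then obtain w where w: "w \<in> W" "prj Y x = limit_of F \<otimes>\<^bsub>G\<^esub> w" by (elim imageE)
    have "limit_of F = prj Y x \<otimes>\<^bsub>G\<^esub> inv\<^bsub>G\<^esub> w"
      unfolding w(2) using l(2) GG.unit_nbhd_carrier[OF W(1) w(1)] by (simp add: GG.cancel_right)
    then show ?thesis using W(3)[OF _ W(2)[OF w(1)]] x(2) by simp
  qed
  then show "\<exists>U. open_unit_nbhd (tg_sub C completion_points) U \<and> (\<forall>u\<in>U. limit_of u \<in> V)" using U by blast
qed

text \<open>A point \<open>g\<close> close to the unit is the limit of some \<open>F\<close> by the lifting lemma, but \<open>F\<close> need not be close
  to the unit. A small member of \<open>F\<close> contains a point \<open>y\<close> over a small element of \<open>D\<close>, which also has a
  small preimage \<open>v\<close>. Multiplying \<open>F\<close> by the element of \<open>H\<close> that takes \<open>y\<close> to \<open>v\<close> leaves the limit unchanged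
  and moves \<open>F\<close> close to the unit.\<close>

lemma limit_of_open:
  assumes am: "almost_metrizable H" and U: "open_unit_nbhd (tg_sub C completion_points) U"
  shows "\<exists>W. open_unit_nbhd G W \<and> W \<subseteq> limit_of ` U"
proof -
  let ?X = "mid Y"
  obtain U' where U': "open_unit_nbhd C U'" "U = U' \<inter> completion_points" using U by (rule unit_nbhd_subE)
  then have "openin (topo C) U'" "nhdsin (topo ?X) \<one>\<^bsub>?X\<^esub> \<in> U'" by (simp_all add: open_unit_nbhd_def)
  then obtain A where A: "openin (topo ?X) A" "\<forall>\<^sub>F x in nhdsin (topo ?X) \<one>\<^bsub>?X\<^esub>. x \<in> A"
    "\<forall>F'. minimal_Cauchy ?X F' \<longrightarrow> (\<forall>\<^sub>F x in F'. x \<in> A) \<longrightarrow> F' \<in> U'" unfolding openin_Raikov by blast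
  have "open_unit_nbhd ?X A" using A(1) X.eventually_nhdsin_self[OF X.one_closed A(2)] by (simp add: open_unit_nbhd_def)
  then obtain V1 where V1: "open_unit_nbhd ?X V1" "\<And>v w. v \<in> V1 \<Longrightarrow> w \<in> V1 \<Longrightarrow> v \<otimes>\<^bsub>?X\<^esub> w \<in> A"
    using X.unit_nbhd_halve by metis
  then obtain V where V: "open_unit_nbhd ?X V" "V \<subseteq> V1" "\<And>v w. v \<in> V \<Longrightarrow> w \<in> V \<Longrightarrow> v \<otimes>\<^bsub>?X\<^esub> w \<in> V1"
    using X.unit_nbhd_halve[OF V1(1)] by metis
  obtain W where W: "open_unit_nbhd G W" "\<forall>d\<in>W \<inter> D. \<exists>u\<in>V. prj Y u = d" using prj_unit_nbhd[OF V(1)] by (elim exE conjE)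
  have "g \<in> limit_of ` U" if g: "g \<in> W" for g
  proof -
    have "g \<in> carrier G" using GG.unit_nbhd_carrier[OF W(1) g] .
    then obtain F where F: "F \<in> completion_points" "limit_of F = g" using point_over[OF am] by blast
    note f = completion_pointsD[OF F(1)]
    obtain B where B: "\<forall>\<^sub>F x in F. x \<in> B" "B \<subseteq> carrier ?X" "\<forall>a\<in>B. \<forall>b\<in>B. a \<otimes>\<^bsub>?X\<^esub> inv\<^bsub>?X\<^esub> b \<in> V"
      using X.Cauchy_small_set[OF X.minimal_CauchyD(1)[OF f(1)] V(1)] by (elim exE conjE)
    have "\<forall>\<^sub>F x in F. prj Y x \<in> W" using f(2) F(2) g W(1) by (simp add: limitin_def open_unit_nbhd_def)
    then obtain y where y: "y \<in> B" "prj Y y \<in> W"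
      using eventually_happens'[OF X.minimal_CauchyD(2)[OF f(1)] eventually_conj[OF B(1)]] by blast
    have yc: "y \<in> carrier ?X" using y(1) B(2) by blast
    obtain v where v: "v \<in> V" "prj Y v = prj Y y" using W(2) y(2) prj_D[OF yc] by blast
    have vc: "v \<in> carrier ?X" using X.unit_nbhd_carrier[OF V(1) v(1)] .
    from prj_eq[OF vc yc v(2)] obtain h where h: "h \<in> carrier H" "v = y \<otimes>\<^bsub>?X\<^esub> inc Y h" .
    define F' where "F' = filter_mult ?X F (nhdsin (topo ?X) (inc Y h))"
    note ih = nhdsin_points[OF i.hom_closed[OF h(1)]]
    have F': "F' \<in> completion_points" "limit_of F' = g"
      using mult_points[OF F(1) ih(1)] ih(2) F(2) h(1) \<open>g \<in> carrier G\<close> by (simp_all add: F'_def)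
    let ?T = "(\<lambda>u. inc Y h \<otimes>\<^bsub>?X\<^esub> u) ` V"
    have "openin (topo ?X) ?T" using V(1) h(1) by (intro X.openin_translate) (auto simp: open_unit_nbhd_def)
    moreover have "inc Y h \<in> ?T"
      using V(1) h(1) by (intro image_eqI[of _ _ "\<one>\<^bsub>?X\<^esub>"]) (auto simp: open_unit_nbhd_def)
    ultimately have T: "\<forall>\<^sub>F x in nhdsin (topo ?X) (inc Y h). x \<in> ?T" by (rule X.eventually_nhdsin_open)
    have "a \<otimes>\<^bsub>?X\<^esub> z \<in> A" if a: "a \<in> B" and z: "z \<in> ?T" for a z
    proof -
      obtain w where w: "w \<in> V" "z = inc Y h \<otimes>\<^bsub>?X\<^esub> w" using z by (elim imageE)
      have ac: "a \<in> carrier ?X" using a B(2) by blast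
      have wc: "w \<in> carrier ?X" using X.unit_nbhd_carrier[OF V(1) w(1)] .
      have "a \<otimes>\<^bsub>?X\<^esub> z = (a \<otimes>\<^bsub>?X\<^esub> inv\<^bsub>?X\<^esub> y) \<otimes>\<^bsub>?X\<^esub> (v \<otimes>\<^bsub>?X\<^esub> w)"
        unfolding w(2) h(2) using ac wc yc h(1) by (simp add: X.m_assoc X.cancel_left)
      then show ?thesis using V1(2)[of "a \<otimes>\<^bsub>?X\<^esub> inv\<^bsub>?X\<^esub> y" "v \<otimes>\<^bsub>?X\<^esub> w"] B(3) a y(1) V(2) V(3)[OF v(1) w(1)] by auto
    qed
    then have "\<forall>\<^sub>F x in F'. x \<in> A"
      unfolding F'_def eventually_filter_mult using B(1) T
      by - (rule exI[of _ "\<lambda>x. x \<in> B"], rule exI[of _ "\<lambda>x. x \<in> ?T"], simp only: simp_thms, blast)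
    then have "F' \<in> U" using A(3) completion_pointsD(1)[OF F'(1)] F'(1) U'(2) by simp
    then show ?thesis using F'(2) by (intro image_eqI[of _ _ F']) simp_all
  qed
  then show ?thesis using W(1) by blast
qed

text \<open>Roundness makes every member of \<open>F\<close> meet \<open>H\<close>: a point of the member close to the kernel can be moved
  into the kernel by a small correction. The trace \<open>L\<close> of \<open>F\<close> on \<open>H\<close> is thus a proper Cauchy filter, and \<open>F\<close> is
  the neighbourhood filter of its limit because the two filters mesh.\<close>

lemma limit_of_kernel:
  assumes complete: "complete_top_group H" and F: "F \<in> completion_points" "limit_of F = \<one>\<^bsub>G\<^esub>"
  shows "\<exists>h\<in>carrier H. F = nhdsin (topo (mid Y)) (inc Y h)"
proof -
  let ?X = "mid Y"
  note f = completion_pointsD[OF F(1)]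
  have meet: "\<exists>h\<in>carrier H. P (inc Y h)" if P: "eventually P F" for P
  proof -
    obtain U where U: "open_unit_nbhd ?X U" "\<forall>\<^sub>F x in F. \<forall>u\<in>U. P (x \<otimes>\<^bsub>?X\<^esub> u)"
      by (rule X.minimal_Cauchy_round[OF f(1) P])
    obtain V where V: "open_unit_nbhd ?X V" "V \<subseteq> U" "\<And>v. v \<in> V \<Longrightarrow> inv\<^bsub>?X\<^esub> v \<in> V"
      using X.unit_nbhd_halve[OF U(1)] by metis
    obtain W where W: "open_unit_nbhd G W" "\<forall>d\<in>W \<inter> D. \<exists>u\<in>V. prj Y u = d" using prj_unit_nbhd[OF V(1)] by (elim exE conjE)
    have "\<forall>\<^sub>F x in F. prj Y x \<in> W" using f(2) F(2) W(1) by (simp add: limitin_def open_unit_nbhd_def)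
    from eventually_happens'[OF X.minimal_CauchyD(2)[OF f(1)]
      eventually_conj[OF this eventually_conj[OF X.minimal_CauchyD(3)[OF f(1)] U(2)]]]
    obtain x where x: "prj Y x \<in> W" "x \<in> carrier ?X" "\<forall>u\<in>U. P (x \<otimes>\<^bsub>?X\<^esub> u)" by (elim exE conjE)
    obtain v where v: "v \<in> V" "prj Y v = prj Y x" using W(2) x(1) prj_D[OF x(2)] by blast
    have vc: "v \<in> carrier ?X" using X.unit_nbhd_carrier[OF V(1) v(1)] .
    have "prj Y (x \<otimes>\<^bsub>?X\<^esub> inv\<^bsub>?X\<^esub> v) = \<one>\<^bsub>G\<^esub>"
      using x(2) vc v(2) prj_carrier[OF x(2)] by (simp add: prj_mult prj_inv del: p.hom_inv)
    then obtain h where "h \<in> carrier H" "x \<otimes>\<^bsub>?X\<^esub> inv\<^bsub>?X\<^esub> v = inc Y h"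
      using prj_eq_one[of "x \<otimes>\<^bsub>?X\<^esub> inv\<^bsub>?X\<^esub> v"] x(2) vc by auto
    moreover have "P (x \<otimes>\<^bsub>?X\<^esub> inv\<^bsub>?X\<^esub> v)" using x(3) V(2,3) v(1) by blast
    ultimately show ?thesis by (intro bexI[of _ h]) simp_all
  qed
  define L where "L = inf (filtercomap (inc Y) F) (principal (carrier H))"
  have evL: "eventually P L \<longleftrightarrow> (\<exists>Q. eventually Q F \<and> (\<forall>h\<in>carrier H. Q (inc Y h) \<longrightarrow> P h))" for P
    by (auto simp: L_def eventually_inf_principal eventually_filtercomap)
  have Lb: "L \<noteq> bot" unfolding trivial_limit_def evL using meet by blast
  have "Cauchy_filter_in H L"
  proof (rule H.Cauchy_filterI[OF Lb])
    show "\<forall>\<^sub>F x in L. x \<in> carrier H" unfolding evL by (intro exI[of _ "\<lambda>_. True"]) simp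
    fix U assume "open_unit_nbhd H U"
    from unit_nbhd_inc[OF this] obtain V where V: "open_unit_nbhd ?X V"
      "\<forall>h\<in>carrier H. inc Y h \<in> V \<longrightarrow> h \<in> U" by (elim exE conjE)
    obtain A where A: "\<forall>\<^sub>F x in F. x \<in> A" "A \<subseteq> carrier ?X" "\<forall>a\<in>A. \<forall>b\<in>A. a \<otimes>\<^bsub>?X\<^esub> inv\<^bsub>?X\<^esub> b \<in> V"
      using X.Cauchy_small_set[OF X.minimal_CauchyD(1)[OF f(1)] V(1)] by (elim exE conjE)
    have "a \<otimes>\<^bsub>H\<^esub> inv\<^bsub>H\<^esub> b \<in> U" if "a \<in> carrier H" "inc Y a \<in> A" "b \<in> carrier H" "inc Y b \<in> A" for a b
      using V(2)[rule_format, of "a \<otimes>\<^bsub>H\<^esub> inv\<^bsub>H\<^esub> b"] A(3) that by simp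
    moreover have "\<forall>\<^sub>F h in L. h \<in> {h \<in> carrier H. inc Y h \<in> A}" unfolding evL using A(1) by blast
    ultimately show "\<exists>A. (\<forall>\<^sub>F x in L. x \<in> A) \<and> (\<forall>a\<in>A. \<forall>b\<in>A. a \<otimes>\<^bsub>H\<^esub> inv\<^bsub>H\<^esub> b \<in> U)"
      by (intro exI[of _ "{h \<in> carrier H. inc Y h \<in> A}"]) simp
  qed
  then obtain l where l: "limitin (topo H) (\<lambda>x. x) l L" using complete unfolding complete_top_group_def by blast
  then have lc: "l \<in> carrier H" using limitin_topspace H.topspace_eq by metis
  have "F = nhdsin (topo ?X) (inc Y l)"
  proof (rule X.minimal_Cauchy_eqI[OF f(1) X.minimal_Cauchy_nhdsin[OF i.hom_closed[OF lc]]])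
    fix A B assume A: "eventually A F" and "eventually B (nhdsin (topo ?X) (inc Y l))"
    then obtain S where S: "openin (topo ?X) S" "inc Y l \<in> S" "\<forall>y\<in>S. B y"
      using X.eventually_nhdsin_carrier[OF i.hom_closed[OF lc]] by blast
    have "openin (topo H) {h \<in> carrier H. inc Y h \<in> S}"
      using openin_continuous_map_preimage[of "topo H" "topo ?X" "inc Y" S] inc_tg_hom S(1)
      by (simp add: tg_hom_def H.topspace_eq)
    then have "\<forall>\<^sub>F h in L. h \<in> {h \<in> carrier H. inc Y h \<in> S}" using l lc S(2) unfolding limitin_def by blast
    moreover have "\<forall>\<^sub>F h in L. A (inc Y h)" unfolding evL using A by blast
    ultimately obtain h where "inc Y h \<in> S" "A (inc Y h)"
      using eventually_happens'[OF Lb eventually_conj] by blast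
    then show "\<exists>x. A x \<and> B x" using S(3) by blast
  qed
  then show ?thesis using lc by blast
qed

lemma nhdsin_tg_hom_points: "nhdsin (topo (mid Y)) \<in> tg_hom (mid Y) (tg_sub C completion_points)"
  by (rule tg_hom_into_sub[OF X.nhdsin_tg_hom _ X.topspace_eq]) (use nhdsin_points(1) in blast)

lemma top_extension_completion:
  assumes Cech: "Cech_complete H"
  shows "top_extension G H completion_extension"
proof (intro top_extension.intro is_extensionI)
  have am: "almost_metrizable H" and co: "complete_top_group H" using Cech by (simp_all add: Cech_complete_def)
  show "top_ab_group (mid completion_extension)"
    using top_ab_group_sub[OF X.top_ab_group_Raikov subgroup_completion_points] by simp
  show "inc completion_extension \<in> tg_hom H (mid completion_extension)"
    using tg_hom_compose[OF inc_tg_hom nhdsin_tg_hom_points] by simp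
  show "prj completion_extension \<in> tg_hom (mid completion_extension) G" using limit_of_tg_hom by simp
  fix U assume "open_unit_nbhd H U"
  from unit_nbhd_inc[OF this] obtain V where V: "open_unit_nbhd (mid Y) V"
    "\<forall>h\<in>carrier H. inc Y h \<in> V \<longrightarrow> h \<in> U" by (elim exE conjE)
  let ?U = "{F. minimal_Cauchy (mid Y) F \<and> (\<forall>\<^sub>F x in F. x \<in> V)}"
  have "openin (topo C) ?U" "nhdsin (topo (mid Y)) \<one>\<^bsub>mid Y\<^esub> \<in> ?U"
    using V(1) X.openin_Raikov_basic X.minimal_Cauchy_nhdsin X.eventually_nhdsin_open[of V "\<one>\<^bsub>mid Y\<^esub>"]
    by (simp_all add: open_unit_nbhd_def)
  then have "open_unit_nbhd C ?U" by (simp add: open_unit_nbhd_def)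
  then have N: "open_unit_nbhd (tg_sub C completion_points) (?U \<inter> completion_points)"
    by (rule unit_nbhd_sub) (use nhdsin_points(1)[OF X.one_closed] in simp)
  have "h \<in> U" if "h \<in> carrier H" "nhdsin (topo (mid Y)) (inc Y h) \<in> ?U \<inter> completion_points" for h
    using V(2) that X.eventually_nhdsin_self[OF i.hom_closed[OF that(1)], of "\<lambda>x. x \<in> V"] by simp
  then show "\<exists>V. open_unit_nbhd (mid completion_extension) V \<and>
    (\<forall>h\<in>carrier H. inc completion_extension h \<in> V \<longrightarrow> h \<in> U)"
    unfolding completion_extension_simps using N by blast
next
  fix U assume "open_unit_nbhd (mid completion_extension) U"
  then show "\<exists>V. open_unit_nbhd G V \<and> V \<subseteq> prj completion_extension ` U"
    using limit_of_open Cech unfolding completion_extension_simps Cech_complete_def by blast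
next
  fix h assume h: "h \<in> carrier H" "inc completion_extension h = \<one>\<^bsub>mid completion_extension\<^esub>"
  then have "inc Y h = \<one>\<^bsub>mid Y\<^esub>" using X.nhdsin_eqD[of "inc Y h" "\<one>\<^bsub>mid Y\<^esub>"] by simp
  then show "h = \<one>\<^bsub>H\<^esub>" using inc_eqD[OF h(1) H.one_closed] by simp
next
  fix h assume h: "h \<in> carrier H"
  then show "prj completion_extension (inc completion_extension h) = \<one>\<^bsub>G\<^esub>"
    using nhdsin_points(2)[OF i.hom_closed[OF h]] prj_inc[OF h] by simp
next
  fix F assume "F \<in> carrier (mid completion_extension)" "prj completion_extension F = \<one>\<^bsub>G\<^esub>"
  then show "\<exists>h\<in>carrier H. F = inc completion_extension h"
    using limit_of_kernel Cech unfolding Cech_complete_def by simp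
next
  fix g assume "g \<in> carrier G"
  then show "\<exists>F\<in>carrier (mid completion_extension). prj completion_extension F = g"
    using point_over Cech unfolding Cech_complete_def by simp
qed (rule top_G H)+

lemma restrict_completion_equiv: "ext_equiv H Y (restrict_extension D completion_extension)"
proof -
  have "nhdsin (topo (mid Y)) \<in> tg_hom (mid Y)
    (tg_sub (tg_sub C completion_points) {F \<in> carrier (tg_sub C completion_points). limit_of F \<in> D})"
    using nhdsin_points prj_D
    by (intro tg_hom_into_sub[OF nhdsin_tg_hom_points _ X.topspace_eq] image_subsetI) (simp only: tg_sub_simps mem_Collect_eq simp_thms)
  then show ?thesis
    unfolding ext_equiv_def restrict_extension_simps completion_extension_simps
    using nhdsin_points(2) by (intro bexI[of _ "nhdsin (topo (mid Y))"]) simp_all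
qed

text \<open>The morphism sends \<open>x\<close> to the trace of its neighbourhood filter on the restriction, transported to
  the middle group of \<open>Y\<close> by \<open>S\<close>. Traces are proper because the restriction is dense, and round because \<open>S\<close> is
  open, as an equivalence of extensions.\<close>

lemma completion_unique:
  assumes E: "top_extension G H E" and Cech: "Cech_complete H"
    and eq: "ext_equiv H (restrict_extension D E) Y"
  shows "ext_equiv H E completion_extension"
proof -
  interpret E: top_extension G H E by fact
  let ?X = "mid Y" and ?Z = "{x \<in> carrier (mid E). prj E x \<in> D}"
  let ?R = "restrict_extension D E"
  interpret R: top_extension "tg_sub G D" H ?R by (rule top_extension_restrict[OF E D])
  obtain S where S: "S \<in> tg_hom (mid ?R) ?X" "\<And>h. h \<in> carrier H \<Longrightarrow> S (inc ?R h) = inc Y h"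
    "\<And>x. x \<in> carrier (mid ?R) \<Longrightarrow> prj Y (S x) = prj ?R x"
    using eq unfolding ext_equiv_def by blast
  have opn: "openin (topo ?X) (S ` U)" if "openin (topo (mid ?R)) U" for U
    by (rule ext_morphism_homeomorphic(2)[OF R.top_extension_axioms top_extension_axioms S(1) _ _ that])
      (simp_all only: S(2,3))
  have Sc: "S z \<in> carrier ?X" if "z \<in> ?Z" for z using tg_hom_closed[OF S(1)] that by simp
  have Sm: "S (x \<otimes>\<^bsub>mid E\<^esub> y) = S x \<otimes>\<^bsub>?X\<^esub> S y" if "x \<in> ?Z" "y \<in> ?Z" for x y
    using tg_hom_mult[OF S(1)] that by simp
  have Zm: "x \<otimes>\<^bsub>mid E\<^esub> y \<in> ?Z" if "x \<in> ?Z" "y \<in> ?Z" for x y using that by simp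
  have Si: "S (inv\<^bsub>mid E\<^esub> x) = inv\<^bsub>?X\<^esub> (S x)" and Zi: "inv\<^bsub>mid E\<^esub> x \<in> ?Z" if x: "x \<in> ?Z" for x
  proof -
    show i: "inv\<^bsub>mid E\<^esub> x \<in> ?Z" using x by simp
    have "S \<one>\<^bsub>mid E\<^esub> = \<one>\<^bsub>?X\<^esub>" using S(2)[OF H.one_closed] by simp
    then have "S (inv\<^bsub>mid E\<^esub> x) \<otimes>\<^bsub>?X\<^esub> S x = \<one>\<^bsub>?X\<^esub>" using Sm[OF i x] x by simp
    then show "S (inv\<^bsub>mid E\<^esub> x) = inv\<^bsub>?X\<^esub> (S x)" using X.inv_equality[OF _ Sc[OF x] Sc[OF i]] by simp
  qed
  have Zdense: "\<exists>z. z \<in> U \<inter> ?Z" if U: "openin (topo (mid E)) U" "x \<in> U" for U x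
  proof -
    obtain d where "d \<in> D" "d \<in> prj E ` U"
      using dense_meets[OF E.openin_prj_image[OF U(1)] imageI[OF U(2)]] by blast
    then show ?thesis using E.X.openin_carrier[OF U(1)] by auto
  qed
  define \<Phi> where "\<Phi> x = filtermap S (inf (nhdsin (topo (mid E)) x) (principal ?Z))" for x
  have ev: "eventually P (\<Phi> x) \<longleftrightarrow> (\<exists>U. openin (topo (mid E)) U \<and> x \<in> U \<and> (\<forall>z\<in>U \<inter> ?Z. P (S z)))"
    if "x \<in> carrier (mid E)" for P x
    unfolding \<Phi>_def eventually_filtermap eventually_inf_principal E.X.eventually_nhdsin_carrier[OF that] by blast
  have mc: "minimal_Cauchy ?X (\<Phi> x)" if x: "x \<in> carrier (mid E)" for x
    unfolding minimal_Cauchy_def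
  proof
    show "Cauchy_filter_in ?X (\<Phi> x)"
    proof (rule X.Cauchy_filterI)
      show "\<Phi> x \<noteq> bot" unfolding trivial_limit_def ev[OF x] using Zdense by blast
      show "\<forall>\<^sub>F y in \<Phi> x. y \<in> carrier ?X" unfolding ev[OF x]
        using x Sc E.X.openin_carrier_self by (intro exI[of _ "carrier (mid E)"]) simp
      fix U assume "open_unit_nbhd ?X U"
      then have "open_unit_nbhd (mid ?R) {x \<in> carrier (mid ?R). S x \<in> U}"
        by (rule tg_hom_unit_nbhd[OF S(1) R.X.top_ab_group_axioms X.top_ab_group_axioms])
      then obtain V where V: "open_unit_nbhd (mid E) V" "{x \<in> carrier (mid ?R). S x \<in> U} = V \<inter> ?Z"
        unfolding restrict_extension_simps by (rule unit_nbhd_subE)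
      then have "openin (topo (mid E)) V" "x \<otimes>\<^bsub>mid E\<^esub> inv\<^bsub>mid E\<^esub> x \<in> V" using x by (simp_all add: open_unit_nbhd_def)
      from E.X.div_nbhds[OF this(1) x x this(2)] obtain A B where AB: "openin (topo (mid E)) A" "openin (topo (mid E)) B"
        "x \<in> A" "x \<in> B" "\<forall>v\<in>A. \<forall>w\<in>B. v \<otimes>\<^bsub>mid E\<^esub> inv\<^bsub>mid E\<^esub> w \<in> V" by (elim exE conjE)
      have "S z \<otimes>\<^bsub>?X\<^esub> inv\<^bsub>?X\<^esub> (S z') \<in> U" if z: "z \<in> A \<inter> B \<inter> ?Z" "z' \<in> A \<inter> B \<inter> ?Z" for z z'
      proof -
        have zz: "z \<in> ?Z" "z' \<in> ?Z" using z by blast+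
        have "z \<otimes>\<^bsub>mid E\<^esub> inv\<^bsub>mid E\<^esub> z' \<in> V \<inter> ?Z" using AB(5) z Zm[OF zz(1) Zi[OF zz(2)]] by blast
        then have "S (z \<otimes>\<^bsub>mid E\<^esub> inv\<^bsub>mid E\<^esub> z') \<in> U" unfolding V(2)[symmetric] by blast
        then show ?thesis by (simp only: Sm[OF zz(1) Zi[OF zz(2)]] Si[OF zz(2)])
      qed
      then have "\<forall>a\<in>S ` (A \<inter> B \<inter> ?Z). \<forall>b\<in>S ` (A \<inter> B \<inter> ?Z). a \<otimes>\<^bsub>?X\<^esub> inv\<^bsub>?X\<^esub> b \<in> U"
        by (intro ballI, elim imageE, simp only:)
      moreover have "\<forall>\<^sub>F y in \<Phi> x. y \<in> S ` (A \<inter> B \<inter> ?Z)"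
        unfolding ev[OF x] using AB(1-4) by (intro exI[of _ "A \<inter> B"]) blast
      ultimately show "\<exists>A. (\<forall>\<^sub>F x in \<Phi> x. x \<in> A) \<and> (\<forall>a\<in>A. \<forall>b\<in>A. a \<otimes>\<^bsub>?X\<^esub> inv\<^bsub>?X\<^esub> b \<in> U)" by blast
    qed
    show "round_filter ?X (\<Phi> x)"
      unfolding round_filter_def
    proof (intro allI impI)
      fix P assume "eventually P (\<Phi> x)"
      then obtain U where U: "openin (topo (mid E)) U" "x \<in> U" "\<forall>z\<in>U \<inter> ?Z. P (S z)" unfolding ev[OF x] by blast
      then have "x \<otimes>\<^bsub>mid E\<^esub> \<one>\<^bsub>mid E\<^esub> \<in> U" using x by simp
      from E.X.mult_nbhds[OF U(1) x E.X.one_closed this] obtain V W where VW: "openin (topo (mid E)) V"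
        "openin (topo (mid E)) W" "x \<in> V" "\<one>\<^bsub>mid E\<^esub> \<in> W" "\<forall>v\<in>V. \<forall>w\<in>W. v \<otimes>\<^bsub>mid E\<^esub> w \<in> U" by (elim exE conjE)
      have "openin (topo (mid ?R)) (W \<inter> ?Z)" using VW(2) by (auto simp: openin_subtopology)
      from opn[OF this] have "openin (topo ?X) (S ` (W \<inter> ?Z))" .
      moreover have "\<one>\<^bsub>?X\<^esub> \<in> S ` (W \<inter> ?Z)"
        using VW(4) S(2)[OF H.one_closed] by (intro image_eqI[of _ _ "\<one>\<^bsub>mid E\<^esub>"]) simp_all
      ultimately have n: "open_unit_nbhd ?X (S ` (W \<inter> ?Z))" by (simp only: open_unit_nbhd_def)
      have "P (S z \<otimes>\<^bsub>?X\<^esub> S w)" if z: "z \<in> V \<inter> ?Z" and w: "w \<in> W \<inter> ?Z" for z w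
      proof -
        have zw: "z \<in> ?Z" "w \<in> ?Z" using z w by blast+
        have "z \<otimes>\<^bsub>mid E\<^esub> w \<in> U \<inter> ?Z" using VW(5) z w Zm[OF zw] by blast
        then have "P (S (z \<otimes>\<^bsub>mid E\<^esub> w))" using U(3) by blast
        then show ?thesis by (simp only: Sm[OF zw])
      qed
      then have "\<forall>z\<in>V \<inter> ?Z. \<forall>u\<in>S ` (W \<inter> ?Z). P (S z \<otimes>\<^bsub>?X\<^esub> u)"
        by (intro ballI, elim imageE, simp only:)
      then have "\<forall>\<^sub>F y in \<Phi> x. \<forall>u\<in>S ` (W \<inter> ?Z). P (y \<otimes>\<^bsub>?X\<^esub> u)"
        unfolding ev[OF x] using VW(1,3) by (intro exI[of _ V] conjI)
      then show "\<exists>U. open_unit_nbhd ?X U \<and> (\<forall>\<^sub>F y in \<Phi> x. \<forall>u\<in>U. P (y \<otimes>\<^bsub>?X\<^esub> u))" using n by blast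
    qed
  qed
  have lim: "limitin (topo G) (prj Y) (prj E x) (\<Phi> x)" if x: "x \<in> carrier (mid E)" for x
    unfolding limitin_def
  proof (intro conjI allI impI)
    show "prj E x \<in> topspace (topo G)" using x GG.topspace_eq by simp
    fix U assume U: "openin (topo G) U \<and> prj E x \<in> U"
    have "openin (topo (mid E)) {x \<in> carrier (mid E). prj E x \<in> U}"
      using openin_continuous_map_preimage[of "topo (mid E)" "topo G" "prj E" U] E.prj_tg_hom U
      by (simp add: tg_hom_def E.X.topspace_eq)
    moreover have "prj Y (S z) \<in> U" if "z \<in> {x \<in> carrier (mid E). prj E x \<in> U} \<inter> ?Z" for z
      using S(3)[of z] that by simp
    ultimately show "\<forall>\<^sub>F y in \<Phi> x. prj Y y \<in> U"
      unfolding ev[OF x] using x U by (intro exI[of _ "{x \<in> carrier (mid E). prj E x \<in> U}"]) simp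
  qed
  have pt: "\<Phi> x \<in> completion_points" and pl: "limit_of (\<Phi> x) = prj E x" if x: "x \<in> carrier (mid E)" for x
    using completion_pointsI[OF mc[OF x] lim[OF x]] limit_of_eq[OF mc[OF x] lim[OF x]] .
  have "\<Phi> \<in> hom (mid E) (tg_sub C completion_points)"
  proof (rule homI)
    fix x assume "x \<in> carrier (mid E)" then show "\<Phi> x \<in> carrier (tg_sub C completion_points)" using pt by simp
  next
    fix x y assume x: "x \<in> carrier (mid E)" and y: "y \<in> carrier (mid E)"
    have xy: "x \<otimes>\<^bsub>mid E\<^esub> y \<in> carrier (mid E)" using x y by simp
    have "filter_mult ?X (\<Phi> x) (\<Phi> y) = \<Phi> (x \<otimes>\<^bsub>mid E\<^esub> y)"
    proof (rule X.minimal_Cauchy_le_eq[OF _ mc[OF xy]])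
      show "minimal_Cauchy ?X (filter_mult ?X (\<Phi> x) (\<Phi> y))"
        by (rule X.minimal_Cauchy_mult[OF X.minimal_CauchyD(1)[OF mc[OF x]] mc[OF y]])
      show "filter_mult ?X (\<Phi> x) (\<Phi> y) \<le> \<Phi> (x \<otimes>\<^bsub>mid E\<^esub> y)"
      proof (rule filter_leI)
        fix P assume "eventually P (\<Phi> (x \<otimes>\<^bsub>mid E\<^esub> y))"
        then obtain U where U: "openin (topo (mid E)) U" "x \<otimes>\<^bsub>mid E\<^esub> y \<in> U" "\<forall>z\<in>U \<inter> ?Z. P (S z)" unfolding ev[OF xy] by blast
        from E.X.mult_nbhds[OF U(1) x y U(2)] obtain V W where VW: "openin (topo (mid E)) V"
          "openin (topo (mid E)) W" "x \<in> V" "y \<in> W" "\<forall>v\<in>V. \<forall>w\<in>W. v \<otimes>\<^bsub>mid E\<^esub> w \<in> U" by (elim exE conjE)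
        have "P (S z \<otimes>\<^bsub>?X\<^esub> S w)" if z: "z \<in> V \<inter> ?Z" and w: "w \<in> W \<inter> ?Z" for z w
        proof -
          have zw: "z \<in> ?Z" "w \<in> ?Z" using z w by blast+
          have "z \<otimes>\<^bsub>mid E\<^esub> w \<in> U \<inter> ?Z" using VW(5) z w Zm[OF zw] by blast
          then have "P (S (z \<otimes>\<^bsub>mid E\<^esub> w))" using U(3) by blast
          then show ?thesis by (simp only: Sm[OF zw])
        qed
        moreover have "\<forall>\<^sub>F v in \<Phi> x. v \<in> S ` (V \<inter> ?Z)" "\<forall>\<^sub>F w in \<Phi> y. w \<in> S ` (W \<inter> ?Z)"
          unfolding ev[OF x] ev[OF y] using VW(1-4) by blast+
        ultimately show "eventually P (filter_mult ?X (\<Phi> x) (\<Phi> y))"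
          unfolding eventually_filter_mult
          by - (rule exI[of _ "\<lambda>v. v \<in> S ` (V \<inter> ?Z)"], rule exI[of _ "\<lambda>w. w \<in> S ` (W \<inter> ?Z)"],
            intro conjI allI impI, assumption, assumption, elim imageE, simp only:)
      qed
    qed
    then show "\<Phi> (x \<otimes>\<^bsub>mid E\<^esub> y) = \<Phi> x \<otimes>\<^bsub>tg_sub C completion_points\<^esub> \<Phi> y" by simp
  qed
  then have "\<Phi> \<in> tg_hom (mid E) (mid completion_extension)"
    unfolding completion_extension_simps
  proof (intro tg_homI[OF E.X.top_ab_group_axioms top_ab_group_sub[OF X.top_ab_group_Raikov subgroup_completion_points]])
    fix V assume "open_unit_nbhd (tg_sub C completion_points) V"
    then obtain V' where V': "open_unit_nbhd C V'" "V = V' \<inter> completion_points" by (rule unit_nbhd_subE)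
    have S1: "S \<one>\<^bsub>mid E\<^esub> = \<one>\<^bsub>?X\<^esub>" using S(2)[OF H.one_closed] by simp
    obtain A where A: "openin (topo ?X) A" "\<forall>\<^sub>F x in nhdsin (topo ?X) \<one>\<^bsub>?X\<^esub>. x \<in> A"
      "\<forall>F'. minimal_Cauchy ?X F' \<longrightarrow> (\<forall>\<^sub>F x in F'. x \<in> A) \<longrightarrow> F' \<in> V'"
      using V'(1) unfolding open_unit_nbhd_def openin_Raikov Raikov_completion_simps by blast
    have "open_unit_nbhd ?X A" using A(1) X.eventually_nhdsin_self[OF X.one_closed A(2)] by (simp add: open_unit_nbhd_def)
    then have "open_unit_nbhd (mid ?R) {x \<in> carrier (mid ?R). S x \<in> A}"
      by (rule tg_hom_unit_nbhd[OF S(1) R.X.top_ab_group_axioms X.top_ab_group_axioms])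
    then obtain N where N: "open_unit_nbhd (mid E) N" "{x \<in> carrier (mid ?R). S x \<in> A} = N \<inter> ?Z"
      unfolding restrict_extension_simps by (rule unit_nbhd_subE)
    have "\<Phi> u \<in> V" if u: "u \<in> N" for u
    proof -
      have uc: "u \<in> carrier (mid E)" using E.X.unit_nbhd_carrier[OF N(1) u] .
      have "\<forall>z\<in>N \<inter> ?Z. S z \<in> A" unfolding N(2)[symmetric] by blast
      then have "\<forall>\<^sub>F x in \<Phi> u. x \<in> A" unfolding ev[OF uc] using N(1) u unfolding open_unit_nbhd_def by blast
      then show ?thesis using A(3) mc[OF uc] pt[OF uc] V'(2) by simp
    qed
    then show "\<exists>U. open_unit_nbhd (mid E) U \<and> (\<forall>u\<in>U. \<Phi> u \<in> V)" using N(1) by blast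
  qed
  moreover have "\<Phi> (inc E h) = inc completion_extension h" if h: "h \<in> carrier H" for h
  proof -
    have ic: "inc E h \<in> carrier (mid E)" using h by simp
    have iz: "inc E h \<in> ?Z" using h by simp
    have Sh: "S (inc E h) = inc Y h" using S(2)[OF h] by simp
    have "nhdsin (topo ?X) (inc Y h) = \<Phi> (inc E h)"
    proof (rule X.minimal_Cauchy_eqI[OF X.minimal_Cauchy_nhdsin[OF i.hom_closed[OF h]] mc[OF ic]])
      fix A B assume A: "eventually A (nhdsin (topo ?X) (inc Y h))" and B: "eventually B (\<Phi> (inc E h))"
      have "A (inc Y h)" by (rule X.eventually_nhdsin_self[OF i.hom_closed[OF h] A])
      moreover have "B (S (inc E h))" using B iz unfolding ev[OF ic] by blast
      ultimately show "\<exists>x. A x \<and> B x" unfolding Sh by blast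
    qed
    then show ?thesis by simp
  qed
  moreover have "prj completion_extension (\<Phi> x) = prj E x" if "x \<in> carrier (mid E)" for x
    using pl[OF that] by simp
  ultimately show ?thesis unfolding ext_equiv_def by blast
qed

end

section \<open>The isomorphism\<close>

locale two_top_groups =
  fixes G :: "'g top_group" and H :: "'h top_group"
  assumes G: "top_ab_group G" and H: "top_ab_group H"
begin

lemma extensions_iff: "E \<in> extensions G H \<longleftrightarrow> top_extension G H E"
  using G H by (simp add: extensions_def top_extension_def)

lemma equiv_ext_rel: "equiv (extensions G H) (ext_rel G H)"
proof (rule equivI)
  show "ext_rel G H \<subseteq> extensions G H \<times> extensions G H" by (auto simp: ext_rel_def)
  show "refl_on (extensions G H) (ext_rel G H)"
    by (auto simp: refl_on_def ext_rel_def ext_equiv_refl)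
  show "sym (ext_rel G H)"
    using ext_equiv_sym by (auto simp: sym_def ext_rel_def extensions_iff)
  show "trans (ext_rel G H)"
    by (auto simp: trans_def ext_rel_def intro: ext_equiv_trans)
qed

lemma ext_class_eq_Image: "E \<in> extensions G H \<Longrightarrow> ext_class G H E = ext_rel G H `` {E}"
  by (auto simp: ext_class_def ext_rel_def)

lemma ext_class_cong:
  assumes E: "top_extension G H E" and E': "top_extension G H E'" and eq: "ext_equiv H E E'"
  shows "ext_class G H E = ext_class G H E'"
  using ext_equiv_trans[OF eq] ext_equiv_trans[OF ext_equiv_sym[OF E E' eq]]
  by (auto simp: ext_class_def)

text \<open>A class may be given by an extension on an arbitrary type; its members live on the fixed type of
  \<open>extensions\<close>, and \<open>extension_representative\<close> provides one that links the two extensions.\<close>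

lemma ext_class_eqD:
  assumes E: "top_extension G H E" and E': "top_extension G H E'" and eq: "ext_class G H E = ext_class G H E'"
  shows "ext_equiv H E E'"
proof -
  have "group G" "group H" using G H by (auto simp: top_ab_group_def comm_group_def)
  then obtain R where R: "R \<in> extensions G H" "ext_equiv H E R"
    using extension_representative E unfolding top_extension_def by blast
  then have "R \<in> ext_class G H E'" using eq by (auto simp: ext_class_def)
  then have "ext_equiv H E' R" by (simp add: ext_class_def)
  then have "ext_equiv H R E'" using ext_equiv_sym E' R(1) extensions_iff by blast
  then show ?thesis using ext_equiv_trans R(2) by blast
qed

lemma ext_class_carrier:
  assumes E: "top_extension G H E"
  shows "ext_class G H E \<in> carrier (Ext G H)"
proof -
  have "group G" "group H" using G H by (auto simp: top_ab_group_def comm_group_def)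
  then obtain R where R: "R \<in> extensions G H" "ext_equiv H E R"
    using extension_representative E unfolding top_extension_def by blast
  then have "ext_class G H E = ext_rel G H `` {R}"
    using ext_class_cong[OF E _ R(2)] ext_class_eq_Image[OF R(1)] extensions_iff by simp
  then show ?thesis using R(1) by (simp add: Ext_def quotientI)
qed

lemma carrier_ExtE:
  assumes "A \<in> carrier (Ext G H)"
  obtains E where "top_extension G H E" "E \<in> extensions G H" "A = ext_class G H E"
  using assms ext_class_eq_Image extensions_iff unfolding Ext_def by (auto elim!: quotientE)

lemma mult_ext_class:
  assumes E: "top_extension G H E" "E \<in> extensions G H" and E': "top_extension G H E'" "E' \<in> extensions G H"
  shows "ext_class G H E \<otimes>\<^bsub>Ext G H\<^esub> ext_class G H E' = ext_class G H (Baer_sum G H E E')"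
proof -
  have c: "ext_class G H (Baer_sum G H F F') = ext_class G H (Baer_sum G H E E')"
    if F: "F \<in> ext_class G H E" "F' \<in> ext_class G H E'" for F F'
  proof -
    have f: "top_extension G H F" "top_extension G H F'" "ext_equiv H E F" "ext_equiv H E' F'"
      using F extensions_iff by (auto simp: ext_class_def)
    show ?thesis
      by (rule ext_class_cong[OF top_extension_Baer_sum[OF f(1,2)] top_extension_Baer_sum[OF E(1) E'(1)]
        Baer_sum_cong[OF E(1) E'(1) f(1,2) ext_equiv_sym[OF E(1) f(1,3)] ext_equiv_sym[OF E'(1) f(2,4)]]])
  qed
  have mem: "E \<in> ext_class G H E" "E' \<in> ext_class G H E'" using E(2) E'(2) by (simp_all add: ext_class_def ext_equiv_refl)
  then have "(\<Union>F\<in>ext_class G H E. \<Union>F'\<in>ext_class G H E'. ext_class G H (Baer_sum G H F F')) =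
      (\<Union>F\<in>ext_class G H E. \<Union>F'\<in>ext_class G H E'. ext_class G H (Baer_sum G H E E'))"
    using c by (intro SUP_cong refl)
  also have "\<dots> = ext_class G H (Baer_sum G H E E')"
    using mem by blast
  finally show ?thesis by (simp add: Ext_def)
qed

end

text \<open>Restriction on classes. The chosen representative does not matter, since restriction respects
  equivalence (\<open>ext_equiv_restrict\<close>).\<close>

definition restrict_class ::
  "'g top_group \<Rightarrow> 'h top_group \<Rightarrow> 'g set \<Rightarrow> ('h, 'h \<times> 'g, 'g) extn set \<Rightarrow> ('h, 'h \<times> 'g, 'g) extn set" where
  "restrict_class G H D A = ext_class (tg_sub G D) H (restrict_extension D (SOME E. E \<in> A))"

theorem theorem7:
  fixes G :: "'g top_group" and H :: "'h top_group" and D :: "'g set"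
  assumes "top_ab_group G"
    and "top_ab_group H" and "Cech_complete H"
    and "subgroup D G" and "topo G closure_of D = carrier G"
  shows "Ext G H \<cong> Ext (tg_sub G D) H"
proof -
  let ?D = "tg_sub G D"
  let ?r = "restrict_extension D :: ('h, 'h \<times> 'g, 'g) extn \<Rightarrow> ('h, 'h \<times> 'g, 'g) extn"
  interpret G: two_top_groups G H by (rule two_top_groups.intro) fact+
  interpret D: two_top_groups ?D H
    by (rule two_top_groups.intro[OF top_ab_group_sub[OF assms(1,4)] assms(2)])
  note tr = top_extension_restrict[OF _ assms(4)]
  have dense: "dense_extension G D H Y" if "top_extension ?D H Y" for Y :: "('h, 'y, 'g) extn"
    using that assms by (intro dense_extension.intro dense_extension_axioms.intro)
  have res: "restrict_class G H D (ext_class G H E) = ext_class ?D H (restrict_extension D E)"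
    if E: "top_extension G H E" for E :: "('h, 'x, 'g) extn"
  proof -
    have "ext_class G H E \<noteq> {}"
      using G.ext_class_carrier[OF E] G.equiv_ext_rel in_quotient_imp_non_empty by (force simp: Ext_def)
    define F where "F = (SOME E'. E' \<in> ext_class G H E)"
    have "F \<in> ext_class G H E" unfolding F_def using \<open>ext_class G H E \<noteq> {}\<close> by (simp only: some_in_eq simp_thms)
    then have F: "top_extension G H F" "ext_equiv H E F"
      by (simp_all add: G.extensions_iff ext_class_def)
    show ?thesis unfolding restrict_class_def F_def[symmetric]
      by (rule D.ext_class_cong[OF tr[OF E] tr[OF F(1)] ext_equiv_restrict[OF E F(2) assms(4)], symmetric])
  qed
  have "restrict_class G H D \<in> hom (Ext G H) (Ext ?D H)"
  proof (rule homI)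
    fix A assume "A \<in> carrier (Ext G H)"
    then obtain E where E: "top_extension G H E" "E \<in> extensions G H" "A = ext_class G H E" by (elim G.carrier_ExtE)
    then show "restrict_class G H D A \<in> carrier (Ext ?D H)"
      using D.ext_class_carrier[OF tr[OF E(1)]] res[OF E(1)] by simp
  next
    fix A B assume "A \<in> carrier (Ext G H)" "B \<in> carrier (Ext G H)"
    then obtain E F where E: "top_extension G H E" "E \<in> extensions G H" "A = ext_class G H E"
      and F: "top_extension G H F" "F \<in> extensions G H" "B = ext_class G H F" by (elim G.carrier_ExtE)
    have rE: "?r E \<in> extensions ?D H" and rF: "?r F \<in> extensions ?D H"
      using tr[OF E(1)] tr[OF F(1)] D.extensions_iff by simp_all
    have "restrict_class G H D (A \<otimes>\<^bsub>Ext G H\<^esub> B) = ext_class ?D H (restrict_extension D (Baer_sum G H E F))"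
      unfolding E(3) F(3) G.mult_ext_class[OF E(1,2) F(1,2)] by (rule res[OF top_extension_Baer_sum[OF E(1) F(1)]])
    also have "\<dots> = ext_class ?D H (Baer_sum ?D H (?r E) (?r F))"
      by (rule D.ext_class_cong[symmetric, OF top_extension_Baer_sum[OF tr[OF E(1)] tr[OF F(1)]]
          tr[OF top_extension_Baer_sum[OF E(1) F(1)]] Baer_sum_restrict[OF E(1) F(1) assms(4)]])
    also have "\<dots> = restrict_class G H D A \<otimes>\<^bsub>Ext ?D H\<^esub> restrict_class G H D B"
      unfolding E(3) F(3) res[OF E(1)] res[OF F(1)]
      by (rule D.mult_ext_class[OF tr[OF E(1)] rE tr[OF F(1)] rF, symmetric])
    finally show "restrict_class G H D (A \<otimes>\<^bsub>Ext G H\<^esub> B) =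
      restrict_class G H D A \<otimes>\<^bsub>Ext ?D H\<^esub> restrict_class G H D B" .
  qed
  moreover have "bij_betw (restrict_class G H D) (carrier (Ext G H)) (carrier (Ext ?D H))"
    unfolding bij_betw_def
  proof
    show "inj_on (restrict_class G H D) (carrier (Ext G H))"
    proof (rule inj_onI)
      fix A B assume "A \<in> carrier (Ext G H)" "B \<in> carrier (Ext G H)"
        and eq: "restrict_class G H D A = restrict_class G H D B"
      then obtain E F where E: "top_extension G H E" "E \<in> extensions G H" "A = ext_class G H E"
        and F: "top_extension G H F" "F \<in> extensions G H" "B = ext_class G H F" by (elim G.carrier_ExtE)
      have r: "ext_equiv H (?r F) (?r E)"
        using D.ext_class_eqD[OF tr[OF F(1)] tr[OF E(1)]] eq res[OF E(1)] res[OF F(1)] E(3) F(3) by simp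
      interpret dense_extension G D H "?r E" by (rule dense[OF tr[OF E(1)]])
      note c = top_extension_completion[OF assms(3)]
      have "ext_equiv H E completion_extension" by (rule completion_unique[OF E(1) assms(3) ext_equiv_refl])
      moreover have "ext_equiv H F completion_extension" by (rule completion_unique[OF F(1) assms(3) r])
      ultimately show "A = B"
        using G.ext_class_cong[OF E(1) c] G.ext_class_cong[OF F(1) c] E(3) F(3) by simp
    qed
    show "restrict_class G H D ` carrier (Ext G H) = carrier (Ext ?D H)"
    proof
      show "restrict_class G H D ` carrier (Ext G H) \<subseteq> carrier (Ext ?D H)"
        using calculation by (auto simp: hom_def)
      show "carrier (Ext ?D H) \<subseteq> restrict_class G H D ` carrier (Ext G H)"
      proof
        fix B assume "B \<in> carrier (Ext ?D H)"
        then obtain Y where Y: "top_extension ?D H Y" "Y \<in> extensions ?D H" "B = ext_class ?D H Y" by (elim D.carrier_ExtE)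
        interpret dense_extension G D H Y by (rule dense[OF Y(1)])
        note c = top_extension_completion[OF assms(3)]
        have "restrict_class G H D (ext_class G H completion_extension) = B"
          unfolding res[OF c] Y(3)
          by (rule D.ext_class_cong[OF Y(1) tr[OF c] restrict_completion_equiv, symmetric])
        then show "B \<in> restrict_class G H D ` carrier (Ext G H)"
          using G.ext_class_carrier[OF c] by blast
      qed
    qed
  qed
  ultimately show ?thesis by (intro is_isoI[of "restrict_class G H D"]) (simp add: iso_def)
qed

end
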